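(* Consider the multi-agent system $$\dot x_i(t)=Ax_i(t)+\sum_{j=1}^{3}B_ju_i(t-\tau_j),\qquad i\in\{1,\dots,N\},$$ where $N\ge 1$ is an integer, $x_i(t)\in\mathbf{R}^n$ and $u_i(t)\in\mathbf{R}^m$ are the state and control of Agent $i$, $A\in\mathbf{R}^{n\times n}$, $B_j\in\mathbf{R}^{n\times m}$ are constant matrices, and $0\le\tau_1\le\tau_2\le\tau_3<\infty$ are constants. Let $\tau=\tau_1+\tau_2+\tau_3$ and $B=\mathrm{e}^{-A\tau_1}B_1+\mathrm{e}^{-A\tau_2}B_2+\mathrm{e}^{-A\tau_3}B_3$. Assume that $(A,B)$ is controllable and all the eigenvalues of $A$ are on the imaginary axis, and that the communication topology $\mathcal{G}(\mathcal{N},\mathcal{E},\mathcal{A})$, a weighted directed graph on the $N$ agents with weighted adjacency matrix $\mathcal{A}=[\alpha_{ij}]\in\mathbf{R}^{N\times N}$ and Laplacian $L=[l_{ij}]\in\mathbf{R}^{N\times N}$, contains a directed spanning tree. Let $0,\lambda_2,\dots,\lambda_N$ be the eigenvalues of $L$, where $\operatorname{Re}\{\lambda_i\}>0$ for $i\in\{2,\dots,N\}$. For $\gamma>0$ let $F=F(\gamma)=-B^{\mathrm{T}}P$, where $P=P(\gamma)>0$ is the unique positive definite solution to $$A^{\mathrm{T}}P+PA-PBB^{\mathrm{T}}P=-\gamma P,$$ and let $\mu$ be any positive number such that $$\mu\ge\max_{i\in\{2,\dots,N\}}\left\{\frac{1}{\operatorname{Re}\{\lambda_i\}}\right\}.$$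 Then, for any delay $\tau$ that is exactly known and can be arbitrarily large yet bounded, there exists a number $\gamma^{\ast}=\gamma^{\ast}(\mu,\tau,\{\lambda_i\}_{i=2}^{N})>0$ such that for every $\gamma\in(0,\gamma^{\ast})$ the consensus of the multi-agent system is achieved by the protocol $$u_i(t)=\mu F\mathrm{e}^{(A+BF)\tau}\mathrm{e}^{-A\tau}z_i(t),\qquad i\in\{1,\dots,N\},\qquad z_i(t)=\sum_{j=1}^{N}l_{ij}x_j(t).$$ Moreover, the reference trajectory $s(t)\in\mathbf{R}^n$ of the agents, i.e. a signal satisfying $\lim_{t\to\infty}\|x_i(t)-s(t)\|=0$ for all $i\in\{1,\dots,N\}$, exists and satisfies $$\|s(t)\|\le k\left(1+t^{N^{\ast}-1}\right),\qquad\forall t\ge 0,$$ where $N^{\ast}$ is the maximal algebraic multiplicity of the eigenvalues of $A$ and $k$ is a positive function of the initial conditions.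
   Context: The multi-agent system achieves consensus if $\lim_{t\to\infty}\|x_i(t)-x_j(t)\|=0$ for all $i,j\in\{1,\dots,N\}$ (for all initial conditions). If consensus is achieved, there is a signal $s(t)\in\mathbf{R}^n$ (possibly unbounded) with $\lim_{t\to\infty}\|x_i(t)-s(t)\|=0$ for all $i$, called the reference trajectory (or reference signal); it is determined only up to a signal tending to $0$, and the bound on $s$ is understood as the existence of such a signal satisfying it. The graph Laplacian is the standard one for a weighted directed graph with nonnegative weights $\alpha_{ij}$ and no self-loops: $l_{ii}=\sum_{j\ne i}\alpha_{ij}$ and $l_{ij}=-\alpha_{ij}$ for $i\ne j$, so that $z_i(t)=\sum_{j:\alpha_{ij}\ne0}\alpha_{ij}(x_i(t)-x_j(t))$. It is known that if the graph contains a directed spanning tree then $0$ is a simple eigenvalue of $L$ and the others have positive real part. It is also known that, under the assumption on $(A,B)$, the displayed Riccati equation has a unique positive definite solution for every $\gamma>0$. For $N=1$ the condition on $\mu$ (a maximum over an empty set) is vacuous. *)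

theory Defs
  imports "HOL-Analysis.Analysis" "HOL-Computational_Algebra.Polynomial"
begin

section \<open>Matrices\<close>

text \<open>
  The type \<^typ>\<open>real^'n^'n\<close> is not a Banach algebra under \<^const>\<open>matrix_matrix_mult\<close> (its
  \<^const>\<open>times\<close> is componentwise), so the library function \<^const>\<open>exp\<close> cannot be used for
  the matrix exponential.
\<close>

primrec matrix_power :: "real^'n^'n \<Rightarrow> nat \<Rightarrow> real^'n^'n" where
  "matrix_power A 0 = mat 1"
| "matrix_power A (Suc k) = A ** matrix_power A k"

definition matrix_exp :: "real^'n^'n \<Rightarrow> real^'n^'n" where
  "matrix_exp A = (\<Sum>k. (1 / fact k) *\<^sub>R matrix_power A k)"

definition positive_definite :: "real^'n^'n \<Rightarrow> bool" where
  "positive_definite P \<longleftrightarrow> transpose P = P \<and> (\<forall>v. v \<noteq> 0 \<longrightarrow> 0 < v \<bullet> (P *v v))"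

definition eigenvalues :: "real^'n^'n \<Rightarrow> complex set" where
  "eigenvalues A = {a. \<exists>v. v \<noteq> 0 \<and> map_matrix complex_of_real A *v v = a *s v}"

definition charpoly :: "real^'n^'n \<Rightarrow> complex poly" where
  "charpoly A = det (\<chi> i j. (if i = j then [:0, 1:] else 0) - [:complex_of_real (A $ i $ j):])"

definition algebraic_multiplicity :: "real^'n^'n \<Rightarrow> complex \<Rightarrow> nat" where
  "algebraic_multiplicity A a = order a (charpoly A)"

definition max_algebraic_multiplicity :: "real^'n^'n \<Rightarrow> nat" where
  "max_algebraic_multiplicity A = Max (algebraic_multiplicity A ` eigenvalues A)"


section \<open>Linear systems\<close>

text \<open>
  The pair \<open>(A, B)\<close> is controllable if every state of \<open>x' = A x + B u\<close> can be steered to every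
  other state in finite time.  The restriction to continuous inputs is customary and immaterial.
\<close>

definition controllable :: "real^'n^'n \<Rightarrow> real^'m^'n \<Rightarrow> bool" where
  "controllable A B \<longleftrightarrow>
     (\<forall>x0 x1. \<exists>T>0. \<exists>(u :: real \<Rightarrow> real^'m) (x :: real \<Rightarrow> real^'n).
        continuous_on {0..T} u \<and> x 0 = x0 \<and> x T = x1 \<and>
        (\<forall>t\<in>{0..T}. (x has_vector_derivative (A *v x t + B *v u t)) (at t within {0..T})))"

definition riccati_solution :: "real^'n^'n \<Rightarrow> real^'m^'n \<Rightarrow> real \<Rightarrow> real^'n^'n \<Rightarrow> bool" where
  "riccati_solution A B \<gamma> P \<longleftrightarrow>
     transpose A ** P + P ** A - P ** B ** transpose B ** P = - (\<gamma> *\<^sub>R P)"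


section \<open>Weighted directed graphs\<close>

text \<open>
  A graph is given by its weighted adjacency matrix.  The weight \<open>W $ i $ j\<close> is that of the edge from
  \<open>j\<close> to \<open>i\<close>, along which agent \<open>i\<close> receives information from agent \<open>j\<close>.
\<close>

definition weighted_adjacency :: "real^'v^'v \<Rightarrow> bool" where
  "weighted_adjacency W \<longleftrightarrow> (\<forall>i j. 0 \<le> W $ i $ j) \<and> (\<forall>i. W $ i $ i = 0)"

definition edges :: "real^'v^'v \<Rightarrow> ('v \<times> 'v) set" where
  "edges W = {(j, i). W $ i $ j \<noteq> 0}"

definition directed_tree :: "'v rel \<Rightarrow> bool" where
  "directed_tree T \<longleftrightarrow>
     (\<exists>r. (\<forall>j. (j, r) \<notin> T) \<and> (\<forall>i. i \<noteq> r \<longrightarrow> (\<exists>!j. (j, i) \<in> T)) \<and> (\<forall>i. (r, i) \<in> T\<^sup>*))"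

definition has_directed_spanning_tree :: "real^'v^'v \<Rightarrow> bool" where
  "has_directed_spanning_tree W \<longleftrightarrow> (\<exists>T \<subseteq> edges W. directed_tree T)"

definition laplacian :: "real^'v^'v \<Rightarrow> real^'v^'v" where
  "laplacian W = (\<chi> i j. if i = j then (\<Sum>k\<in>UNIV - {i}. W $ i $ k) else - (W $ i $ j))"


section \<open>The multi-agent system\<close>

text \<open>The input matrices are \<open>B 1, B 2, B 3\<close> and the delays are \<open>d 1, d 2, d 3\<close>.\<close>

definition delayed_input_matrix ::
    "real^'n^'n \<Rightarrow> (nat \<Rightarrow> real^'m^'n) \<Rightarrow> (nat \<Rightarrow> real) \<Rightarrow> real^'m^'n" where
  "delayed_input_matrix A B d = (\<Sum>j=1..3. matrix_exp (- (d j *\<^sub>R A)) ** B j)"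

definition feedback_gain ::
    "real^'n^'n \<Rightarrow> (nat \<Rightarrow> real^'m^'n) \<Rightarrow> (nat \<Rightarrow> real) \<Rightarrow> real^'n^'n \<Rightarrow> real^'n^'m" where
  "feedback_gain A B d P = - (transpose (delayed_input_matrix A B d) ** P)"

text \<open>
  Trajectories live on \<open>[- d 3, \<infinity>)\<close>; their restriction to \<open>[- d 3, 0]\<close> is the initial condition.
  At \<open>t = 0\<close> the derivative is the right derivative.
\<close>

definition agent_dynamics ::
    "real^'n^'n \<Rightarrow> (nat \<Rightarrow> real^'m^'n) \<Rightarrow> (nat \<Rightarrow> real) \<Rightarrow>
     ('v \<Rightarrow> real \<Rightarrow> real^'m) \<Rightarrow> ('v \<Rightarrow> real \<Rightarrow> real^'n) \<Rightarrow> bool" where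
  "agent_dynamics A B d u x \<longleftrightarrow>
     (\<forall>i. continuous_on {- d 3..} (x i) \<and>
       (\<forall>t\<ge>0. (x i has_vector_derivative (A *v x i t + (\<Sum>j=1..3. B j *v u i (t - d j))))
                (at t within {0..})))"

definition relative_state ::
    "real^'v^'v \<Rightarrow> ('v \<Rightarrow> real \<Rightarrow> real^'n) \<Rightarrow> 'v \<Rightarrow> real \<Rightarrow> real^'n" where
  "relative_state W x i t = (\<Sum>j\<in>UNIV. laplacian W $ i $ j *\<^sub>R x j t)"

definition consensus_protocol ::
    "real^'n^'n \<Rightarrow> real^'m^'n \<Rightarrow> real^'n^'m \<Rightarrow> real \<Rightarrow> real \<Rightarrow> real \<Rightarrow> real^'v^'v \<Rightarrow>
     ('v \<Rightarrow> real \<Rightarrow> real^'m) \<Rightarrow> ('v \<Rightarrow> real \<Rightarrow> real^'n) \<Rightarrow> bool" where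
  "consensus_protocol A B F \<mu> \<tau> h W u x \<longleftrightarrow>
     (\<forall>i. \<forall>t\<ge>- h. u i t =
        \<mu> *\<^sub>R (F *v (matrix_exp (\<tau> *\<^sub>R (A + B ** F)) *v
               (matrix_exp (- (\<tau> *\<^sub>R A)) *v relative_state W x i t))))"

definition closed_loop_trajectory ::
    "real^'n^'n \<Rightarrow> (nat \<Rightarrow> real^'m^'n) \<Rightarrow> (nat \<Rightarrow> real) \<Rightarrow> real^'n^'m \<Rightarrow> real \<Rightarrow> real^'v^'v \<Rightarrow>
     ('v \<Rightarrow> real \<Rightarrow> real^'n) \<Rightarrow> ('v \<Rightarrow> real \<Rightarrow> real^'n) \<Rightarrow> bool" where
  "closed_loop_trajectory A B d F \<mu> W \<phi> x \<longleftrightarrow>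
     (\<forall>i. \<forall>\<theta>\<in>{- d 3..0}. x i \<theta> = \<phi> i \<theta>) \<and>
     (\<exists>u. agent_dynamics A B d u x \<and>
          consensus_protocol A (delayed_input_matrix A B d) F \<mu> (\<Sum>j=1..3. d j) (d 3) W u x)"

definition consensus :: "('v \<Rightarrow> real \<Rightarrow> real^'n) \<Rightarrow> bool" where
  "consensus x \<longleftrightarrow> (\<forall>i j. ((\<lambda>t. norm (x i t - x j t)) \<longlongrightarrow> 0) at_top)"

definition reference_trajectory :: "('v \<Rightarrow> real \<Rightarrow> real^'n) \<Rightarrow> (real \<Rightarrow> real^'n) \<Rightarrow> bool" where
  "reference_trajectory x s \<longleftrightarrow> (\<forall>i. ((\<lambda>t. norm (x i t - s t)) \<longlongrightarrow> 0) at_top)"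

end

theory Submission
  imports Defs "HOL-Computational_Algebra.Fundamental_Theorem_Algebra"
    "HOL-Computational_Algebra.Field_as_Ring" "HOL-Computational_Algebra.Polynomial_Factorial"
begin

text \<open>
  By Cayley--Hamilton for the Laplacian, acting with the factors \<open>L - \<lambda>\<^sub>i\<close> one at a time splits the network
  into a cascade of single modes \<open>y' = A y + \<Sum>j. B\<^sub>j u(t - \<tau>\<^sub>j)\<close>, \<open>u = \<mu> K (\<lambda>\<^sub>i y + g)\<close>, where the
  forcing \<open>K g\<close>, coming from the next mode, is square integrable.  For the predicted state \<open>w\<close>, with
  \<open>w' = A w + B u\<close>, the Lyapunov function \<open>V = w\<^sup>* P w\<close> satisfies
  \<open>V' \<le> - \<gamma> V - |F w|\<^sup>2 / 2 + 2 |e|\<^sup>2\<close> with \<open>e = u - \<mu> \<lambda>\<^sub>i F w\<close>, and up to forcing \<open>|e|\<^sup>2\<close> is bounded by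
  \<open>O(|P|\<^sup>2)\<close> times the integral of \<open>|F w|\<^sup>2 + |e|\<^sup>2\<close> over the last \<open>\<tau>\<close> time units.  As \<open>P \<longlongrightarrow> 0\<close> for
  \<open>\<gamma> \<longlongrightarrow> 0\<close>, integrating absorbs the error: \<open>V \<longlongrightarrow> 0\<close>, and \<open>K y\<close> is square integrable again.
  The projection of \<open>L\<close> onto its kernel gives a combination \<open>s\<close> of the states with \<open>s' = A s\<close>; its growth
  is read off from the characteristic polynomial of \<open>A\<close>.
\<close>

section \<open>The action of polynomials on vectors\<close>

text \<open>The Laplacian need not be diagonalisable and its eigenvalues may be complex; hence
  polynomials in L in place of eigenvectors, and complex modes of a real plant. Only square
  integrability is passed along the cascade because no decay rate of a mode is ever established.

  The obstacle within a mode is that both the decay rate \<gamma> of V and the lower bound of P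
  degenerate as \<gamma> tends to 0, so an error measured by |w| could not be absorbed uniformly.
  All errors are therefore measured by |F w|, whose dissipation survives the limit; it comes from
  \<mu> Re \<lambda> \<ge> 1. The error e has two sources: the protocol acts on y instead of w, and
  the product of exponentials in it is not the identity. Either defect is an integral of inputs, or
  of F along an orbit, over the last \<tau> time units, and F stands in front of it; this is where
  the factor O(|P|) arises. Since u contains e again, e is bounded by its own past, and only
  integration over time closes the estimate. The imaginary spectrum of A and controllability,
  through the Hautus test, are what makes P small.\<close>

definition poly_act :: "'a::comm_ring_1^'n^'n \<Rightarrow> 'a poly \<Rightarrow> 'a^'n \<Rightarrow> 'a^'n" where
  "poly_act M p x = fold_coeffs (\<lambda>a y. a *s x + M *v y) p 0"

lemma poly_act_0 [simp]: "poly_act M 0 x = 0"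
  by (simp add: poly_act_def)

text \<open>Horner's rule for p(M) x. The polynomial acts on vectors because the ring product on the
  matrix type is componentwise, so that \<open>poly\<close> at a matrix would not be p(M).\<close>

lemma poly_act_pCons [simp]: "poly_act M (pCons a p) x = a *s x + M *v poly_act M p x"
  by (cases "p = 0 \<and> a = 0") (auto simp: poly_act_def)

lemma poly_act_zero_right [simp]: "poly_act M p 0 = 0"
  by (induction p) auto

lemma poly_act_add_left: "poly_act M (p + q) x = poly_act M p x + poly_act M q x"
proof (induction p q rule: poly_induct2)
  case (pCons a p b q)
  then show ?case
    by (simp add: vector_sadd_rdistrib matrix_vector_right_distrib)
qed simp

lemma poly_act_sum_left: "poly_act M (sum f S) x = (\<Sum>i\<in>S. poly_act M (f i) x)"
  by (induction S rule: infinite_finite_induct) (auto simp: poly_act_add_left)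

lemma poly_act_add: "poly_act M p (x + y) = poly_act M p x + poly_act M p y"
  by (induction p) (auto simp: vector_add_ldistrib matrix_vector_right_distrib)

lemma matrix_vector_mult_smult: "M *v (c *s x) = c *s (M *v x)" for M :: "'a::comm_ring_1^'n^'m"
  by (simp add: vec_eq_iff matrix_vector_mult_def sum_distrib_left mult.left_commute)

lemma poly_act_scale: "poly_act M p (c *s x) = c *s poly_act M p x"
  by (induction p)
     (auto simp: vector_add_ldistrib vector_smult_assoc mult.commute matrix_vector_mult_smult)

lemma poly_act_sum: "poly_act M p (sum f S) = (\<Sum>i\<in>S. poly_act M p (f i))"
  by (induction S rule: infinite_finite_induct) (auto simp: poly_act_add)

lemma poly_act_diff: "poly_act M p (x - y) = poly_act M p x - poly_act M p y"
proof -
  have "poly_act M p (x - y) + poly_act M p y = poly_act M p x"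
    by (simp flip: poly_act_add)
  then show ?thesis by (simp add: algebra_simps)
qed

lemma poly_act_smult_left: "poly_act M (smult c p) x = c *s poly_act M p x"
  by (induction p)
     (auto simp: vector_add_ldistrib vector_smult_assoc matrix_vector_mult_smult)

lemma poly_act_mult: "poly_act M (p * q) x = poly_act M p (poly_act M q x)"
  by (induction p) (auto simp: poly_act_add_left poly_act_smult_left)

lemma poly_act_1 [simp]: "poly_act M 1 x = x"
  by (simp add: one_pCons)

lemma poly_act_linear_factor: "poly_act M [:- a, 1:] x = M *v x - a *s x"
  by (simp add: vector_sneg_minus1 vector_smult_assoc)

lemma poly_act_mult_commute: "poly_act M p (poly_act M q x) = poly_act M q (poly_act M p x)"
  by (metis poly_act_mult mult.commute)

text \<open>For the bilinear pairing, without conjugation, p of the transpose is adjoint to p of M.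
  With unit vectors for x and y this turns columns of p(M) into rows.\<close>

lemma poly_act_transpose:
  "(\<Sum>k\<in>UNIV. poly_act (transpose M) p x $ k * y $ k) = (\<Sum>k\<in>UNIV. x $ k * poly_act M p y $ k)"
proof (induction p arbitrary: x y)
  case (pCons a p)
  have adj: "(\<Sum>k\<in>UNIV. (transpose M *v u) $ k * y $ k) = (\<Sum>k\<in>UNIV. u $ k * (M *v y) $ k)" for u y
    unfolding matrix_vector_mult_def transpose_def
    by (simp add: sum_distrib_left sum_distrib_right, subst sum.swap) (simp add: mult_ac)
  have com: "poly_act M p (M *v y) = M *v poly_act M p y"
    using poly_act_mult_commute[of M p "[:0, 1:]" y] by simp
  have "(\<Sum>k\<in>UNIV. poly_act (transpose M) (pCons a p) x $ k * y $ k)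
      = a * (\<Sum>k\<in>UNIV. x $ k * y $ k) + (\<Sum>k\<in>UNIV. x $ k * poly_act M p (M *v y) $ k)"
    by (simp add: distrib_right sum.distrib adj pCons sum_distrib_left mult.assoc
        del: transpose_matrix_vector)
  also have "\<dots> = (\<Sum>k\<in>UNIV. x $ k * poly_act M (pCons a p) y $ k)"
    by (simp add: com distrib_left sum.distrib sum_distrib_left mult.left_commute)
  finally show ?case .
qed simp

section \<open>Cofactors and the Cayley-Hamilton theorem\<close>

lemma det_replace_row:
  fixes M :: "'a::comm_ring_1^'n^'n"
  shows "det (\<chi> l. if l = j then v else M $ l)
       = (\<Sum>k\<in>UNIV. v $ k * det (\<chi> l. if l = j then axis k 1 else M $ l))"
proof -
  have v: "v = (\<Sum>k\<in>UNIV. v $ k *s axis k 1)"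
    by (simp add: vec_eq_iff axis_def if_distrib sum.delta cong: if_cong)
  have "det (\<chi> l. if l = j then v else M $ l)
      = det (\<chi> l. if l = j then (\<Sum>k\<in>UNIV. v $ k *s axis k 1) else M $ l)"
    by (subst v) (rule refl)
  also have "\<dots> = (\<Sum>k\<in>UNIV. det (\<chi> l. if l = j then v $ k *s axis k 1 else M $ l))"
    by (rule det_linear_row_sum) simp
  also have "\<dots> = (\<Sum>k\<in>UNIV. v $ k * det (\<chi> l. if l = j then axis k 1 else M $ l))"
    by (simp add: det_row_mul)
  finally show ?thesis .
qed

text \<open>The sum is the determinant of M with row j replaced by row i: this is M itself if i = j,
  and has two equal rows otherwise.\<close>

lemma cofactor_expansion:
  fixes M :: "'a::comm_ring_1^'n^'n"
  shows "(\<Sum>k\<in>UNIV. M $ i $ k * det (\<chi> l. if l = j then axis k 1 else M $ l))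
       = (if i = j then det M else 0)"
proof (cases "i = j")
  case True
  have "(\<chi> l. if l = j then M $ j else M $ l) = M"
    by (simp add: vec_eq_iff)
  with True show ?thesis by (simp flip: det_replace_row)
next
  case False
  have "det (\<chi> l. if l = j then M $ i else M $ l) = 0"
    by (rule det_identical_rows[OF False]) (simp add: row_def vec_eq_iff False)
  with False show ?thesis by (simp flip: det_replace_row)
qed

text \<open>Cayley--Hamilton: act with the cofactors of \<open>X I - M\<close> on the relations \<open>\<Sum>i. (X I - M) $ i $ k \<cdot> e\<^sub>i = 0\<close>.\<close>

theorem cayley_hamilton:
  fixes M :: "'a::comm_ring_1^'n^'n"
  shows "poly_act M (det (\<chi> i j. (if i = j then [:0, 1:] else 0) - [:M $ i $ j:])) x = 0"
proof -
  define X where "X = (\<chi> i j. (if i = j then [:0, 1:] else 0) - [:M $ i $ j:])"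
  define C where "C j k = det (\<chi> l. if l = j then axis k 1 else X $ l)" for j k
  have col: "(\<Sum>i\<in>UNIV. poly_act M (X $ i $ k) (axis i 1)) = 0" for k
  proof -
    have "poly_act M (X $ i $ k) (axis i 1)
        = (if i = k then M *v axis k 1 else 0) - M $ i $ k *s axis i 1" for i
      by (cases "i = k") (auto simp: X_def vector_sneg_minus1 vector_smult_assoc)
    moreover have "M *v axis k 1 = (\<Sum>i\<in>UNIV. M $ i $ k *s axis i 1)"
      by (simp add: vec_eq_iff matrix_vector_mult_def axis_def if_distrib sum.delta cong: if_cong)
    ultimately show ?thesis
      by (simp add: sum_subtractf sum.delta)
  qed
  have "poly_act M (det X) (axis j 1) = 0" for j
  proof -
    have "poly_act M (det X) (axis j 1)
        = (\<Sum>i\<in>UNIV. poly_act M (if i = j then det X else 0) (axis i 1))"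
      by (subst sum.cong[OF refl, of _ _ "\<lambda>i. if i = j then poly_act M (det X) (axis j 1) else 0"]) auto
    \<comment> \<open>The Kronecker delta is rewritten as row i of \<open>X\<close> against the
      cofactors of row j; exchanging the sums exposes the vanishing sums of
      \<open>col\<close>.\<close>
    also have "\<dots> = (\<Sum>i\<in>UNIV. poly_act M (\<Sum>k\<in>UNIV. C j k * X $ i $ k) (axis i 1))"
      unfolding C_def by (simp only: cofactor_expansion[of X, symmetric] mult.commute)
    also have "\<dots> = (\<Sum>k\<in>UNIV. poly_act M (C j k) (\<Sum>i\<in>UNIV. poly_act M (X $ i $ k) (axis i 1)))"
      by (simp add: poly_act_sum_left poly_act_mult poly_act_sum, subst sum.swap) simp
    finally show ?thesis by (simp add: col)
  qed
  moreover have "x = (\<Sum>j\<in>UNIV. x $ j *s axis j 1)"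
    by (simp add: vec_eq_iff axis_def if_distrib sum.delta cong: if_cong)
  ultimately have "poly_act M (det X) x = 0"
    by (metis (no_types, lifting) poly_act_sum poly_act_scale vector_smult_rzero sum.neutral)
  then show ?thesis by (simp add: X_def)
qed

lemma poly_act_charpoly: "poly_act (map_matrix complex_of_real M) (charpoly M) x = 0"
  using cayley_hamilton[of "map_matrix complex_of_real M"] by (simp add: charpoly_def)

lemma charpoly_transpose: "charpoly (transpose M) = charpoly M"
proof -
  have "(\<chi> i j. (if i = j then [:0, 1:] else 0) - [:complex_of_real (transpose M $ i $ j):])
      = transpose (\<chi> i j. (if i = j then [:0, 1:] else 0) - [:complex_of_real (M $ i $ j):])"
    by (auto simp: vec_eq_iff transpose_def)
  then show ?thesis by (simp add: charpoly_def)
qed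

lemma eigenvalue_iff_root_charpoly: "a \<in> eigenvalues M \<longleftrightarrow> poly (charpoly M) a = 0"
proof -
  define X where "X = (\<chi> i j. (if i = j then a else 0) - complex_of_real (M $ i $ j))"
  have "poly (charpoly M) a = det X"
    unfolding charpoly_def det_def X_def
    by (auto simp: poly_sum poly_prod sign_def intro!: sum.cong prod.cong
        split: if_splits)
  moreover have "X *v v = a *s v - map_matrix complex_of_real M *v v" for v
    unfolding vec_eq_iff X_def matrix_vector_mult_def vec_lambda_beta left_diff_distrib sum_subtractf
    by (simp add: if_distribR if_distrib[of "\<lambda>z. z * _"] cong: if_cong)
  moreover have "det X \<noteq> 0 \<longleftrightarrow> (\<forall>v. X *v v = 0 \<longrightarrow> v = 0)"
    by (simp add: invertible_left_inverse matrix_left_invertible_ker flip: invertible_det_nz)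
  ultimately show ?thesis
    by (auto simp: eigenvalues_def)
qed

section \<open>Real matrices acting on complex vectors\<close>

definition cmv :: "real^'n^'m \<Rightarrow> complex^'n \<Rightarrow> complex^'m" where
  "cmv M x = map_matrix complex_of_real M *v x"

lemma cmv_nth: "cmv M x $ i = (\<Sum>j\<in>UNIV. complex_of_real (M $ i $ j) * x $ j)"
  by (simp add: cmv_def matrix_vector_mult_def)

text \<open>\<open>norm M\<close> is the Frobenius norm, so Cauchy-Schwarz in each row
  suffices.\<close>

lemma norm_cmv_le: "norm (cmv M x) \<le> norm M * norm x"
proof -
  have "norm (cmv M x $ i) \<le> norm (M $ i) * norm x" for i
  proof -
    have "norm (cmv M x $ i) \<le> (\<Sum>j\<in>UNIV. \<bar>M $ i $ j\<bar> * \<bar>norm (x $ j)\<bar>)"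
      unfolding cmv_nth by (rule order_trans[OF norm_sum]) (simp add: norm_mult)
    also have "\<dots> \<le> L2_set (\<lambda>j. M $ i $ j) UNIV * L2_set (\<lambda>j. norm (x $ j)) UNIV"
      by (rule L2_set_mult_ineq)
    finally show ?thesis by (simp add: norm_vec_def L2_set_def)
  qed
  then have "norm (cmv M x) \<le> L2_set (\<lambda>i. norm (M $ i) * norm x) UNIV"
    unfolding norm_vec_def[of "cmv M x"] by (intro L2_set_mono) auto
  also have "\<dots> = norm M * norm x"
    by (simp add: norm_vec_def[of M] L2_set_left_distrib)
  finally show ?thesis .
qed

lemma bounded_bilinear_cmv: "bounded_bilinear cmv"
proof
  show "\<exists>K. \<forall>a b. norm (cmv a b) \<le> norm a * norm b * K" for b :: "complex^'n"
    by (rule exI[of _ 1]) (simp add: norm_cmv_le)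
qed (simp_all add: vec_eq_iff cmv_nth sum.distrib distrib_left distrib_right scaleR_sum_right
    mult.assoc flip: scaleR_conv_of_real)

interpretation cmv: bounded_bilinear cmv
  by (rule bounded_bilinear_cmv)

lemma cmv_mult: "cmv (A ** B) x = cmv A (cmv B x)"
  unfolding vec_eq_iff cmv_nth matrix_matrix_mult_def vec_lambda_beta of_real_sum of_real_mult
    sum_distrib_left sum_distrib_right
  by (subst sum.swap) (simp add: mult.assoc)

lemma cmv_mat_1 [simp]: "cmv (mat 1) x = x"
  by (simp add: vec_eq_iff cmv_nth mat_def if_distrib if_distribR cong: if_cong)

lemma cmv_smult: "cmv M (c *s x) = c *s cmv M x"
  by (simp add: vec_eq_iff cmv_nth sum_distrib_left mult.left_commute)

text \<open>The inner product here is the real part of the Hermitian one, for which the adjoint of a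
  real matrix is its transpose.\<close>

lemma inner_cmv: "cmv M x \<bullet> y = x \<bullet> cmv (transpose M) y"
  unfolding inner_vec_def cmv_nth inner_sum_left inner_sum_right transpose_def vec_lambda_beta
  by (subst sum.swap) (simp add: inner_complex_def algebra_simps)

text \<open>The imaginary part of c acts as a rotation and drops out; this is why only Re \<lambda>
  enters the Lyapunov estimate.\<close>

lemma inner_smult_self: "x \<bullet> (c *s x) = Re c * (norm x)\<^sup>2" for x :: "complex^'n"
proof -
  have "z \<bullet> (c * z) = Re c * (norm z)\<^sup>2" for z
    by (simp add: inner_complex_def cmod_power2 algebra_simps) (simp add: power2_eq_square)
  then show ?thesis
    by (simp add: inner_vec_def sum_distrib_left flip: power2_norm_eq_inner)
       (simp add: norm_vec_def L2_set_def sum_nonneg sum_distrib_left)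
qed

lemma norm_smult: "norm (c *s x) = cmod c * norm x" for x :: "complex^'n"
  by (simp add: norm_vec_def norm_mult L2_set_right_distrib)

lemma bounded_bilinear_smult: "bounded_bilinear ((*s) :: complex \<Rightarrow> complex^'n \<Rightarrow> complex^'n)"
proof
  show "\<exists>K. \<forall>a (b::complex^'n). norm (a *s b) \<le> norm a * norm b * K"
    by (rule exI[of _ 1]) (simp add: norm_smult)
qed (simp_all add: vec_eq_iff algebra_simps)

lemma has_vector_derivative_vecI:
  assumes "\<And>i. ((\<lambda>t. f t $ i) has_vector_derivative f' $ i) (at x within S)"
  shows "(f has_vector_derivative f') (at x within S)"
  unfolding has_vector_derivative_def has_derivative_within
proof (intro conjI bounded_linear_scaleR_left vec_tendstoI)
  fix i
  show "((\<lambda>y. ((1 / norm (y - x)) *\<^sub>R (f y - (f x + (y - x) *\<^sub>R f'))) $ i) \<longlongrightarrow> 0 $ i) (at x within S)"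
    using assms[of i] by (simp add: has_vector_derivative_def has_derivative_within)
qed

section \<open>The matrix exponential\<close>

lemma matrix_power_scaleR: "matrix_power (t *\<^sub>R M) k = t ^ k *\<^sub>R matrix_power M k"
proof (induction k)
  case (Suc k)
  then show ?case
    by (simp add: vec_eq_iff matrix_matrix_mult_def sum_distrib_left mult_ac)
qed simp

lemma norm_cmv_matrix_power_le: "norm (cmv (matrix_power M k) x) \<le> norm M ^ k * norm x"
proof (induction k)
  case (Suc k)
  have "norm (cmv (matrix_power M (Suc k)) x) \<le> norm M * norm (cmv (matrix_power M k) x)"
    by (simp add: cmv_mult norm_cmv_le)
  also have "\<dots> \<le> norm M * (norm M ^ k * norm x)"
    by (intro mult_left_mono Suc) simp
  finally show ?case by (simp add: mult.assoc)
qed simp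

lemma abs_matrix_power_nth_le: "\<bar>matrix_power M k $ i $ j\<bar> \<le> norm M ^ k"
proof -
  have "\<bar>matrix_power M k $ i $ j\<bar> = norm (cmv (matrix_power M k) (axis j 1) $ i)"
    by (simp add: cmv_nth axis_def if_distrib cong: if_cong)
  also have "\<dots> \<le> norm (cmv (matrix_power M k) (axis j 1))"
    by (rule Finite_Cartesian_Product.norm_nth_le)
  also have "\<dots> \<le> norm M ^ k"
    using norm_cmv_matrix_power_le[of M k "axis j 1"] by (simp add: norm_axis_1)
  finally show ?thesis .
qed

lemma summable_matrix_power_series:
  "summable (\<lambda>k. matrix_power M k $ i $ j / fact k * y ^ k)"
proof (rule summable_comparison_test')
  show "summable (\<lambda>k. (norm M * \<bar>y\<bar>) ^ k /\<^sub>R fact k)"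
    by (rule summable_exp_generic)
  show "norm (matrix_power M k $ i $ j / fact k * y ^ k) \<le> (norm M * \<bar>y\<bar>) ^ k /\<^sub>R fact k" for k
    using abs_matrix_power_nth_le[of M k i j]
    by (simp add: abs_mult power_mult_distrib power_abs field_simps mult_left_mono)
qed

text \<open>Each entry is a scalar power series in t, which can be differentiated termwise.\<close>

lemma matrix_exp_nth:
  "matrix_exp (t *\<^sub>R M) $ i $ j = (\<Sum>k. matrix_power M k $ i $ j / fact k * t ^ k)"
proof -
  have "(\<lambda>k. (1 / fact k) *\<^sub>R matrix_power (t *\<^sub>R M) k)
        sums (\<chi> i j. \<Sum>k. matrix_power M k $ i $ j / fact k * t ^ k)"
    unfolding sums_def
  proof (intro vec_tendstoI)
    fix i j
    show "(\<lambda>n. (\<Sum>k<n. (1 / fact k) *\<^sub>R matrix_power (t *\<^sub>R M) k) $ i $ j)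
          \<longlonglongrightarrow> (\<chi> i j. \<Sum>k. matrix_power M k $ i $ j / fact k * t ^ k) $ i $ j"
      using summable_LIMSEQ[OF summable_matrix_power_series[of M i j t]]
      by (simp add: matrix_power_scaleR mult.commute)
  qed
  then show ?thesis
    by (simp add: matrix_exp_def sums_iff)
qed

lemma matrix_power_commute: "matrix_power M k ** M = M ** matrix_power M k"
  by (induction k) (simp_all flip: matrix_mul_assoc)

lemma matrix_exp_nth_has_derivative:
  "((\<lambda>t. matrix_exp (t *\<^sub>R M) $ i $ j) has_field_derivative
    (\<Sum>k. matrix_power M (Suc k) $ i $ j / fact k * t ^ k)) (at t)"
proof -
  have "diffs (\<lambda>k. matrix_power M k $ i $ j / fact k) = (\<lambda>k. matrix_power M (Suc k) $ i $ j / fact k)"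
    by (simp add: diffs_def fun_eq_iff del: matrix_power.simps of_nat_Suc)
  then show ?thesis
    unfolding matrix_exp_nth
    using termdiffs_strong_converges_everywhere[OF summable_matrix_power_series[of M i j], of t]
    by simp
qed

text \<open>M commutes with its powers, so the differentiated series can be read with M on either
  side; uniqueness of derivatives then shows that M commutes with its exponential.\<close>

lemma matrix_exp_has_vector_derivative:
  shows "((\<lambda>t. matrix_exp (t *\<^sub>R M)) has_vector_derivative M ** matrix_exp (t *\<^sub>R M)) (at t within S)"
    and "((\<lambda>t. matrix_exp (t *\<^sub>R M)) has_vector_derivative matrix_exp (t *\<^sub>R M) ** M) (at t within S)"
proof -
  note entry = summable_sums[OF summable_matrix_power_series, of M _ _ t, folded matrix_exp_nth]
  have l: "(\<Sum>k. matrix_power M (Suc k) $ i $ j / fact k * t ^ k) = (M ** matrix_exp (t *\<^sub>R M)) $ i $ j" for i j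
  proof -
    have "(\<lambda>k. \<Sum>l\<in>UNIV. M $ i $ l * (matrix_power M k $ l $ j / fact k * t ^ k))
        sums (\<Sum>l\<in>UNIV. M $ i $ l * matrix_exp (t *\<^sub>R M) $ l $ j)"
      by (intro sums_sum sums_mult entry)
    then show ?thesis
      by (simp add: matrix_matrix_mult_def sums_iff sum_distrib_left sum_divide_distrib mult_ac)
  qed
  have r: "(\<Sum>k. matrix_power M (Suc k) $ i $ j / fact k * t ^ k) = (matrix_exp (t *\<^sub>R M) ** M) $ i $ j" for i j
  proof -
    have "(\<lambda>k. \<Sum>l\<in>UNIV. (matrix_power M k $ i $ l / fact k * t ^ k) * M $ l $ j)
        sums (\<Sum>l\<in>UNIV. matrix_exp (t *\<^sub>R M) $ i $ l * M $ l $ j)"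
      by (intro sums_sum sums_mult2 entry)
    then show ?thesis
      by (simp add: matrix_power_commute[symmetric])
         (simp add: matrix_matrix_mult_def sums_iff sum_distrib_left sum_divide_distrib mult_ac)
  qed
  show "((\<lambda>t. matrix_exp (t *\<^sub>R M)) has_vector_derivative M ** matrix_exp (t *\<^sub>R M)) (at t within S)"
    using matrix_exp_nth_has_derivative[of M _ _ t, THEN has_field_derivative_at_within]
    unfolding l by (intro has_vector_derivative_vecI) (simp add: has_real_derivative_iff_has_vector_derivative)
  show "((\<lambda>t. matrix_exp (t *\<^sub>R M)) has_vector_derivative matrix_exp (t *\<^sub>R M) ** M) (at t within S)"
    using matrix_exp_nth_has_derivative[of M _ _ t, THEN has_field_derivative_at_within]
    unfolding r by (intro has_vector_derivative_vecI) (simp add: has_real_derivative_iff_has_vector_derivative)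
qed


lemma matrix_exp_0 [simp]: "matrix_exp (0 :: real^'n^'n) = mat 1"
proof -
  have "matrix_exp (0 *\<^sub>R 0 :: real^'n^'n) $ i $ j = mat 1 $ i $ j" for i j :: 'n
    using powser_zero[of "\<lambda>k. matrix_power (0 :: real^'n^'n) k $ i $ j / fact k"]
    unfolding matrix_exp_nth by simp
  then show ?thesis
    by (simp add: vec_eq_iff)
qed

section \<open>The flow of a linear system\<close>

definition flow :: "real^'n^'n \<Rightarrow> real \<Rightarrow> complex^'n \<Rightarrow> complex^'n" where
  "flow M t x = cmv (matrix_exp (t *\<^sub>R M)) x"

lemma flow_0 [simp]: "flow M 0 x = x"
  by (simp add: flow_def)

lemma cmv_flow: "cmv M (flow M t x) = flow M t (cmv M x)"
proof -
  have "M ** matrix_exp (t *\<^sub>R M) = matrix_exp (t *\<^sub>R M) ** M"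
    using matrix_exp_has_vector_derivative[of M t UNIV] by (rule vector_derivative_unique_at)
  then show ?thesis
    by (simp add: flow_def flip: cmv_mult)
qed

lemma bounded_linear_flow: "bounded_linear (flow M t)"
  unfolding flow_def by (rule cmv.bounded_linear_right)

lemmas linear_flow = bounded_linear.linear[OF bounded_linear_flow]

lemma flow_has_vector_derivative:
  assumes "(f has_field_derivative f') (at t within S)"
    and "(x has_vector_derivative x') (at t within S)"
  shows "((\<lambda>t. flow M (f t) (x t)) has_vector_derivative
           flow M (f t) (f' *\<^sub>R cmv M (x t) + x')) (at t within S)"
proof -
  have "((\<lambda>t. matrix_exp (t *\<^sub>R M)) \<circ> f has_vector_derivative
      f' *\<^sub>R (matrix_exp (f t *\<^sub>R M) ** M)) (at t within S)"
    using assms(1) by (intro vector_diff_chain_within matrix_exp_has_vector_derivative)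
      (simp add: has_real_derivative_iff_has_vector_derivative)
  from cmv.has_vector_derivative[OF this assms(2)]
  have "((\<lambda>t. flow M (f t) (x t)) has_vector_derivative
      cmv (matrix_exp (f t *\<^sub>R M)) x' + cmv (f' *\<^sub>R (matrix_exp (f t *\<^sub>R M) ** M)) (x t)) (at t within S)"
    unfolding o_def flow_def .
  moreover have "cmv (matrix_exp (f t *\<^sub>R M)) x' + cmv (f' *\<^sub>R (matrix_exp (f t *\<^sub>R M) ** M)) (x t)
      = flow M (f t) (f' *\<^sub>R cmv M (x t) + x')"
    unfolding flow_def by (simp add: cmv_mult cmv.add_right cmv.scaleR_right cmv.scaleR_left)
  ultimately show ?thesis by simp
qed

text \<open>The derivative in s vanishes because M commutes with its flow, and s = 0 gives the
  constant. Both inverses and the group law follow from this one identity.\<close>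

lemma flow_cancel: "flow M (- s) (flow M (s + t) x) = flow M t x"
proof -
  have 1: "((\<lambda>s. - s) has_field_derivative - 1) (at s)" "((\<lambda>s. s + t) has_field_derivative 1) (at s)" for s :: real
    by (auto intro!: derivative_eq_intros)
  have "((\<lambda>s. flow M (- s) (flow M (s + t) x)) has_vector_derivative
      flow M (- s) (- 1 *\<^sub>R cmv M (flow M (s + t) x) + flow M (s + t) (1 *\<^sub>R cmv M x + 0))) (at s)" for s
    by (intro flow_has_vector_derivative 1 has_vector_derivative_const)
  then have der: "((\<lambda>s. flow M (- s) (flow M (s + t) x)) has_derivative (\<lambda>_. 0)) (at s within UNIV)" for s
    by (simp add: has_vector_derivative_def cmv_flow linear_0[OF linear_flow])
  have "\<exists>c. \<forall>s\<in>UNIV. flow M (- s) (flow M (s + t) x) = c"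
    by (rule has_derivative_zero_constant[OF convex_UNIV der])
  then obtain c where "\<And>s. flow M (- s) (flow M (s + t) x) = c"
    by blast
  from this[of s] this[of 0] show ?thesis by simp
qed

lemma flow_add: "flow M (s + t) x = flow M s (flow M t x)"
  using flow_cancel[of M s t x] flow_cancel[of M "- s" 0 "flow M (s + t) x"] by simp

section \<open>Monotonicity and exponential growth on a half-line\<close>

lemma at_within_atLeast: "a < t \<Longrightarrow> at t within {a..} = at t" for t :: real
  by (rule at_within_interior) simp

lemma halfline_derivative_nonpos_imp_le:
  fixes g :: "real \<Rightarrow> real"
  assumes der: "\<And>t. c \<le> t \<Longrightarrow> (g has_real_derivative g' t) (at t within {c..})"
    and neg: "\<And>t. a \<le> t \<Longrightarrow> t \<le> b \<Longrightarrow> g' t \<le> 0" and ab: "c \<le> a" "a \<le> b"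
  shows "g b \<le> g a"
proof (rule DERIV_nonpos_imp_decreasing_open[OF ab(2)])
  show "\<exists>y. DERIV g t :> y \<and> y \<le> 0" if "a < t" "t < b" for t
    using der[of t] neg[of t] that ab by (auto simp: at_within_atLeast)
  have "continuous_on {c..} g"
    by (rule DERIV_continuous_on[OF der]) auto
  then show "continuous_on {a..b} g"
    by (rule continuous_on_subset) (use ab in auto)
qed

text \<open>Gronwall's argument: \<open>exp (- (2 * m * t)) * (x t \<bullet> x t)\<close> has a
  nonpositive derivative.\<close>

lemma norm_le_exp_growth:
  fixes x x' :: "real \<Rightarrow> 'a::real_inner"
  assumes "\<And>t. 0 \<le> t \<Longrightarrow> (x has_vector_derivative x' t) (at t within {0..})"
    and "\<And>t. 0 \<le> t \<Longrightarrow> norm (x' t) \<le> m * norm (x t)" and "0 \<le> t"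
  shows "norm (x t) \<le> exp (m * t) * norm (x 0)"
proof -
  define g where "g t = exp (- (2 * m * t)) * (x t \<bullet> x t)" for t
  have der: "(g has_real_derivative exp (- (2 * m * s)) * (2 * (x s \<bullet> x' s) - 2 * m * (x s \<bullet> x s))) (at s within {0..})"
    if "0 \<le> s" for s
  proof -
    have "((\<lambda>t. x t \<bullet> x t) has_vector_derivative x s \<bullet> x' s + x' s \<bullet> x s) (at s within {0..})"
      by (rule bounded_bilinear.has_vector_derivative[OF bounded_bilinear_inner]) (use assms(1) that in auto)
    then have 1: "((\<lambda>t. x t \<bullet> x t) has_real_derivative 2 * (x s \<bullet> x' s)) (at s within {0..})"
      by (simp add: has_real_derivative_iff_has_vector_derivative inner_commute)
    show ?thesis
      unfolding g_def by (rule derivative_eq_intros 1 refl)+ (simp add: algebra_simps)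
  qed
  have neg: "exp (- (2 * m * s)) * (2 * (x s \<bullet> x' s) - 2 * m * (x s \<bullet> x s)) \<le> 0" if "0 \<le> s" for s
  proof -
    have "x s \<bullet> x' s \<le> norm (x s) * (m * norm (x s))"
      using Cauchy_Schwarz_ineq2[of "x s" "x' s"] mult_left_mono[OF assms(2)[OF that], of "norm (x s)"] by simp
    then have "x s \<bullet> x' s \<le> m * (x s \<bullet> x s)"
      by (simp add: dot_square_norm power2_eq_square mult_ac)
    then show ?thesis by (simp add: mult_nonneg_nonpos)
  qed
  have "g t \<le> g 0"
    by (rule halfline_derivative_nonpos_imp_le[OF der neg]) (use assms(3) in auto)
  then have "exp (2 * m * t) * (exp (- (2 * m * t)) * (x t \<bullet> x t)) \<le> exp (2 * m * t) * (x 0 \<bullet> x 0)"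
    by (intro mult_left_mono) (simp_all add: g_def)
  then have "x t \<bullet> x t \<le> exp (2 * m * t) * (x 0 \<bullet> x 0)"
    by (simp only: mult.assoc[symmetric] exp_add[symmetric]) simp
  also have "exp (2 * m * t) = (exp (m * t))\<^sup>2"
    by (simp add: mult.assoc exp_double)
  finally have "(norm (x t))\<^sup>2 \<le> (exp (m * t) * norm (x 0))\<^sup>2"
    by (simp only: power_mult_distrib power2_norm_eq_inner)
  then show ?thesis by (rule power2_le_imp_le) simp
qed

text \<open>The bound m is a parameter, rather than \<open>norm M\<close>, so that a single m can
  serve all closed-loop matrices with small gain. Negative times are positive times for - M.\<close>

lemma norm_flow_le:
  fixes M :: "real^'n^'n" and x :: "complex^'n"
  assumes M: "\<And>x. norm (cmv M x) \<le> m * norm x"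
  shows "norm (flow M t x) \<le> exp (m * \<bar>t\<bar>) * norm x"
proof -
  have pos: "norm (flow N t x) \<le> exp (m * t) * norm x"
    if "0 \<le> t" "\<And>x. norm (cmv N x) \<le> m * norm x" for t and N :: "real^'n^'n"
  proof -
    have "norm (flow N t x) \<le> exp (m * t) * norm (flow N 0 x)"
    proof (rule norm_le_exp_growth[OF _ _ that(1)])
      show "((\<lambda>t. flow N t x) has_vector_derivative flow N t (1 *\<^sub>R cmv N x + 0)) (at t within {0..})" for t
        by (intro flow_has_vector_derivative) (auto intro!: derivative_eq_intros)
      show "norm (flow N t (1 *\<^sub>R cmv N x + 0)) \<le> m * norm (flow N t x)" for t
        by (simp add: that(2) flip: cmv_flow)
    qed
    then show ?thesis by simp
  qed
  show ?thesis
  proof (cases "0 \<le> t")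
    case False
    have "flow (- M) (- t) x = flow M t x"
      by (simp add: flow_def)
    with pos[of "- t" "- M"] False show ?thesis by (simp add: M cmv.minus_left)
  qed (use pos M in simp)
qed

section \<open>The Riccati equation for small parameters\<close>

lemma inner_cmv_self_pos:
  assumes "positive_definite P" "x \<noteq> 0"
  shows "0 < cmv P x \<bullet> x"
proof -
  define u v where "u = (\<chi> i. Re (x $ i))" and "v = (\<chi> i. Im (x $ i))"
  have "cmv P x \<bullet> x = u \<bullet> (P *v u) + v \<bullet> (P *v v)"
    unfolding inner_vec_def cmv_nth matrix_vector_mult_def
    by (simp add: inner_complex_def u_def v_def sum.distrib mult.commute)
  moreover have "u \<noteq> 0 \<or> v \<noteq> 0"
    using assms(2) by (auto simp: u_def v_def vec_eq_iff complex_eq_iff)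
  moreover have "0 \<le> y \<bullet> (P *v y)" for y
    using assms(1) by (cases "y = 0") (auto simp: positive_definite_def intro: less_imp_le)
  ultimately show ?thesis
    using assms(1) by (metis positive_definite_def add_pos_nonneg add_nonneg_pos)
qed

lemma cmv_eq_iff: "M = N \<longleftrightarrow> (\<forall>x. cmv M x = cmv N x)"
proof
  assume *: "\<forall>x. cmv M x = cmv N x"
  have "M $ i $ j = N $ i $ j" for i j
    using arg_cong[OF spec[OF *, of "axis j 1"], of "\<lambda>y. y $ i"]
    by (simp add: cmv_nth axis_def if_distrib cong: if_cong)
  then show "M = N" by (simp add: vec_eq_iff)
qed simp

text \<open>The Riccati equation as an identity of bilinear forms. The polarised version is what
  Cauchy-Schwarz requires off the diagonal.\<close>

lemma riccati_inner:
  assumes "riccati_solution A B \<gamma> P" "transpose P = P"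
  shows "cmv P x \<bullet> cmv A y + cmv A x \<bullet> cmv P y
       - cmv (transpose B) (cmv P x) \<bullet> cmv (transpose B) (cmv P y) = - \<gamma> * (cmv P x \<bullet> y)"
proof -
  have "cmv (transpose A ** P + P ** A - P ** B ** transpose B ** P) x \<bullet> y = cmv (- (\<gamma> *\<^sub>R P)) x \<bullet> y"
    using assms(1) by (simp add: riccati_solution_def)
  then show ?thesis
    by (simp add: cmv.add_left cmv.diff_left cmv.minus_left cmv.scaleR_left cmv_mult inner_add_left
        inner_diff_left inner_cmv assms(2))
qed

text \<open>Hautus test. With the bilinear pairing l of w, the quantity exp(a t) l(x(t)) is constant
  along every controlled trajectory, whatever the input; steering an arbitrary state to 0 forces l
  to vanish there.\<close>

lemma controllable_imp_hautus:
  fixes A :: "real^'n^'n" and w :: "complex^'n"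
  assumes "controllable A B" and A: "cmv (transpose A) w = - a *s w" and B: "cmv (transpose B) w = 0"
  shows "w = 0"
proof -
  define l :: "real^'n \<Rightarrow> complex" where "l v = (\<Sum>i\<in>UNIV. w $ i * complex_of_real (v $ i))" for v
  have lin: "bounded_linear l"
    unfolding l_def by (intro linear_conv_bounded_linear[THEN iffD1] linearI)
      (simp_all add: distrib_left sum.distrib scaleR_sum_right flip: scaleR_conv_of_real)
  have l_mult: "l (M *v v) = (\<Sum>j\<in>UNIV. cmv (transpose M) w $ j * complex_of_real (v $ j))" for M :: "real^'k^'n" and v
    unfolding l_def cmv_nth matrix_vector_mult_def transpose_def vec_lambda_beta of_real_sum of_real_mult
      sum_distrib_left sum_distrib_right
    by (subst sum.swap) (simp add: mult_ac)
  have lA: "l (A *v v) = - a * l v" for v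
    by (simp add: l_mult A) (simp add: l_def sum_distrib_left mult.assoc sum_negf)
  have lB: "l (B *v v) = 0" for v
    by (simp add: l_mult B)
  have "l x0 = 0" for x0
  proof -
    obtain T u x where T: "T > 0" and x: "x 0 = x0" "x T = 0"
      and der: "\<And>t. t \<in> {0..T} \<Longrightarrow> (x has_vector_derivative (A *v x t + B *v u t)) (at t within {0..T})"
      using assms(1) unfolding controllable_def by metis
    have "((\<lambda>t. exp (a * of_real t) * l (x t)) has_vector_derivative 0) (at t within {0..T})" if "t \<in> {0..T}" for t
    proof -
      have 1: "((\<lambda>t. l (x t)) has_vector_derivative - a * l (x t)) (at t within {0..T})"
        using bounded_linear.has_vector_derivative[OF lin der[OF that]]
        by (simp add: linear_add[OF bounded_linear.linear[OF lin]] lA lB)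
      have 2: "((\<lambda>t. exp (a * of_real t)) has_vector_derivative a * exp (a * of_real t)) (at t within {0..T})"
        by (rule has_vector_derivative_real_field) (auto intro!: derivative_eq_intros)
      show ?thesis
        using has_vector_derivative_mult[OF 2 1] by (simp add: algebra_simps)
    qed
    then have der0: "((\<lambda>t. exp (a * of_real t) * l (x t)) has_derivative (\<lambda>_. 0)) (at t within {0..T})"
      if "t \<in> {0..T}" for t
      using that by (simp add: has_vector_derivative_def)
    have "\<exists>c. \<forall>t\<in>{0..T}. exp (a * of_real t) * l (x t) = c"
      by (rule has_derivative_zero_constant[OF convex_real_interval(5) der0])
    then obtain c where c: "\<And>t. t \<in> {0..T} \<Longrightarrow> exp (a * of_real t) * l (x t) = c"
      by blast
    from c[of 0] c[of T] T x show ?thesis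
      by (simp add: linear_0[OF bounded_linear.linear[OF lin]])
  qed
  then have "l (axis i 1) = 0" for i
    by blast
  then show ?thesis
    by (simp add: l_def vec_eq_iff axis_def if_distrib cong: if_cong)
qed

text \<open>Induction along generalised eigenvectors: if p has the root a, then (M - a) x is
  annihilated by p divided by X - a.\<close>

lemma poly_act_eq_0_induct:
  fixes M :: "complex^'n^'n"
  assumes "poly_act M p x = 0" "p \<noteq> 0" "\<And>a. poly p a = 0 \<Longrightarrow> Q a"
    and Z: "Z 0" and step: "\<And>a x. Q a \<Longrightarrow> Z (M *v x - a *s x) \<Longrightarrow> Z x"
  shows "Z x"
  using assms(1-3)
proof (induction "degree p" arbitrary: p x)
  case 0
  then obtain c where "p = [:c:]" "c \<noteq> 0"
    by (metis degree_eq_zeroE pCons_eq_0_iff)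
  with 0 show ?case using Z by simp
next
  case (Suc d)
  then obtain a where a: "poly p a = 0"
    by (metis fundamental_theorem_of_algebra constant_degree nat.simps(3))
  then obtain q where q: "p = [:- a, 1:] * q"
    by (metis dvdE poly_eq_0_iff_dvd)
  then have "q \<noteq> 0" using Suc.prems by auto
  then have "d = degree q"
    using Suc.hyps(2) by (simp add: q degree_mult_eq del: mult_pCons_left)
  moreover have "poly_act M q (M *v x - a *s x) = 0"
    using Suc.prems(1) by (metis q poly_act_linear_factor poly_act_mult mult.commute)
  ultimately have "Z (M *v x - a *s x)"
    using \<open>q \<noteq> 0\<close> Suc.prems(3) by (intro Suc.hyps(1)) (auto simp: q)
  with Suc.prems(3)[OF a] show ?case by (rule step)
qed

lemma inner_smult_imaginary:
  fixes x y :: "complex^'n"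
  assumes "Re a = 0"
  shows "x \<bullet> (a *s y) = - ((a *s x) \<bullet> y)"
  using assms by (simp add: inner_vec_def inner_complex_def algebra_simps flip: sum_negf)

text \<open>
  Otherwise normalised solutions \<open>P / norm P\<close> accumulate, as \<open>\<gamma> \<longrightarrow> 0\<close>, at some \<open>S\<close> of norm one.
  The limit \<open>m\<close> of the forms \<open>P B B\<^sup>T P / norm P\<close> is \<open>A\<^sup>T S + S A\<close>; it is positive semidefinite and,
  the eigenvalues of \<open>A\<close> being imaginary, vanishes on the generalised eigenvectors of \<open>A\<close>, which are
  therefore killed by \<open>S\<close>.
\<close>

theorem riccati_solution_small:
  fixes A :: "real^'n^'n"
  assumes con: "controllable A B" and imag: "\<forall>a\<in>eigenvalues A. Re a = 0" and "0 < \<epsilon>"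
  shows "\<exists>\<gamma>0>0. \<forall>\<gamma> P. 0 < \<gamma> \<and> \<gamma> < \<gamma>0 \<and> positive_definite P \<and> riccati_solution A B \<gamma> P \<longrightarrow> norm P < \<epsilon>"
proof (rule ccontr)
  assume contra: "\<not> ?thesis"
  have "\<exists>\<gamma> P. 0 < \<gamma> \<and> \<gamma> < inverse (Suc k) \<and> positive_definite P \<and> riccati_solution A B \<gamma> P \<and> \<epsilon> \<le> norm P" for k
    using contra by (metis inverse_positive_iff_positive not_less of_nat_0_less_iff zero_less_Suc)
  then obtain \<gamma> P where \<gamma>: "\<And>k. 0 < \<gamma> k" "\<And>k. \<gamma> k < inverse (Suc k)" and pd: "\<And>k. positive_definite (P k)"
    and ric: "\<And>k. riccati_solution A B (\<gamma> k) (P k)" and eps: "\<And>k. \<epsilon> \<le> norm (P k)"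
    by metis
  have nP: "0 < norm (P k)" for k
    using eps[of k] \<open>0 < \<epsilon>\<close> by linarith
  have sym: "transpose (P k) = P k" for k
    using pd by (simp add: positive_definite_def)
  have \<gamma>0: "\<gamma> \<longlonglongrightarrow> 0"
    using \<gamma> by (intro tendsto_sandwich[OF _ _ tendsto_const LIMSEQ_inverse_real_of_nat])
      (auto intro!: always_eventually less_imp_le)
  define Sk where "Sk k = P k /\<^sub>R norm (P k)" for k
  have "Sk k \<in> sphere 0 1" for k
    using nP[of k] by (simp add: Sk_def)
  then obtain S r where S: "S \<in> sphere 0 1" and r: "strict_mono r" and lim: "(Sk \<circ> r) \<longlonglongrightarrow> S"
    using compact_sphere[of "0::real^'n^'n" 1] unfolding compact_def by metis
  have limS: "(\<lambda>k. cmv (Sk (r k)) x) \<longlonglongrightarrow> cmv S x" for x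
    using bounded_linear.tendsto[OF cmv.bounded_linear_left lim] by (simp add: o_def)
  have symS: "cmv S x \<bullet> y = x \<bullet> cmv S y" for x y
  proof -
    have "cmv (Sk k) x \<bullet> y = x \<bullet> cmv (Sk k) y" for k
      by (simp add: Sk_def cmv.scaleR_left inner_cmv sym)
    then have "(\<lambda>k. cmv (Sk (r k)) x \<bullet> y) \<longlonglongrightarrow> x \<bullet> cmv S y"
      using tendsto_inner[OF tendsto_const limS] by simp
    with tendsto_inner[OF limS tendsto_const] show ?thesis
      by (rule LIMSEQ_unique)
  qed
  define mk where "mk k x y = (cmv (transpose B) (cmv (P k) x) \<bullet> cmv (transpose B) (cmv (P k) y)) / norm (P k)" for k x y
  define m where "m x y = cmv S x \<bullet> cmv A y + cmv A x \<bullet> cmv S y" for x y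
  \<comment> \<open>The form is quadratic in P and \<open>norm P\<close> has no upper bound, so
    boundedness after dividing by \<open>norm P\<close> is not evident. The Riccati equation
    rewrites it linearly in \<open>Sk\<close>, which converges along r.\<close>
  have mk: "mk k x y = cmv (Sk k) x \<bullet> cmv A y + cmv A x \<bullet> cmv (Sk k) y + \<gamma> k * (cmv (Sk k) x \<bullet> y)" for k x y
    using riccati_inner[OF ric sym, of k x y] nP[of k]
    by (simp add: mk_def Sk_def cmv.scaleR_left field_simps)
  have limm: "(\<lambda>k. mk (r k) x y) \<longlonglongrightarrow> m x y" for x y
  proof -
    have "(\<lambda>k. mk (r k) x y) \<longlonglongrightarrow> cmv S x \<bullet> cmv A y + cmv A x \<bullet> cmv S y + 0 * (cmv S x \<bullet> y)"
      unfolding mk using LIMSEQ_subseq_LIMSEQ[OF \<gamma>0 r]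
      by (intro tendsto_intros limS) (simp add: o_def)
    then show ?thesis by (simp add: m_def)
  qed
  have "(mk k x y)\<^sup>2 \<le> mk k x x * mk k y y" for k x y
    using Cauchy_Schwarz_ineq[of "cmv (transpose B) (cmv (P k) x)" "cmv (transpose B) (cmv (P k) y)"] nP[of k]
    by (simp add: mk_def power_divide divide_right_mono power2_eq_square)
  then have m_cs: "(m x y)\<^sup>2 \<le> m x x * m y y" for x y
    by (intro LIMSEQ_le[OF tendsto_power[OF limm] tendsto_mult[OF limm limm]]) auto
  \<comment> \<open>The square carries \<open>norm P\<close> twice in the denominator and
    \<open>mk\<close> only once; the lower bound \<epsilon> on \<open>norm P\<close> pays for the
    other. Hence B^T S x vanishes wherever \<open>m x x\<close> does.\<close>
  have "(norm (cmv (transpose B) (cmv (Sk k) x)))\<^sup>2 \<le> mk k x x / \<epsilon>" for k x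
  proof -
    have "(norm (cmv (transpose B) (cmv (Sk k) x)))\<^sup>2 = mk k x x / norm (P k)"
    proof -
      have "norm (cmv (transpose B) (cmv (Sk k) x)) = norm (cmv (transpose B) (cmv (P k) x)) / norm (P k)"
        by (simp add: Sk_def cmv.scaleR_left cmv.scaleR_right divide_inverse_commute)
      moreover have "mk k x x = (norm (cmv (transpose B) (cmv (P k) x)))\<^sup>2 / norm (P k)"
        by (simp add: mk_def dot_square_norm)
      ultimately show ?thesis
        by (simp add: power_divide power2_eq_square)
    qed
    also have "\<dots> \<le> mk k x x / \<epsilon>"
      using eps[of k] \<open>0 < \<epsilon>\<close> by (intro divide_left_mono) (auto simp: mk_def intro!: mult_pos_pos nP)
    finally show ?thesis .
  qed
  then have BS: "(norm (cmv (transpose B) (cmv S x)))\<^sup>2 \<le> m x x / \<epsilon>" for x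
    using \<open>0 < \<epsilon>\<close>
    by (intro LIMSEQ_le[OF tendsto_power[OF tendsto_norm[OF cmv.tendsto[OF tendsto_const limS]]]
          tendsto_divide[OF limm tendsto_const]]) auto
  have step: "cmv S x = 0" if a: "Re a = 0" and x: "cmv S (map_matrix complex_of_real A *v x - a *s x) = 0" for a x
  proof -
    have SA: "cmv S (cmv A x) = a *s cmv S x"
      using x by (simp add: cmv.diff_right cmv_smult flip: cmv_def)
    have "m x x = 2 * (x \<bullet> (a *s cmv S x))"
      by (simp add: m_def symS SA inner_commute[of "cmv A x"])
    \<comment> \<open>S is symmetric and multiplication by the imaginary a is skew, so the inner
      product equals its own negative.\<close>
    also have "\<dots> = 0"
    proof -
      have "x \<bullet> (a *s cmv S x) = - (cmv S (a *s x) \<bullet> x)"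
        by (simp add: inner_smult_imaginary[OF a] symS)
      then show ?thesis
        by (simp add: cmv_smult inner_commute)
    qed
    finally have m0: "m x x = 0" .
    have "cmv (transpose B) (cmv S x) = 0"
      using BS[of x] by (simp add: m0)
    \<comment> \<open>A null vector of the semidefinite form m is null against every y, and
      \<open>m x y = 0\<close> for all y says that A^T S x = - a S x. So S x satisfies the premises
      of the Hautus test.\<close>
    moreover have "cmv (transpose A) (cmv S x) = - a *s cmv S x"
    proof -
      have "(cmv (transpose A) (cmv S x) + a *s cmv S x) \<bullet> y = 0" for y
      proof -
        have "m x y = 0" using m_cs[of x y] by (simp add: m0)
        then show ?thesis
          by (simp add: m_def inner_add_left inner_cmv[of "transpose A"] SA flip: symS[of "cmv A x"])
      qed
      then have "cmv (transpose A) (cmv S x) + a *s cmv S x = 0"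
        using inner_eq_zero_iff by blast
      then show ?thesis
        by (simp add: vec_eq_iff eq_neg_iff_add_eq_0)
    qed
    ultimately show ?thesis
      by (intro controllable_imp_hautus[OF con])
  qed
  \<comment> \<open>A point off the imaginary axis witnesses that the characteristic polynomial is
    not zero.\<close>
  have "1 \<notin> eigenvalues A"
    using imag by force
  then have nz: "charpoly A \<noteq> 0"
    by (metis eigenvalue_iff_root_charpoly poly_0)
  have "cmv S x = 0" for x
  proof (rule poly_act_eq_0_induct[OF poly_act_charpoly nz, where Q = "\<lambda>a. Re a = 0"
        and Z = "\<lambda>x. cmv S x = 0"])
    show "Re a = 0" if "poly (charpoly A) a = 0" for a
      using imag that by (simp add: eigenvalue_iff_root_charpoly)
    show "cmv S x = 0" if "Re a = 0" "cmv S (map_matrix complex_of_real A *v x - a *s x) = 0" for a x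
      using that by (rule step)
  qed (rule cmv.zero_right)
  then have "S = 0" by (simp add: cmv_eq_iff cmv.zero_left)
  with S show False by simp
qed

section \<open>Polynomial growth\<close>

lemma norm_diff_le_integral:
  fixes f :: "real \<Rightarrow> 'a::banach"
  assumes "a \<le> b" "\<And>t. t \<in> {a..b} \<Longrightarrow> (f has_vector_derivative f' t) (at t within {a..b})"
    and "\<And>t. t \<in> {a..b} \<Longrightarrow> norm (f' t) \<le> \<phi> t" and "\<phi> integrable_on {a..b}"
  shows "norm (f b - f a) \<le> integral {a..b} \<phi>"
proof -
  have "(f' has_integral f b - f a) {a..b}"
    using assms(1,2) by (rule fundamental_theorem_of_calculus)
  then show ?thesis
    using integral_norm_bound_integral[of f' "{a..b}" \<phi>] assms(3,4)
    by (auto simp: has_integral_iff)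
qed

lemma scaleR_eq_smult: "r *\<^sub>R x = complex_of_real r *s x"
  by (simp add: vec_eq_iff) (simp add: scaleR_conv_of_real)

lemma bounded_linear_poly_act:
  fixes M :: "complex^'n^'n"
  shows "bounded_linear (poly_act M p)"
  by (intro linear_conv_bounded_linear[THEN iffD1] linearI)
     (auto simp: poly_act_add poly_act_scale scaleR_eq_smult)

definition linear_solution :: "real^'n^'n \<Rightarrow> (real \<Rightarrow> complex^'n) \<Rightarrow> bool" where
  "linear_solution A y \<longleftrightarrow> (\<forall>t\<ge>0. (y has_vector_derivative cmv A (y t)) (at t within {0..}))"

lemma linear_solution_poly_act:
  assumes "linear_solution A y"
  shows "linear_solution A (\<lambda>t. poly_act (map_matrix complex_of_real A) p (y t))"
  unfolding linear_solution_def
proof (intro allI impI)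
  fix t :: real assume "0 \<le> t"
  then have "(y has_vector_derivative cmv A (y t)) (at t within {0..})"
    using assms by (simp add: linear_solution_def)
  from bounded_linear.has_vector_derivative[OF bounded_linear_poly_act[of "map_matrix complex_of_real A" p] this]
  show "((\<lambda>t. poly_act (map_matrix complex_of_real A) p (y t)) has_vector_derivative
      cmv A (poly_act (map_matrix complex_of_real A) p (y t))) (at t within {0..})"
    using poly_act_mult_commute[of "map_matrix complex_of_real A" p "[:0, 1:]" "y t"]
    by (simp add: cmv_def)
qed

text \<open>Multiplying y by exp(-a t), of modulus one, leaves the derivative exp(-a t) (A - a) y.
  By induction (A - a) y grows one power slower, and integrating restores the power. C does not
  depend on y.\<close>

lemma poly_growth_one_eigenvalue:
  fixes A :: "real^'n^'n"
  assumes "Re a = 0"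
  shows "\<exists>C. \<forall>y. linear_solution A y \<and> (\<forall>t\<ge>0. poly_act (map_matrix complex_of_real A) ([:- a, 1:] ^ m) (y t) = 0)
           \<longrightarrow> (\<forall>t\<ge>0. norm (y t) \<le> C * (1 + t ^ (m - 1)) * norm (y 0))"
proof (induction m)
  case 0
  show ?case by (intro exI[of _ 0]) auto
next
  case (Suc m)
  let ?A = "map_matrix complex_of_real A"
  from Suc obtain C where C: "\<And>y t. linear_solution A y \<Longrightarrow> (\<And>t. 0 \<le> t \<Longrightarrow> poly_act ?A ([:- a, 1:] ^ m) (y t) = 0)
      \<Longrightarrow> 0 \<le> t \<Longrightarrow> norm (y t) \<le> C * (1 + t ^ (m - 1)) * norm (y 0)"
    by blast
  obtain K where K: "0 < K" "\<And>x. norm (poly_act ?A [:- a, 1:] x) \<le> norm x * K"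
    using bounded_linear.pos_bounded[OF bounded_linear_poly_act] by blast
  \<comment> \<open>At m = 0 the truncated exponent m - 1 is 0 and a positive bound on z would
    integrate to linear growth. But then z vanishes, so D may be 0.\<close>
  define D where "D = (if m = 0 then 0 else \<bar>C\<bar> * K)"
  show ?case
  proof (intro exI allI impI)
    fix y :: "real \<Rightarrow> complex^'n" and t :: real
    assume y: "linear_solution A y \<and> (\<forall>t\<ge>0. poly_act ?A ([:- a, 1:] ^ Suc m) (y t) = 0)" and t: "0 \<le> t"
    define z where "z t = poly_act ?A [:- a, 1:] (y t)" for t
    have z: "linear_solution A z"
      unfolding z_def using y by (intro linear_solution_poly_act) blast
    have z_kill: "poly_act ?A ([:- a, 1:] ^ m) (z t) = 0" if "0 \<le> t" for t
      using y that unfolding z_def by (metis poly_act_mult power_Suc2)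
    have z_le: "norm (z s) \<le> D * (1 + t ^ (m - 1)) * norm (y 0)" if "0 \<le> s" "s \<le> t" for s
    proof (cases "m = 0")
      case True
      then show ?thesis using z_kill[OF that(1)] by (simp add: D_def)
    next
      case False
      have "norm (z s) \<le> C * (1 + s ^ (m - 1)) * norm (z 0)"
        by (rule C[OF z z_kill that(1)])
      also have "\<dots> \<le> \<bar>C\<bar> * (1 + t ^ (m - 1)) * (norm (y 0) * K)"
        using that K by (intro mult_mono) (auto simp: z_def power_mono simp del: poly_act_pCons)
      finally show ?thesis by (simp add: D_def False mult_ac)
    qed
    have "norm (exp (- a * of_real t) *s y t - exp (- a * of_real 0) *s y 0)
        \<le> integral {0..t} (\<lambda>_. D * (1 + t ^ (m - 1)) * norm (y 0))"
    proof (rule norm_diff_le_integral[OF t])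
      fix s assume s: "s \<in> {0..t}"
      have "(y has_vector_derivative cmv A (y s)) (at s within {0..})"
        using y s by (simp add: linear_solution_def)
      then have "(y has_vector_derivative cmv A (y s)) (at s within {0..t})"
        by (rule has_vector_derivative_within_subset) auto
      moreover have "((\<lambda>s. exp (- a * of_real s)) has_vector_derivative - a * exp (- a * of_real s)) (at s within {0..t})"
        by (rule has_vector_derivative_real_field) (auto intro!: derivative_eq_intros)
      ultimately have "((\<lambda>s. exp (- a * of_real s) *s y s) has_vector_derivative
          exp (- a * of_real s) *s cmv A (y s) + (- a * exp (- a * of_real s)) *s y s) (at s within {0..t})"
        by (intro bounded_bilinear.has_vector_derivative[OF bounded_bilinear_smult])
      then show "((\<lambda>s. exp (- a * of_real s) *s y s) has_vector_derivative exp (- a * of_real s) *s z s) (at s within {0..t})"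
        by (rule back_subst[of "\<lambda>v. (_ has_vector_derivative v) _"])
           (simp add: z_def poly_act_linear_factor cmv_def vec_eq_iff algebra_simps del: poly_act_pCons)
      show "norm (exp (- a * of_real s) *s z s) \<le> D * (1 + t ^ (m - 1)) * norm (y 0)"
        using z_le[of s] s assms by (simp add: norm_smult)
    qed (rule integrable_const_ivl)
    then have "norm (exp (- a * of_real t) *s y t - y 0) \<le> t * (D * (1 + t ^ (m - 1)) * norm (y 0))"
      using t by (simp add: mult_ac)
    then have "norm (exp (- a * of_real t) *s y t) \<le> norm (y 0) + t * (D * (1 + t ^ (m - 1)) * norm (y 0))"
      using norm_triangle_sub[of "exp (- a * of_real t) *s y t" "y 0"] by linarith
    then have "norm (y t) \<le> (1 + D * (t * (1 + t ^ (m - 1)))) * norm (y 0)"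
      using assms by (simp add: norm_smult algebra_simps)
    also have "\<dots> \<le> ((1 + 2 * D) * (1 + t ^ m)) * norm (y 0)"
    proof (rule mult_right_mono)
      show "1 + D * (t * (1 + t ^ (m - 1))) \<le> (1 + 2 * D) * (1 + t ^ m)"
      proof (cases "m = 0")
        case False
        then obtain k where k: "m = Suc k" by (cases m) auto
        have "t \<le> 1 + t ^ m"
        proof (cases "t \<le> 1")
          case False
          then have "t ^ 1 \<le> t ^ m" by (intro power_increasing) (auto simp: k)
          then show ?thesis by simp
        qed (use t in \<open>simp add: add_increasing2\<close>)
        moreover have "t * t ^ (m - 1) = t ^ m" by (simp add: k)
        ultimately have "t * (1 + t ^ (m - 1)) \<le> 2 * (1 + t ^ m)"
          using t zero_le_power[OF t, of m] by (simp add: distrib_left)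
        moreover have "0 \<le> D" using K by (simp add: D_def)
        ultimately have "D * (t * (1 + t ^ (m - 1))) \<le> D * (2 * (1 + t ^ m))"
          by (rule mult_left_mono)
        then show ?thesis using zero_le_power[OF t, of m] by (simp add: algebra_simps)
      qed (simp add: D_def)
    qed simp
    finally show "norm (y t) \<le> (1 + 2 * D) * (1 + t ^ (Suc m - 1)) * norm (y 0)" by simp
  qed
qed

lemma coprime_linear_factors:
  fixes a b :: complex
  assumes "a \<noteq> b"
  shows "coprime [:- a, 1:] [:- b, 1:]"
proof (rule coprimeI)
  fix c assume "c dvd [:- a, 1:]" "c dvd [:- b, 1:]"
  then have "c dvd [:- a, 1:] - [:- b, 1:]" by (rule dvd_diff)
  also have "[:- a, 1:] - [:- b, 1:] = [:b - a:]" by simp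
  finally show "c dvd 1"
    using assms by (metis const_poly_dvd_const_poly_iff dvd_trans is_unit_const_poly_iff dvd_field_iff eq_iff_diff_eq_0 one_neq_zero pCons_one)
qed

text \<open>Bezout for the coprime g and h gives y = (u g)(A) y + (v h)(A) y. The first summand is
  annihilated by h and falls under the induction hypothesis, the second by g and falls under the
  case of one eigenvalue.\<close>

lemma poly_growth_factors:
  fixes A :: "real^'n^'n"
  assumes "finite S" "\<And>a. a \<in> S \<Longrightarrow> Re a = 0" "\<And>a. a \<in> S \<Longrightarrow> k a \<le> N"
  shows "\<exists>C. \<forall>y. linear_solution A y \<and> (\<forall>t\<ge>0. poly_act (map_matrix complex_of_real A) (\<Prod>a\<in>S. [:- a, 1:] ^ k a) (y t) = 0)
           \<longrightarrow> (\<forall>t\<ge>0. norm (y t) \<le> C * (1 + t ^ (N - 1)) * norm (y 0))"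
  using assms
proof (induction S)
  case empty
  show ?case by (intro exI[of _ 0]) auto
next
  case (insert a S)
  let ?A = "map_matrix complex_of_real A"
  define g h where "g = [:- a, 1:] ^ k a" and "h = (\<Prod>b\<in>S. [:- b, 1:] ^ k b)"
  have "coprime g h"
    unfolding g_def h_def using insert.hyps(2)
    by (intro prod_coprime_right) (auto intro!: coprime_linear_factors)
  then obtain u v where uv: "u * g + v * h = 1"
    by (metis bezout_coefficients_fst_snd coprime_imp_gcd_eq_1)
  obtain C1 where C1: "\<And>y t. linear_solution A y \<Longrightarrow> (\<And>t. 0 \<le> t \<Longrightarrow> poly_act ?A g (y t) = 0)
      \<Longrightarrow> 0 \<le> t \<Longrightarrow> norm (y t) \<le> C1 * (1 + t ^ (k a - 1)) * norm (y 0)"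
    using poly_growth_one_eigenvalue[of a A "k a"] insert.prems(1) unfolding g_def by blast
  have "\<exists>C. \<forall>y. linear_solution A y \<and> (\<forall>t\<ge>0. poly_act ?A h (y t) = 0)
           \<longrightarrow> (\<forall>t\<ge>0. norm (y t) \<le> C * (1 + t ^ (N - 1)) * norm (y 0))"
    unfolding h_def using insert.prems by (intro insert.IH) auto
  then obtain C2 where C2: "\<And>y t. linear_solution A y \<Longrightarrow> (\<And>t. 0 \<le> t \<Longrightarrow> poly_act ?A h (y t) = 0)
      \<Longrightarrow> 0 \<le> t \<Longrightarrow> norm (y t) \<le> C2 * (1 + t ^ (N - 1)) * norm (y 0)"
    by blast
  obtain K1 where K1: "0 < K1" "\<And>x. norm (poly_act ?A (v * h) x) \<le> norm x * K1"
    using bounded_linear.pos_bounded[OF bounded_linear_poly_act] by blast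
  obtain K2 where K2: "0 < K2" "\<And>x. norm (poly_act ?A (u * g) x) \<le> norm x * K2"
    using bounded_linear.pos_bounded[OF bounded_linear_poly_act] by blast
  show ?case
  proof (intro exI allI impI)
    fix y :: "real \<Rightarrow> complex^'n" and t :: real
    assume y: "linear_solution A y \<and> (\<forall>t\<ge>0. poly_act ?A (\<Prod>a\<in>insert a S. [:- a, 1:] ^ k a) (y t) = 0)"
      and t: "0 \<le> t"
    have kill: "poly_act ?A (g * h) (y t) = 0" if "0 \<le> t" for t
      using y that insert.hyps by (simp add: g_def h_def)
    have "poly_act ?A g (poly_act ?A (v * h) (y t)) = 0" if "0 \<le> t" for t
    proof -
      have "poly_act ?A g (poly_act ?A (v * h) (y t)) = poly_act ?A v (poly_act ?A (g * h) (y t))"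
        by (simp add: mult.left_commute flip: poly_act_mult)
      then show ?thesis by (simp add: kill[OF that])
    qed
    then have "norm (poly_act ?A (v * h) (y t)) \<le> C1 * (1 + t ^ (k a - 1)) * norm (poly_act ?A (v * h) (y 0))"
      using y by (intro C1 linear_solution_poly_act t) auto
    also have "\<dots> \<le> \<bar>C1\<bar> * (2 * (1 + t ^ (N - 1))) * (norm (y 0) * K1)"
    proof (intro mult_mono)
      have "t ^ (k a - 1) \<le> 1 + t ^ (N - 1)"
      proof (cases "t \<le> 1")
        case True
        then show ?thesis using t by (intro add_increasing2) (auto intro: power_le_one)
      next
        case False
        then have "t ^ (k a - 1) \<le> t ^ (N - 1)"
          using insert.prems(2)[of a] by (intro power_increasing) auto
        then show ?thesis by simp
      qed
      then show "1 + t ^ (k a - 1) \<le> 2 * (1 + t ^ (N - 1))"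
        using zero_le_power[OF t, of "N - 1"] by simp
    qed (use t K1 in auto)
    finally have 1: "norm (poly_act ?A (v * h) (y t)) \<le> \<bar>C1\<bar> * (2 * (1 + t ^ (N - 1))) * (norm (y 0) * K1)" .
    have "poly_act ?A h (poly_act ?A (u * g) (y t)) = 0" if "0 \<le> t" for t
    proof -
      have "poly_act ?A h (poly_act ?A (u * g) (y t)) = poly_act ?A u (poly_act ?A (g * h) (y t))"
        by (simp add: mult_ac flip: poly_act_mult)
      then show ?thesis by (simp add: kill[OF that])
    qed
    then have "norm (poly_act ?A (u * g) (y t)) \<le> C2 * (1 + t ^ (N - 1)) * norm (poly_act ?A (u * g) (y 0))"
      using y by (intro C2 linear_solution_poly_act t) auto
    also have "\<dots> \<le> \<bar>C2\<bar> * (1 + t ^ (N - 1)) * (norm (y 0) * K2)"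
      using t K2 by (intro mult_mono) auto
    finally have 2: "norm (poly_act ?A (u * g) (y t)) \<le> \<bar>C2\<bar> * (1 + t ^ (N - 1)) * (norm (y 0) * K2)" .
    have "y t = poly_act ?A (u * g) (y t) + poly_act ?A (v * h) (y t)"
      by (simp add: uv flip: poly_act_add_left)
    then have "norm (y t) \<le> norm (poly_act ?A (u * g) (y t)) + norm (poly_act ?A (v * h) (y t))"
      by (metis norm_triangle_ineq)
    with 1 2 show "norm (y t) \<le> (2 * \<bar>C1\<bar> * K1 + \<bar>C2\<bar> * K2) * (1 + t ^ (N - 1)) * norm (y 0)"
      by (simp add: algebra_simps)
  qed
qed

definition cvec :: "real^'n \<Rightarrow> complex^'n" where
  "cvec v = (\<chi> i. complex_of_real (v $ i))"

lemma bounded_linear_cvec: "bounded_linear cvec"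
  by (intro linear_conv_bounded_linear[THEN iffD1] linearI)
     (simp_all add: cvec_def vec_eq_iff flip: scaleR_conv_of_real)

lemma norm_cvec [simp]: "norm (cvec v) = norm v"
  by (simp add: norm_vec_def cvec_def)

lemma cmv_cvec: "cmv M (cvec v) = cvec (M *v v)"
  by (simp add: vec_eq_iff cmv_nth cvec_def matrix_vector_mult_def)

text \<open>The factorisation of the characteristic polynomial has algebraic multiplicities as
  exponents. As C is uniform in s, the growth constant of a solution depends on its initial value
  alone.\<close>

theorem imaginary_eigenvalues_growth:
  fixes A :: "real^'n^'n"
  assumes imag: "\<forall>a\<in>eigenvalues A. Re a = 0"
  shows "\<exists>C\<ge>0. \<forall>s. (\<forall>t\<ge>0. (s has_vector_derivative A *v s t) (at t within {0..}))
    \<longrightarrow> (\<forall>t\<ge>0. norm (s t) \<le> C * (1 + t ^ (max_algebraic_multiplicity A - 1)) * norm (s 0))"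
proof -
  define p where "p = charpoly A"
  have "1 \<notin> eigenvalues A"
    using imag by force
  then have nz: "p \<noteq> 0"
    unfolding p_def by (metis eigenvalue_iff_root_charpoly poly_0)
  have ev: "{z. poly p z = 0} = eigenvalues A"
    by (auto simp: p_def eigenvalue_iff_root_charpoly)
  have fin: "finite (eigenvalues A)"
    using poly_roots_finite[OF nz] by (simp add: ev)
  have decomp: "smult (lead_coeff p) (\<Prod>z\<in>eigenvalues A. [:- z, 1:] ^ order z p) = p"
    using complex_poly_decompose[of p] by (simp add: ev)
  have kill: "poly_act (map_matrix complex_of_real A) (\<Prod>z\<in>eigenvalues A. [:- z, 1:] ^ order z p) x = 0" for x
  proof -
    have "lead_coeff p *s poly_act (map_matrix complex_of_real A) (\<Prod>z\<in>eigenvalues A. [:- z, 1:] ^ order z p) x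
        = poly_act (map_matrix complex_of_real A) p x"
      by (subst decomp[symmetric]) (simp add: poly_act_smult_left)
    then show ?thesis using nz by (simp add: p_def poly_act_charpoly)
  qed
  have "order z p \<le> max_algebraic_multiplicity A" if "z \<in> eigenvalues A" for z
    unfolding max_algebraic_multiplicity_def using that fin
    by (intro Max_ge) (auto simp: algebraic_multiplicity_def p_def)
  with imag have "\<exists>C. \<forall>y. linear_solution A y \<and>
      (\<forall>t\<ge>0. poly_act (map_matrix complex_of_real A) (\<Prod>z\<in>eigenvalues A. [:- z, 1:] ^ order z p) (y t) = 0)
      \<longrightarrow> (\<forall>t\<ge>0. norm (y t) \<le> C * (1 + t ^ (max_algebraic_multiplicity A - 1)) * norm (y 0))"
    by (intro poly_growth_factors[OF fin]) auto
  then obtain C where C: "\<And>y t. linear_solution A y \<Longrightarrow> 0 \<le> t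
      \<Longrightarrow> norm (y t) \<le> C * (1 + t ^ (max_algebraic_multiplicity A - 1)) * norm (y 0)"
    using kill by blast
  show ?thesis
  proof (intro exI conjI allI impI)
    fix s :: "real \<Rightarrow> real^'n" and t :: real
    assume s: "\<forall>t\<ge>0. (s has_vector_derivative A *v s t) (at t within {0..})" and t: "0 \<le> t"
    have "linear_solution A (\<lambda>t. cvec (s t))"
      unfolding linear_solution_def cmv_cvec
      using s by (auto intro: bounded_linear.has_vector_derivative[OF bounded_linear_cvec])
    from C[OF this t] have "norm (s t) \<le> C * (1 + t ^ (max_algebraic_multiplicity A - 1)) * norm (s 0)"
      by simp
    also have "\<dots> \<le> \<bar>C\<bar> * (1 + t ^ (max_algebraic_multiplicity A - 1)) * norm (s 0)"
      using t by (intro mult_right_mono) auto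
    finally show "norm (s t) \<le> \<bar>C\<bar> * (1 + t ^ (max_algebraic_multiplicity A - 1)) * norm (s 0)" .
  qed simp
qed

section \<open>A square integrability estimate with delay\<close>

lemma integral_has_vector_derivative_atLeast:
  fixes f :: "real \<Rightarrow> 'a::banach"
  assumes "continuous_on {a..} f" "a \<le> t"
  shows "((\<lambda>t. integral {a..t} f) has_vector_derivative f t) (at t within {a..})"
proof -
  have "((\<lambda>t. integral {a..t} f) has_vector_derivative f t) (at t within {a..t + 1})"
    using assms by (intro integral_has_vector_derivative) (auto intro: continuous_on_subset)
  moreover have "at t within {a..t + 1} = at t within {a..}"
    by (rule at_within_nhd[of t "{..<t + 1}"]) auto
  ultimately show ?thesis by simp
qed

lemma integral_has_real_derivative_atLeast:
  fixes f :: "real \<Rightarrow> real"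
  assumes "continuous_on {a..} f" "a \<le> t"
  shows "((\<lambda>t. integral {a..t} f) has_real_derivative f t) (at t within {a..})"
  using integral_has_vector_derivative_atLeast[OF assms]
  by (simp add: has_real_derivative_iff_has_vector_derivative)

lemma integrable_on_Icc_atLeast:
  fixes f :: "real \<Rightarrow> 'a::banach"
  assumes "continuous_on {c..} f" "c \<le> a"
  shows "f integrable_on {a..b}"
  by (rule integrable_continuous_interval) (rule continuous_on_subset[OF assms(1)], use assms(2) in auto)

lemma integral_diff_atLeast:
  fixes f :: "real \<Rightarrow> 'a::banach"
  assumes "continuous_on {c..} f" "c \<le> a" "a \<le> b"
  shows "integral {c..b} f - integral {c..a} f = integral {a..b} f"
  using Henstock_Kurzweil_Integration.integral_combine[OF assms(2,3) integrable_on_Icc_atLeast[OF assms(1) order_refl]]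
  by (simp add: algebra_simps)

lemma integral_mono_upper:
  fixes f :: "real \<Rightarrow> real"
  assumes "continuous_on {c..} f" "c \<le> a" "a \<le> b" "\<And>t. c \<le> t \<Longrightarrow> 0 \<le> f t"
  shows "integral {c..a} f \<le> integral {c..b} f"
proof -
  have "0 \<le> integral {a..b} f"
    using assms by (intro Henstock_Kurzweil_Integration.integral_nonneg integrable_on_Icc_atLeast[OF assms(1)]) auto
  with integral_diff_atLeast[OF assms(1-3)] show ?thesis by simp
qed

text \<open>In the application f, e and g are the squared norms of F w, of the input error and of
  the forcing. Integrated over time, a window of length \<tau> costs a factor \<tau>, so the
  integral of e is at most \<eta> \<tau> times the integrals of f and e up to constants; \<eta>
  \<tau> \<le> 1/16 lets the dissipation f / 2 win.\<close>

lemma delayed_l2_estimate: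
  fixes f e g V V' :: "real \<Rightarrow> real"
  assumes cont: "continuous_on {0..} f" "continuous_on {0..} e" "continuous_on {0..} g"
    and nonneg: "\<And>t. 0 \<le> t \<Longrightarrow> 0 \<le> f t" "\<And>t. 0 \<le> t \<Longrightarrow> 0 \<le> e t" "\<And>t. 0 \<le> t \<Longrightarrow> 0 \<le> g t"
      "\<And>t. 0 \<le> t \<Longrightarrow> 0 \<le> V t"
    and V: "\<And>t. 0 \<le> t \<Longrightarrow> (V has_real_derivative V' t) (at t within {0..})"
    and V': "\<And>t. 0 \<le> t \<Longrightarrow> V' t \<le> - \<gamma> * V t - f t / 2 + 2 * e t" and "0 < \<gamma>"
    and e: "\<And>t. \<tau> \<le> t \<Longrightarrow> e t \<le> \<eta> * integral {t - \<tau>..t} (\<lambda>s. f s + e s) + c * g t"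
    and const: "0 \<le> \<tau>" "0 \<le> \<eta>" "\<eta> * \<tau> \<le> 1 / 16" "0 \<le> c"
    and g: "\<And>T. 0 \<le> T \<Longrightarrow> integral {0..T} g \<le> Cg"
  shows "\<exists>C. \<forall>T\<ge>0. integral {0..T} f \<le> C \<and> integral {0..T} e \<le> C \<and> integral {0..T} V \<le> C"
    and "(V \<longlongrightarrow> 0) at_top"
proof -
  define G where "G t = integral {0..t} (\<lambda>s. f s + e s)" for t
  have contfe: "continuous_on {0..} (\<lambda>s. f s + e s)"
    by (intro continuous_intros cont)
  have contV: "continuous_on {0..} V"
    by (rule DERIV_continuous_on[OF V]) auto
  have contG: "continuous_on {0..} G"
    unfolding G_def by (rule DERIV_continuous_on[OF integral_has_real_derivative_atLeast[OF contfe]]) auto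
  have G_mono: "G s \<le> G t" if "0 \<le> s" "s \<le> t" for s t
    unfolding G_def using that nonneg(1,2) by (intro integral_mono_upper[OF contfe]) auto
  have G_split: "G t = integral {0..t} f + integral {0..t} e" for t
    unfolding G_def
    by (rule Henstock_Kurzweil_Integration.integral_add) (auto intro!: integrable_on_Icc_atLeast cont)
  have G_nonneg: "0 \<le> G t" if "0 \<le> t" for t
    using G_mono[of 0 t] that by (simp add: G_def)
  define J where "J t = integral {0..t} G" for t
  have J: "(J has_real_derivative G t) (at t within {0..})" if "0 \<le> t" for t
    unfolding J_def by (rule integral_has_real_derivative_atLeast[OF contG that])
  \<comment> \<open>The first term pays for the interval before \<tau>, on which e is not controlled
    by its past.\<close>
  define C1 where "C1 = integral {0..\<tau>} e + c * Cg"
  have "0 \<le> Cg" using g[of 0] by simp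
  have Ie_delay: "integral {0..T} e \<le> C1 + \<eta> * \<tau> * G T" if "\<tau> \<le> T" for T
  proof -
    \<comment> \<open>J(t) - J(t - \<tau>) has the window integral as derivative up to its monotone
      remainder J(\<tau>) - J(0) at the start, so the delay inequality integrates by monotonicity of
      \<psi>, without exchanging a double integral.\<close>
    define \<psi> where "\<psi> t = integral {0..t} e - \<eta> * (J t - J (t - \<tau>)) - c * integral {0..t} g" for t
    have "\<psi> T \<le> \<psi> \<tau>"
    proof (rule halfline_derivative_nonpos_imp_le[OF _ _ order_refl that])
      fix t assume t: "\<tau> \<le> t"
      have sub: "{\<tau>..} \<subseteq> {0..}" using const by auto
      have "(J \<circ> (\<lambda>t. t - \<tau>) has_real_derivative G (t - \<tau>) * 1) (at t within {\<tau>..})"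
        using t const by (intro DERIV_image_chain DERIV_subset[OF J]) (auto intro!: derivative_eq_intros)
      then have Jd: "((\<lambda>t. J (t - \<tau>)) has_real_derivative G (t - \<tau>)) (at t within {\<tau>..})"
        by (simp add: o_def)
      show "(\<psi> has_real_derivative e t - \<eta> * (G t - G (t - \<tau>)) - c * g t) (at t within {\<tau>..})"
        unfolding \<psi>_def using t const
        by (intro DERIV_diff DERIV_cmult Jd DERIV_subset[OF integral_has_real_derivative_atLeast[OF cont(2)] sub]
            DERIV_subset[OF integral_has_real_derivative_atLeast[OF cont(3)] sub] DERIV_subset[OF J sub]) auto
      have "G t - G (t - \<tau>) = integral {t - \<tau>..t} (\<lambda>s. f s + e s)"
        unfolding G_def by (rule integral_diff_atLeast[OF contfe]) (use t const in auto)
      then show "e t - \<eta> * (G t - G (t - \<tau>)) - c * g t \<le> 0"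
        using e[OF t] by simp
    qed
    moreover have "J T - J (T - \<tau>) \<le> \<tau> * G T"
    proof -
      have "J T - J (T - \<tau>) = integral {T - \<tau>..T} G"
        unfolding J_def by (rule integral_diff_atLeast[OF contG]) (use that const in auto)
      also have "\<dots> \<le> integral {T - \<tau>..T} (\<lambda>_. G T)"
        using that const by (intro integral_le integrable_on_Icc_atLeast[OF contG]) (auto intro!: G_mono)
      finally show ?thesis using const by simp
    qed
    moreover have "0 \<le> J \<tau> - J 0"
      unfolding J_def using const integral_mono_upper[OF contG _ _ G_nonneg, of 0 \<tau>] by simp
    moreover have "c * integral {0..T} g \<le> c * Cg"
      using g[of T] that const by (intro mult_left_mono) auto
    moreover have "0 \<le> c * integral {0..\<tau>} g"
      using const nonneg(3)
      by (intro mult_nonneg_nonneg Henstock_Kurzweil_Integration.integral_nonneg integrable_on_Icc_atLeast[OF cont(3)]) auto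
    ultimately show ?thesis
      using const mult_left_mono[of "J T - J (T - \<tau>)" "\<tau> * G T" \<eta>] mult_nonneg_nonneg[of \<eta> "J \<tau> - J 0"]
      by (simp add: \<psi>_def C1_def algebra_simps)
  qed
  have If_nonneg: "0 \<le> integral {0..T} f" for T
    by (intro Henstock_Kurzweil_Integration.integral_nonneg integrable_on_Icc_atLeast[OF cont(1)] nonneg) auto
  have Ie_nonneg: "0 \<le> integral {0..T} e" for T
    by (intro Henstock_Kurzweil_Integration.integral_nonneg integrable_on_Icc_atLeast[OF cont(2)] nonneg) auto
  have IV_nonneg: "0 \<le> integral {0..T} V" for T
    by (intro Henstock_Kurzweil_Integration.integral_nonneg integrable_on_Icc_atLeast[OF contV] nonneg) auto
  have C1: "0 \<le> C1"
    using Ie_nonneg[of \<tau>] \<open>0 \<le> Cg\<close> const(4) by (simp add: C1_def)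
  \<comment> \<open>Solving x \<le> C1 + (y + x) / 16 for x gives 16/15 C1 + y / 15; the first
    coefficient is rounded up to 2.\<close>
  have Ie: "integral {0..T} e \<le> 2 * C1 + integral {0..T} f / 15" if "0 \<le> T" for T
  proof (cases "\<tau> \<le> T")
    case True
    then have "integral {0..T} e \<le> C1 + 1 / 16 * G T"
      using Ie_delay[OF True] mult_right_mono[OF const(3) G_nonneg[OF that]] by linarith
    then show ?thesis
      using C1 If_nonneg[of T] unfolding G_split by (simp add: field_simps)
  next
    case False
    then have "integral {0..T} e \<le> integral {0..\<tau>} e"
      using that by (intro integral_mono_upper[OF cont(2)] nonneg) auto
    then show ?thesis
      using Ie_nonneg[of \<tau>] \<open>0 \<le> Cg\<close> const(4) If_nonneg[of T] by (simp add: C1_def add_increasing2)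
  qed
  have W: "V t + \<gamma> * integral {0..t} V + integral {0..t} f / 2 - 2 * integral {0..t} e
     \<le> V s + \<gamma> * integral {0..s} V + integral {0..s} f / 2 - 2 * integral {0..s} e" if "0 \<le> s" "s \<le> t" for s t
  proof (rule halfline_derivative_nonpos_imp_le[OF _ _ that])
    fix t :: real assume t: "0 \<le> t"
    show "((\<lambda>t. V t + \<gamma> * integral {0..t} V + integral {0..t} f / 2 - 2 * integral {0..t} e)
        has_real_derivative V' t + \<gamma> * V t + f t / 2 - 2 * e t) (at t within {0..})"
      by (intro DERIV_diff DERIV_add DERIV_cmult DERIV_cdivide V[OF t] integral_has_real_derivative_atLeast t cont contV)
  next
    show "V' r + \<gamma> * V r + f r / 2 - 2 * e r \<le> 0" if "s \<le> r" for r
      using V'[of r] that \<open>0 \<le> s\<close> by simp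
  qed
  \<comment> \<open>The integral of f keeps the coefficient 1/2 - 2/15 = 11/30, and 3 exceeds
    30/11.\<close>
  define C where "C = 3 * (V 0 + 4 * C1)"
  have bound: "integral {0..T} f \<le> C \<and> integral {0..T} e \<le> C + 2 * C1 \<and> \<gamma> * integral {0..T} V \<le> C" if "0 \<le> T" for T
  proof -
    have "V T + \<gamma> * integral {0..T} V + integral {0..T} f / 2 - 2 * integral {0..T} e \<le> V 0"
      using W[OF order_refl that] by simp
    moreover have "0 \<le> \<gamma> * integral {0..T} V"
      using \<open>0 < \<gamma>\<close> IV_nonneg by simp
    moreover have "2 * integral {0..T} e \<le> 4 * C1 + 2 * integral {0..T} f / 15"
      using Ie[OF that] by simp
    moreover note nonneg(4)[OF that] nonneg(4)[of 0] If_nonneg[of T] Ie[OF that] C1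
    ultimately show ?thesis
      unfolding C_def by (intro conjI) argo+
  qed
  have C: "0 \<le> C" using C1 nonneg(4)[of 0] by (simp add: C_def)
  have IV: "integral {0..T} V \<le> C / \<gamma>" if "0 \<le> T" for T
    using bound[OF that] \<open>0 < \<gamma>\<close> by (simp add: pos_le_divide_eq mult.commute)
  show "\<exists>C. \<forall>T\<ge>0. integral {0..T} f \<le> C \<and> integral {0..T} e \<le> C \<and> integral {0..T} V \<le> C"
    using bound IV C C1 by (intro exI[of _ "C + 2 * C1 + C / \<gamma>"]) (smt (verit) divide_nonneg_pos \<open>0 < \<gamma>\<close>)
  have V_step: "V t \<le> V s + 2 * (integral {0..t} e - integral {0..s} e)" if "0 \<le> s" "s \<le> t" for s t
  proof -
    have "\<gamma> * integral {0..s} V \<le> \<gamma> * integral {0..t} V"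
      using integral_mono_upper[OF contV that nonneg(4)] \<open>0 < \<gamma>\<close> by simp
    moreover have "integral {0..s} f \<le> integral {0..t} f"
      using integral_mono_upper[OF cont(1) that nonneg(1)] by simp
    moreover note W[OF that]
    ultimately show ?thesis by argo
  qed
  \<comment> \<open>V is integrable, hence small at some late time; after that it can rise only by
    twice the remaining integral of e, which is small as well.\<close>
  show "(V \<longlongrightarrow> 0) at_top"
  proof (rule tendstoI)
    fix \<epsilon> :: real assume "0 < \<epsilon>"
    define S where "S = (SUP t\<in>{0..}. integral {0..t} e)"
    have bdd: "bdd_above ((\<lambda>t. integral {0..t} e) ` {0..})"
      using bound by (intro bdd_aboveI[of _ "C + 2 * C1"]) auto
    have "S - \<epsilon> / 8 < S" using \<open>0 < \<epsilon>\<close> by simp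
    then obtain s0 where s0: "0 \<le> s0" "S - \<epsilon> / 8 < integral {0..s0} e"
      unfolding S_def by (subst (asm) less_cSUP_iff[OF _ bdd]) auto
    obtain s where s: "s0 \<le> s" "V s < \<epsilon> / 2"
    proof (rule ccontr)
      assume "\<not> thesis"
      then have ge: "\<epsilon> / 2 \<le> V s" if "s0 \<le> s" for s
        using that \<open>\<And>s. s0 \<le> s \<Longrightarrow> V s < \<epsilon> / 2 \<Longrightarrow> thesis\<close> by force
      \<comment> \<open>The length is chosen so that V \<ge> \<epsilon> / 2 throughout would give
        the integral C / \<gamma> + 1, above its bound C / \<gamma>.\<close>
      define T where "T = s0 + 2 * (C / \<gamma> + 1) / \<epsilon>"
      have T: "s0 \<le> T" using C \<open>0 < \<gamma>\<close> \<open>0 < \<epsilon>\<close> by (simp add: T_def)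
      have "C / \<gamma> + 1 = integral {s0..T} (\<lambda>_. \<epsilon> / 2)"
        using T \<open>0 < \<epsilon>\<close> by (simp add: T_def)
      also have "\<dots> \<le> integral {s0..T} V"
        using s0 by (intro integral_le integrable_on_Icc_atLeast[OF contV] ge) auto
      also have "\<dots> = integral {0..T} V - integral {0..s0} V"
        by (rule integral_diff_atLeast[OF contV, symmetric]) (use s0 T in auto)
      also have "\<dots> \<le> C / \<gamma>"
        using IV[of T] IV_nonneg[of s0] s0 T by simp
      finally show False by simp
    qed
    have "dist (V t) 0 < \<epsilon>" if "s \<le> t" for t
    proof -
      have "integral {0..t} e \<le> S"
        unfolding S_def using s s0 that by (intro cSUP_upper bdd) auto
      moreover have "integral {0..s0} e \<le> integral {0..s} e"
        using s s0 nonneg(2) by (intro integral_mono_upper[OF cont(2)]) auto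
      moreover have "V t \<le> V s + 2 * (integral {0..t} e - integral {0..s} e)"
        using s s0 that by (intro V_step) auto
      moreover have "0 \<le> V t" using nonneg(4) s s0 that by auto
      ultimately show ?thesis using s s0 \<open>0 < \<epsilon>\<close> by (simp add: dist_real_def)
    qed
    then show "\<forall>\<^sub>F t in at_top. dist (V t) 0 < \<epsilon>"
      by (auto simp: eventually_at_top_linorder)
  qed
qed

section \<open>A single delayed mode\<close>

text \<open>Cauchy-Schwarz, from the nonnegativity of the integral of the squared deviation from the
  mean m.\<close>

lemma integral_squared_le:
  fixes f :: "real \<Rightarrow> real"
  assumes "continuous_on {a..b} f" "a \<le> b"
  shows "(integral {a..b} f)\<^sup>2 \<le> (b - a) * integral {a..b} (\<lambda>t. (f t)\<^sup>2)"
proof (cases "a = b")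
  case False
  define m where "m = integral {a..b} f / (b - a)"
  have int: "f integrable_on {a..b}" "(\<lambda>t. (f t)\<^sup>2) integrable_on {a..b}"
    by (intro integrable_continuous_interval continuous_intros assms)+
  have "0 \<le> integral {a..b} (\<lambda>t. (f t - m)\<^sup>2)"
    by (intro Henstock_Kurzweil_Integration.integral_nonneg integrable_continuous_interval continuous_intros assms) auto
  also have "(\<lambda>t. (f t - m)\<^sup>2) = (\<lambda>t. (f t)\<^sup>2 - 2 * m * f t + m\<^sup>2)"
    by (simp add: power2_diff fun_eq_iff)
  also have "integral {a..b} \<dots> = integral {a..b} (\<lambda>t. (f t)\<^sup>2) - 2 * m * integral {a..b} f + m\<^sup>2 * (b - a)"
    using has_integral_const_real[of "m\<^sup>2" a b] assms(2)
    by (intro integral_unique has_integral_add has_integral_diff has_integral_mult_right integrable_integral int)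
       (simp add: mult.commute)
  finally have "0 \<le> (b - a) * (integral {a..b} (\<lambda>t. (f t)\<^sup>2) - 2 * m * integral {a..b} f + m\<^sup>2 * (b - a))"
    using assms(2) by simp
  also have "\<dots> = (b - a) * integral {a..b} (\<lambda>t. (f t)\<^sup>2) - 2 * (m * (b - a)) * integral {a..b} f + (m * (b - a))\<^sup>2"
    by (simp add: algebra_simps power2_eq_square)
  also have "m * (b - a) = integral {a..b} f"
    using False by (simp add: m_def)
  finally show ?thesis
    by (simp add: power2_eq_square)
qed simp

text \<open>The primitive is nondecreasing and bounded, so its increments over windows of fixed
  length die out.\<close>

lemma window_integral_tendsto_0:
  fixes h :: "real \<Rightarrow> real"
  assumes cont: "continuous_on {0..} h" and nonneg: "\<And>t. 0 \<le> t \<Longrightarrow> 0 \<le> h t"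
    and bound: "\<And>T. 0 \<le> T \<Longrightarrow> integral {0..T} h \<le> C" and "0 \<le> \<tau>"
  shows "((\<lambda>t. integral {t - \<tau>..t} h) \<longlongrightarrow> 0) at_top"
proof (rule tendstoI)
  fix \<epsilon> :: real assume "0 < \<epsilon>"
  define S where "S = (SUP t\<in>{0..}. integral {0..t} h)"
  have bdd: "bdd_above ((\<lambda>t. integral {0..t} h) ` {0..})"
    using bound by (intro bdd_aboveI[of _ C]) auto
  have "S - \<epsilon> < S" using \<open>0 < \<epsilon>\<close> by simp
  then obtain s where s: "0 \<le> s" "S - \<epsilon> < integral {0..s} h"
    unfolding S_def by (subst (asm) less_cSUP_iff[OF _ bdd]) auto
  have "dist (integral {t - \<tau>..t} h) 0 < \<epsilon>" if "s + \<tau> \<le> t" for t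
  proof -
    have "integral {0..t} h \<le> S"
      unfolding S_def using s that \<open>0 \<le> \<tau>\<close> by (intro cSUP_upper bdd) auto
    moreover have "integral {0..s} h \<le> integral {0..t - \<tau>} h"
      using s that nonneg by (intro integral_mono_upper[OF cont]) auto
    moreover have "integral {0..t} h - integral {0..t - \<tau>} h = integral {t - \<tau>..t} h"
      using s that \<open>0 \<le> \<tau>\<close> by (intro integral_diff_atLeast[OF cont]) auto
    moreover have "0 \<le> integral {t - \<tau>..t} h"
      using s that by (intro Henstock_Kurzweil_Integration.integral_nonneg integrable_on_Icc_atLeast[OF cont] nonneg) auto
    ultimately show ?thesis using s by (simp add: dist_real_def)
  qed
  then show "\<forall>\<^sub>F t in at_top. dist (integral {t - \<tau>..t} h) 0 < \<epsilon>"
    by (auto simp: eventually_at_top_linorder)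
qed

text \<open>By compactness of the unit sphere. The constant depends on P and serves only for fixed
  \<gamma>, to pass from the decay of V to that of w.\<close>

lemma positive_definite_coercive:
  fixes P :: "real^'n^'n"
  assumes "positive_definite P"
  shows "\<exists>c>0. \<forall>x. c * (norm x)\<^sup>2 \<le> cmv P x \<bullet> x"
proof -
  have cont: "continuous_on (sphere 0 1) (\<lambda>x. cmv P x \<bullet> x)"
    by (intro continuous_intros cmv.continuous_on)
  have "axis undefined 1 \<in> sphere (0 :: complex^'n) 1"
    by (simp add: norm_axis_1)
  then have "\<exists>x0\<in>sphere 0 1. \<forall>x\<in>sphere 0 1. cmv P x0 \<bullet> x0 \<le> cmv P x \<bullet> x"
    by (intro continuous_attains_inf[OF compact_sphere _ cont]) blast
  then obtain x0 where x0: "x0 \<in> sphere (0 :: complex^'n) 1"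
    and min: "\<And>x. x \<in> sphere 0 1 \<Longrightarrow> cmv P x0 \<bullet> x0 \<le> cmv P x \<bullet> x"
    by blast
  have "cmv P x0 \<bullet> x0 * (norm x)\<^sup>2 \<le> cmv P x \<bullet> x" for x
  proof (cases "x = 0")
    case False
    then have "cmv P x0 \<bullet> x0 \<le> cmv P (x /\<^sub>R norm x) \<bullet> (x /\<^sub>R norm x)"
      by (intro min) simp
    also have "\<dots> = cmv P x \<bullet> x / (norm x)\<^sup>2"
      by (simp add: cmv.scaleR_right divide_inverse power2_eq_square)
    finally show ?thesis
      using False by (simp add: pos_le_divide_eq)
  qed (simp add: cmv.zero_right)
  moreover have "0 < cmv P x0 \<bullet> x0"
    using x0 by (intro inner_cmv_self_pos[OF assms]) auto
  ultimately show ?thesis by blast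
qed

definition protocol_map :: "real^'n^'n \<Rightarrow> real^'m^'n \<Rightarrow> real^'n^'m \<Rightarrow> real \<Rightarrow> complex^'n \<Rightarrow> complex^'m" where
  "protocol_map A B F \<tau> x = cmv F (flow (A + B ** F) \<tau> (flow A (- \<tau>) x))"

lemma bounded_linear_protocol_map: "bounded_linear (protocol_map A B F \<tau>)"
  unfolding protocol_map_def
  by (intro bounded_linear_compose[OF cmv.bounded_linear_right] bounded_linear_compose[OF bounded_linear_flow]
      bounded_linear_flow)

lemma cmv_delayed_input_matrix:
  "cmv (delayed_input_matrix A B d) x = (\<Sum>j=1..3. flow A (- d j) (cmv (B j) x))"
  by (simp add: delayed_input_matrix_def cmv.sum_left cmv_mult flow_def)

text \<open>One link of the cascade: \<open>lam\<close> is an eigenvalue of the Laplacian, and v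
  will be \<open>K\<close> applied to the next mode. The forcing thus enters through the same
  delayed inputs as the feedback.\<close>

locale delayed_mode =
  fixes A :: "real^'n^'n" and B :: "nat \<Rightarrow> real^'m^'n" and d :: "nat \<Rightarrow> real"
    and P :: "real^'n^'n" and \<gamma> \<mu> :: real and lam :: complex
    and y :: "real \<Rightarrow> complex^'n" and v :: "real \<Rightarrow> complex^'m"
  fixes Bd F \<tau> K u
  defines "Bd \<equiv> delayed_input_matrix A B d" and "F \<equiv> feedback_gain A B d P"
    and "\<tau> \<equiv> (\<Sum>j=1..3. d j)"
    and "K \<equiv> protocol_map A Bd F \<tau>"
    and "u \<equiv> \<lambda>t. \<mu> *\<^sub>R (lam *s K (y t) + v t)"
  assumes delays: "0 \<le> d 1" "d 1 \<le> d 2" "d 2 \<le> d 3"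
    and pd: "positive_definite P" and ric: "riccati_solution A Bd \<gamma> P" and \<gamma>: "0 < \<gamma>"
    and \<mu>: "0 < \<mu>" "1 \<le> \<mu> * Re lam"
    and conty: "continuous_on {- d 3..} y" and contv: "continuous_on {- d 3..} v"
    and dyn: "\<And>t. 0 \<le> t \<Longrightarrow> (y has_vector_derivative cmv A (y t) + (\<Sum>j=1..3. cmv (B j) (u (t - d j)))) (at t within {0..})"
    and v_l2: "\<exists>C. \<forall>T\<ge>0. integral {0..T} (\<lambda>t. (norm (v t))\<^sup>2) \<le> C"
begin

lemma sum3: "(\<Sum>j=1..3. f j) = f 1 + f 2 + f (3::nat)" for f :: "nat \<Rightarrow> 'a::comm_monoid_add"
  by (simp add: numeral_3_eq_3 numeral_2_eq_2 add.assoc)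

lemma d_bounds:
  assumes "j \<in> {1..3}"
  shows "0 \<le> d j" "d j \<le> d 3" "d j \<le> \<tau>"
proof -
  have "j = 1 \<or> j = 2 \<or> j = 3" using assms by auto
  then show "0 \<le> d j" "d j \<le> d 3" "d j \<le> \<tau>"
    using delays unfolding \<tau>_def sum3 by auto
qed

lemma \<tau>_nonneg: "0 \<le> \<tau>" and d3_le: "0 \<le> d 3" "d 3 \<le> \<tau>"
  using d_bounds[of 3] by auto

lemma contu: "continuous_on {- d 3..} u"
  unfolding u_def K_def
  by (intro continuous_intros contv bounded_bilinear.continuous_on[OF bounded_bilinear_smult]
      bounded_linear.continuous_on[OF bounded_linear_protocol_map] conty)

lemma contu0: "continuous_on {0..} u"
  by (rule continuous_on_subset[OF contu]) (use d3_le in auto)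

section \<open>Reduction to a system without delay\<close>

definition U :: "nat \<Rightarrow> real \<Rightarrow> complex^'n" where
  "U j t = integral {- d 3..t} (\<lambda>s. flow A (- s) (cmv (B j) (u s)))"

text \<open>Artstein's reduction: this is the integral over s from t - d j to t of e^(A (t - d j -
  s)) B j u(s). Writing it through the primitive \<open>U\<close> reduces the moving limits to the
  chain rule.\<close>

definition D :: "nat \<Rightarrow> real \<Rightarrow> complex^'n" where
  "D j t = flow A (t - d j) (U j t - U j (t - d j))"

text \<open>The predicted state: it obeys the delay-free dynamics \<open>w' = A w + B u\<close>.\<close>

definition w :: "real \<Rightarrow> complex^'n" where
  "w t = y t + (\<Sum>j=1..3. D j t)"

definition e :: "real \<Rightarrow> complex^'m" where
  "e t = u t - (\<mu> * lam) *s cmv F (w t)"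

lemma cont_flow_u: "continuous_on {- d 3..} (\<lambda>s. flow A (- s) (cmv (B j) (u s)))"
proof -
  have "continuous_on UNIV (\<lambda>s. matrix_exp (s *\<^sub>R A))"
    by (rule continuous_on_vector_derivative[OF matrix_exp_has_vector_derivative(1)])
  then have "continuous_on {- d 3..} (\<lambda>s. matrix_exp ((- s) *\<^sub>R A))"
    by (rule continuous_on_compose2) (auto intro!: continuous_intros)
  then show ?thesis
    unfolding flow_def by (intro cmv.continuous_on continuous_intros contu)
qed

lemma U_deriv: "- d 3 \<le> t \<Longrightarrow> (U j has_vector_derivative flow A (- t) (cmv (B j) (u t))) (at t within {- d 3..})"
  unfolding U_def by (rule integral_has_vector_derivative_atLeast[OF cont_flow_u])

text \<open>The last term cancels the delayed input in the equation of y; the middle terms add up to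
  \<open>Bd\<close> applied to u t.\<close>

lemma D_deriv:
  assumes "0 \<le> t" "j \<in> {1..3}"
  shows "(D j has_vector_derivative cmv A (D j t) + flow A (- d j) (cmv (B j) (u t)) - cmv (B j) (u (t - d j)))
           (at t within {0..})"
proof -
  note dj = d_bounds[OF assms(2)]
  have 1: "(U j has_vector_derivative flow A (- t) (cmv (B j) (u t))) (at t within {0..})"
    by (rule has_vector_derivative_within_subset[OF U_deriv]) (use assms d3_le in auto)
  have "(U j \<circ> (\<lambda>t. t - d j) has_vector_derivative
      1 *\<^sub>R flow A (- (t - d j)) (cmv (B j) (u (t - d j)))) (at t within {0..})"
  proof (rule vector_diff_chain_within)
    show "((\<lambda>t. t - d j) has_vector_derivative 1) (at t within {0..})"
      by (auto intro!: derivative_eq_intros)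
    show "(U j has_vector_derivative flow A (- (t - d j)) (cmv (B j) (u (t - d j))))
        (at (t - d j) within (\<lambda>t. t - d j) ` {0..})"
      by (rule has_vector_derivative_within_subset[OF U_deriv]) (use assms dj in auto)
  qed
  then have 2: "((\<lambda>t. U j (t - d j)) has_vector_derivative
      flow A (- (t - d j)) (cmv (B j) (u (t - d j)))) (at t within {0..})"
    by (simp add: o_def)
  have 3: "((\<lambda>t. t - d j) has_field_derivative 1) (at t within {0..})"
    by (auto intro!: derivative_eq_intros)
  have "(D j has_vector_derivative
      flow A (t - d j) (1 *\<^sub>R cmv A (U j t - U j (t - d j)) + (flow A (- t) (cmv (B j) (u t))
        - flow A (- (t - d j)) (cmv (B j) (u (t - d j)))))) (at t within {0..})"
    unfolding D_def by (intro flow_has_vector_derivative 3 has_vector_derivative_diff 1 2)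
  moreover have "flow A (t - d j) (1 *\<^sub>R cmv A X + (flow A (- t) x - flow A (- (t - d j)) z))
      = cmv A (flow A (t - d j) X) + flow A (- d j) x - z" for X x z
    by (simp add: linear_add[OF linear_flow] linear_diff[OF linear_flow] cmv_flow flip: flow_add)
  then have "flow A (t - d j) (1 *\<^sub>R cmv A (U j t - U j (t - d j)) + (flow A (- t) (cmv (B j) (u t))
        - flow A (- (t - d j)) (cmv (B j) (u (t - d j)))))
      = cmv A (D j t) + flow A (- d j) (cmv (B j) (u t)) - cmv (B j) (u (t - d j))"
    unfolding D_def .
  ultimately show ?thesis by simp
qed

lemma w_deriv:
  assumes "0 \<le> t"
  shows "(w has_vector_derivative cmv A (w t) + cmv Bd (u t)) (at t within {0..})"
proof -
  have "(w has_vector_derivative (cmv A (y t) + (\<Sum>j=1..3. cmv (B j) (u (t - d j))))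
     + (\<Sum>j=1..3. cmv A (D j t) + flow A (- d j) (cmv (B j) (u t)) - cmv (B j) (u (t - d j)))) (at t within {0..})"
    unfolding w_def using assms by (intro has_vector_derivative_add dyn has_vector_derivative_sum D_deriv)
  then show ?thesis
    by (simp add: w_def Bd_def cmv_delayed_input_matrix cmv.add_right cmv.sum_right sum.distrib sum_subtractf algebra_simps)
qed

lemma contw: "continuous_on {0..} w"
  by (rule continuous_on_vector_derivative[OF w_deriv]) auto

lemma conte: "continuous_on {0..} e"
  unfolding e_def
  by (intro continuous_intros contu0 bounded_bilinear.continuous_on[OF bounded_bilinear_smult] cmv.continuous_on contw)

text \<open>\<delta> bounds the gain F and is the only one of these constants that depends on P.
  Once \<delta> \<le> 1, \<kappa> bounds the flows of both A and A + Bd F up to time \<tau>,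
  uniformly in P.\<close>

definition \<delta> where "\<delta> = norm (transpose Bd) * norm P"
definition \<beta> where "\<beta> = norm Bd"
definition b where "b = (\<Sum>j=1..3. norm (B j))"
definition \<kappa> where "\<kappa> = exp ((norm A + \<beta>) * \<tau>)"

lemma const_nonneg: "0 \<le> \<delta>" "0 \<le> \<beta>" "0 \<le> b" "1 \<le> \<kappa>"
  by (auto simp: \<delta>_def \<beta>_def b_def \<kappa>_def sum_nonneg \<tau>_nonneg)

lemma F_eq: "cmv F x = - cmv (transpose Bd) (cmv P x)"
  by (simp add: F_def feedback_gain_def Bd_def cmv.minus_left cmv_mult)

lemma norm_F_le: "norm (cmv F x) \<le> \<delta> * norm x"
proof -
  have "norm (cmv F x) \<le> norm (transpose Bd) * norm (cmv P x)"
    by (simp add: F_eq norm_cmv_le)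
  also have "\<dots> \<le> norm (transpose Bd) * (norm P * norm x)"
    by (intro mult_left_mono norm_cmv_le) simp
  finally show ?thesis by (simp add: \<delta>_def mult.assoc)
qed

lemma norm_flow_A:
  assumes "\<bar>s\<bar> \<le> \<tau>"
  shows "norm (flow A s x) \<le> \<kappa> * norm x"
proof -
  have "norm A * \<bar>s\<bar> \<le> (norm A + \<beta>) * \<tau>"
    using assms const_nonneg by (intro mult_mono) auto
  then have "exp (norm A * \<bar>s\<bar>) * norm x \<le> \<kappa> * norm x"
    unfolding \<kappa>_def by (intro mult_right_mono) auto
  with norm_flow_le[OF norm_cmv_le, of A s x] show ?thesis by (rule order_trans)
qed

lemma norm_flow_closed:
  assumes "\<delta> \<le> 1" "\<bar>s\<bar> \<le> \<tau>"
  shows "norm (flow (A + Bd ** F) s x) \<le> \<kappa> * norm x"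
proof -
  have bound: "norm (cmv (A + Bd ** F) x) \<le> (norm A + \<beta>) * norm x" for x
  proof -
    have "norm (cmv F x) \<le> norm x"
      using order_trans[OF norm_F_le mult_right_mono[OF assms(1) norm_ge_zero]] by simp
    then have "norm (cmv Bd (cmv F x)) \<le> \<beta> * norm x"
      unfolding \<beta>_def by (intro order_trans[OF norm_cmv_le mult_left_mono]) auto
    moreover have "norm (cmv (A + Bd ** F) x) \<le> norm (cmv A x) + norm (cmv Bd (cmv F x))"
      by (simp add: cmv.add_left cmv_mult norm_triangle_ineq)
    ultimately show ?thesis
      using norm_cmv_le[of A x] by (simp add: distrib_right)
  qed
  have "(norm A + \<beta>) * \<bar>s\<bar> \<le> (norm A + \<beta>) * \<tau>"
    using assms const_nonneg by (intro mult_left_mono) auto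
  then have "exp ((norm A + \<beta>) * \<bar>s\<bar>) * norm x \<le> \<kappa> * norm x"
    unfolding \<kappa>_def by (intro mult_right_mono) auto
  with norm_flow_le[OF bound, of s x] show ?thesis by (rule order_trans)
qed

definition Iu where "Iu t = integral {t - \<tau>..t} (\<lambda>s. norm (u s))"

lemma integrable_u: "- d 3 \<le> s \<Longrightarrow> (\<lambda>s. norm (u s)) integrable_on {s..t}"
  by (rule integrable_on_Icc_atLeast[OF continuous_on_norm[OF contu]])

lemma Iu_ge:
  assumes "\<tau> \<le> t" "t - \<tau> \<le> s"
  shows "integral {s..t} (\<lambda>s. norm (u s)) \<le> Iu t"
  unfolding Iu_def using assms d3_le
  by (intro integral_subset_le integrable_u) auto

lemma Iu_nonneg: "\<tau> \<le> t \<Longrightarrow> 0 \<le> Iu t"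
  unfolding Iu_def using d3_le by (intro Henstock_Kurzweil_Integration.integral_nonneg integrable_u) auto

lemma norm_D_le:
  assumes "\<tau> \<le> t" "j \<in> {1..3}"
  shows "norm (D j t) \<le> \<kappa> * norm (B j) * Iu t"
proof -
  note dj = d_bounds[OF assms(2)]
  have "norm (flow A (t - d j) (U j t) - flow A (t - d j) (U j (t - d j)))
     \<le> integral {t - d j..t} (\<lambda>s. \<kappa> * norm (B j) * norm (u s))"
  proof (rule norm_diff_le_integral)
    fix s assume s: "s \<in> {t - d j..t}"
    have "(U j has_vector_derivative flow A (- s) (cmv (B j) (u s))) (at s within {t - d j..t})"
      by (rule has_vector_derivative_within_subset[OF U_deriv]) (use s dj assms d3_le in auto)
    from bounded_linear.has_vector_derivative[OF bounded_linear_flow[of A "t - d j"] this]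
    show "((\<lambda>s. flow A (t - d j) (U j s)) has_vector_derivative flow A (t - d j - s) (cmv (B j) (u s))) (at s within {t - d j..t})"
      by (simp flip: flow_add)
    have "norm (flow A (t - d j - s) (cmv (B j) (u s))) \<le> \<kappa> * norm (cmv (B j) (u s))"
      using s dj by (intro norm_flow_A) auto
    also have "\<dots> \<le> \<kappa> * (norm (B j) * norm (u s))"
      using const_nonneg by (intro mult_left_mono norm_cmv_le) auto
    finally show "norm (flow A (t - d j - s) (cmv (B j) (u s))) \<le> \<kappa> * norm (B j) * norm (u s)"
      by (simp add: mult.assoc)
  next
    show "(\<lambda>s. \<kappa> * norm (B j) * norm (u s)) integrable_on {t - d j..t}"
      using dj assms d3_le by (intro integrable_on_mult_right integrable_u) auto
  qed (use dj in auto)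
  also have "\<dots> = \<kappa> * norm (B j) * integral {t - d j..t} (\<lambda>s. norm (u s))"
    by simp
  also have "\<dots> \<le> \<kappa> * norm (B j) * Iu t"
    using assms dj const_nonneg by (intro mult_left_mono Iu_ge) auto
  finally show ?thesis by (simp add: D_def linear_diff[OF linear_flow])
qed

lemma norm_sum_D_le:
  assumes "\<tau> \<le> t"
  shows "norm (\<Sum>j=1..3. D j t) \<le> \<kappa> * b * Iu t"
proof -
  have "norm (\<Sum>j=1..3. D j t) \<le> (\<Sum>j=1..3. \<kappa> * norm (B j) * Iu t)"
    by (rule sum_norm_le) (use assms norm_D_le in auto)
  then show ?thesis by (simp add: b_def sum_distrib_left sum_distrib_right)
qed

text \<open>The input-free backward orbit of w t differs from w r only by the inputs used on [r, t].
  This replaces F along the orbit, which no dissipation controls, by F w at time r.\<close>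

lemma norm_F_flow_back:
  assumes "\<tau> \<le> t" "r \<in> {t - \<tau>..t}"
  shows "norm (cmv F (flow A (r - t) (w t))) \<le> norm (cmv F (w r)) + \<delta> * (\<kappa> * \<beta> * Iu t)"
proof -
  have "norm (flow A (r - t) (w t) - flow A (r - r) (w r)) \<le> integral {r..t} (\<lambda>s. \<kappa> * \<beta> * norm (u s))"
  proof (rule norm_diff_le_integral)
    fix s assume s: "s \<in> {r..t}"
    have "(w has_vector_derivative cmv A (w s) + cmv Bd (u s)) (at s within {r..t})"
      by (rule has_vector_derivative_within_subset[OF w_deriv]) (use s assms \<tau>_nonneg in auto)
    then have "((\<lambda>s. flow A (r - s) (w s)) has_vector_derivative
        flow A (r - s) (- 1 *\<^sub>R cmv A (w s) + (cmv A (w s) + cmv Bd (u s)))) (at s within {r..t})"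
      by (rule flow_has_vector_derivative[rotated]) (auto intro!: derivative_eq_intros)
    then show "((\<lambda>s. flow A (r - s) (w s)) has_vector_derivative flow A (r - s) (cmv Bd (u s))) (at s within {r..t})"
      by simp
    have "norm (flow A (r - s) (cmv Bd (u s))) \<le> \<kappa> * norm (cmv Bd (u s))"
      using s assms by (intro norm_flow_A) auto
    also have "\<dots> \<le> \<kappa> * (\<beta> * norm (u s))"
      unfolding \<beta>_def using const_nonneg by (intro mult_left_mono norm_cmv_le) auto
    finally show "norm (flow A (r - s) (cmv Bd (u s))) \<le> \<kappa> * \<beta> * norm (u s)"
      by (simp add: mult.assoc)
  next
    show "(\<lambda>s. \<kappa> * \<beta> * norm (u s)) integrable_on {r..t}"
      using assms d3_le by (intro integrable_on_mult_right integrable_u) auto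
  qed (use assms in auto)
  also have "\<dots> = \<kappa> * \<beta> * integral {r..t} (\<lambda>s. norm (u s))"
    by simp
  also have "\<dots> \<le> \<kappa> * \<beta> * Iu t"
    using assms const_nonneg by (intro mult_left_mono Iu_ge) auto
  finally have diff: "norm (flow A (r - t) (w t) - w r) \<le> \<kappa> * \<beta> * Iu t"
    by simp
  have "norm (cmv F (flow A (r - t) (w t) - w r)) \<le> \<delta> * (\<kappa> * \<beta> * Iu t)"
    using order_trans[OF norm_F_le mult_left_mono[OF diff const_nonneg(1)]] .
  then show ?thesis
    using norm_triangle_sub[of "cmv F (flow A (r - t) (w t))" "cmv F (w r)"] by (simp add: cmv.diff_right)
qed

lemma cont_norm_Fw: "continuous_on {0..} (\<lambda>t. norm (cmv F (w t)))"
  by (intro continuous_intros cmv.continuous_on contw)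

text \<open>The path r \<mapsto> e^((A+BF)(t-r)) e^(A(r-t)) w(t) joins the two vectors as r runs
  from t - \<tau> to t. In its derivative A cancels and only B F applied to the backward orbit
  remains.\<close>

lemma norm_prediction_error:
  assumes "\<delta> \<le> 1" "\<tau> \<le> t"
  shows "norm (flow (A + Bd ** F) \<tau> (flow A (- \<tau>) (w t)) - w t)
     \<le> \<kappa> * \<beta> * (integral {t - \<tau>..t} (\<lambda>r. norm (cmv F (w r))) + \<tau> * (\<delta> * (\<kappa> * \<beta> * Iu t)))"
proof -
  let ?M = "A + Bd ** F"
  let ?\<phi> = "\<lambda>r. \<kappa> * \<beta> * (norm (cmv F (w r)) + \<delta> * (\<kappa> * \<beta> * Iu t))"
  have int: "(\<lambda>r. norm (cmv F (w r))) integrable_on {t - \<tau>..t}"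
    using assms by (intro integrable_on_Icc_atLeast[OF cont_norm_Fw]) auto
  have "norm (flow ?M (t - t) (flow A (t - t) (w t)) - flow ?M (t - (t - \<tau>)) (flow A (t - \<tau> - t) (w t)))
      \<le> integral {t - \<tau>..t} ?\<phi>"
  proof (rule norm_diff_le_integral)
    fix r assume r: "r \<in> {t - \<tau>..t}"
    have "((\<lambda>r. flow A (r - t) (w t)) has_vector_derivative flow A (r - t) (1 *\<^sub>R cmv A (w t) + 0)) (at r within {t - \<tau>..t})"
      by (intro flow_has_vector_derivative has_vector_derivative_const) (auto intro!: derivative_eq_intros)
    then have "((\<lambda>r. flow ?M (t - r) (flow A (r - t) (w t))) has_vector_derivative
       flow ?M (t - r) (- 1 *\<^sub>R cmv ?M (flow A (r - t) (w t)) + flow A (r - t) (1 *\<^sub>R cmv A (w t) + 0))) (at r within {t - \<tau>..t})"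
      by (rule flow_has_vector_derivative[rotated]) (auto intro!: derivative_eq_intros)
    then show "((\<lambda>r. flow ?M (t - r) (flow A (r - t) (w t))) has_vector_derivative
       - flow ?M (t - r) (cmv Bd (cmv F (flow A (r - t) (w t))))) (at r within {t - \<tau>..t})"
      by (simp add: cmv.add_left cmv_mult linear_neg[OF linear_flow] flip: cmv_flow)
    have "norm (flow ?M (t - r) (cmv Bd (cmv F (flow A (r - t) (w t))))) \<le> \<kappa> * norm (cmv Bd (cmv F (flow A (r - t) (w t))))"
      using r by (intro norm_flow_closed assms) auto
    also have "\<dots> \<le> \<kappa> * (\<beta> * norm (cmv F (flow A (r - t) (w t))))"
      unfolding \<beta>_def using const_nonneg by (intro mult_left_mono norm_cmv_le) auto
    also have "\<dots> \<le> \<kappa> * (\<beta> * (norm (cmv F (w r)) + \<delta> * (\<kappa> * \<beta> * Iu t)))"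
      using const_nonneg r assms by (intro mult_left_mono norm_F_flow_back) auto
    finally show "norm (- flow ?M (t - r) (cmv Bd (cmv F (flow A (r - t) (w t))))) \<le> ?\<phi> r"
      by (simp add: mult.assoc)
  next
    show "?\<phi> integrable_on {t - \<tau>..t}"
      by (intro integrable_on_mult_right integrable_add int integrable_const_ivl)
  qed (use \<tau>_nonneg in auto)
  also have "integral {t - \<tau>..t} ?\<phi> = \<kappa> * \<beta> * (integral {t - \<tau>..t} (\<lambda>r. norm (cmv F (w r))) + \<tau> * (\<delta> * (\<kappa> * \<beta> * Iu t)))"
    using \<tau>_nonneg by (simp add: Henstock_Kurzweil_Integration.integral_add[OF int integrable_const_ivl])
  finally show ?thesis by (simp add: norm_minus_commute)
qed

text \<open>\<kappa> \<beta> and \<tau> \<kappa>\<open>\<^sup>2\<close>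
  \<beta>\<open>\<^sup>2\<close> come from the prediction error, \<kappa>\<open>\<^sup>3\<close> b
  from the delay terms \<open>D\<close> sent through both flows, and 1 + \<mu> |\<open>lam\<close>|
  from expressing u by F w and e. P does not occur.\<close>

definition error_gain where "error_gain = \<mu> * cmod lam * (\<kappa> * \<beta> + \<tau> * \<kappa>\<^sup>2 * \<beta>\<^sup>2 + \<kappa> ^ 3 * b) * (1 + \<mu> * cmod lam)"

lemma norm_u_le: "norm (u t) \<le> \<mu> * cmod lam * norm (cmv F (w t)) + norm (e t)"
proof -
  have "u t = (\<mu> * lam) *s cmv F (w t) + e t" by (simp add: e_def)
  then have "norm (u t) \<le> norm ((\<mu> * lam) *s cmv F (w t)) + norm (e t)" by (metis norm_triangle_ineq)
  then show ?thesis using \<mu> by (simp add: norm_smult norm_mult)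
qed

text \<open>Put y = w - (sum of the \<open>D j\<close>) into the protocol: what differs from F w is
  F of the prediction error minus F of the transported delay terms. Both are bounded through u on
  the window, and \<open>norm_u_le\<close> brings e back on the right.\<close>

lemma norm_e_le:
  assumes \<delta>1: "\<delta> \<le> 1" and t: "\<tau> \<le> t"
  shows "norm (e t) \<le> \<delta> * error_gain * integral {t - \<tau>..t} (\<lambda>s. norm (cmv F (w s)) + norm (e s)) + \<mu> * norm (v t)"
proof -
  let ?M = "A + Bd ** F"
  define G where "G x = flow ?M \<tau> (flow A (- \<tau>) x)" for x
  define Dt where "Dt = (\<Sum>j=1..3. D j t)"
  define IF where "IF = integral {t - \<tau>..t} (\<lambda>r. norm (cmv F (w r)))"
  define Ie where "Ie = integral {t - \<tau>..t} (\<lambda>r. norm (e r))"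
  have K: "K x = cmv F (G x)" for x by (simp add: K_def protocol_map_def G_def)
  have Gdiff: "G (x - y) = G x - G y" for x y by (simp add: G_def linear_diff[OF linear_flow])
  have G_le: "norm (G x) \<le> \<kappa>\<^sup>2 * norm x" for x
  proof -
    have "norm (G x) \<le> \<kappa> * norm (flow A (- \<tau>) x)"
      unfolding G_def using \<tau>_nonneg by (intro norm_flow_closed \<delta>1) auto
    also have "\<dots> \<le> \<kappa> * (\<kappa> * norm x)"
      using const_nonneg \<tau>_nonneg by (intro mult_left_mono norm_flow_A) auto
    finally show ?thesis by (simp add: power2_eq_square mult.assoc)
  qed
  have "y t = w t - Dt" by (simp add: w_def Dt_def)
  then have "K (y t) = cmv F (w t) + (cmv F (G (w t) - w t) - cmv F (G Dt))"
    by (simp add: K Gdiff cmv.diff_right)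
  then have e_eq: "e t = (\<mu> * lam) *s (cmv F (G (w t) - w t) - cmv F (G Dt)) + \<mu> *\<^sub>R v t"
    by (simp add: e_def u_def scaleR_eq_smult vector_add_ldistrib vector_smult_assoc)
  have IF: "0 \<le> IF" unfolding IF_def using t
    by (intro Henstock_Kurzweil_Integration.integral_nonneg integrable_on_Icc_atLeast[OF cont_norm_Fw]) auto
  have Ie: "0 \<le> Ie" unfolding Ie_def using t
    by (intro Henstock_Kurzweil_Integration.integral_nonneg integrable_on_Icc_atLeast[OF continuous_on_norm[OF conte]]) auto
  have Iu_le: "Iu t \<le> \<mu> * cmod lam * IF + Ie"
  proof -
    have "Iu t \<le> integral {t - \<tau>..t} (\<lambda>s. \<mu> * cmod lam * norm (cmv F (w s)) + norm (e s))"
      unfolding Iu_def using t d3_le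
      by (intro integral_le integrable_u norm_u_le integrable_add integrable_on_mult_right
          integrable_on_Icc_atLeast[OF cont_norm_Fw] integrable_on_Icc_atLeast[OF continuous_on_norm[OF conte]]) auto
    also have "\<dots> = \<mu> * cmod lam * IF + Ie"
      unfolding IF_def Ie_def using t
      by (subst Henstock_Kurzweil_Integration.integral_add)
         (auto intro!: integrable_on_mult_right
          integrable_on_Icc_atLeast[OF cont_norm_Fw] integrable_on_Icc_atLeast[OF continuous_on_norm[OF conte]])
    finally show ?thesis .
  qed
  have sum: "integral {t - \<tau>..t} (\<lambda>s. norm (cmv F (w s)) + norm (e s)) = IF + Ie"
    unfolding IF_def Ie_def using t
    by (subst Henstock_Kurzweil_Integration.integral_add)
       (auto intro!: integrable_on_Icc_atLeast[OF cont_norm_Fw] integrable_on_Icc_atLeast[OF continuous_on_norm[OF conte]])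
  have Iu0: "0 \<le> Iu t" using Iu_nonneg[OF t] .
  define q where "q = \<kappa> * \<beta> + \<tau> * \<kappa>\<^sup>2 * \<beta>\<^sup>2 + \<kappa> ^ 3 * b"
  have q: "0 \<le> q" "\<kappa> * \<beta> \<le> q" "\<tau> * \<kappa>\<^sup>2 * \<beta>\<^sup>2 + \<kappa> ^ 3 * b \<le> q"
    using const_nonneg \<tau>_nonneg by (auto simp: q_def)
  have 1: "norm (cmv F (G (w t) - w t)) \<le> \<delta> * (\<kappa> * \<beta> * IF + \<tau> * \<kappa>\<^sup>2 * \<beta>\<^sup>2 * Iu t)"
  proof -
    have "norm (G (w t) - w t) \<le> \<kappa> * \<beta> * (IF + \<tau> * (\<delta> * (\<kappa> * \<beta> * Iu t)))"
      unfolding G_def IF_def by (rule norm_prediction_error[OF \<delta>1 t])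
    also have "\<dots> \<le> \<kappa> * \<beta> * (IF + \<tau> * (1 * (\<kappa> * \<beta> * Iu t)))"
      using const_nonneg \<tau>_nonneg Iu0 \<delta>1
      by (intro mult_left_mono add_left_mono mult_right_mono) auto
    also have "\<dots> = \<kappa> * \<beta> * IF + \<tau> * \<kappa>\<^sup>2 * \<beta>\<^sup>2 * Iu t"
      by (simp add: algebra_simps power2_eq_square)
    finally show ?thesis
      using order_trans[OF norm_F_le mult_left_mono[OF _ const_nonneg(1)]] by blast
  qed
  have 2: "norm (cmv F (G Dt)) \<le> \<delta> * (\<kappa> ^ 3 * b * Iu t)"
  proof -
    have "norm (G Dt) \<le> \<kappa>\<^sup>2 * (\<kappa> * b * Iu t)"
      unfolding Dt_def by (rule order_trans[OF G_le mult_left_mono[OF norm_sum_D_le[OF t]]]) simp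
    also have "\<dots> = \<kappa> ^ 3 * b * Iu t"
      by (simp add: power2_eq_square power3_eq_cube)
    finally show ?thesis
      using order_trans[OF norm_F_le mult_left_mono[OF _ const_nonneg(1)]] by blast
  qed
  have "norm (cmv F (G (w t) - w t) - cmv F (G Dt)) \<le> \<delta> * (\<kappa> * \<beta> * IF + (\<tau> * \<kappa>\<^sup>2 * \<beta>\<^sup>2 + \<kappa> ^ 3 * b) * Iu t)"
    using norm_triangle_ineq4[of "cmv F (G (w t) - w t)" "cmv F (G Dt)"] 1 2 by (simp add: algebra_simps)
  also have "\<dots> \<le> \<delta> * (q * IF + q * Iu t)"
    using q IF Iu0 const_nonneg by (intro mult_left_mono add_mono mult_right_mono) auto
  also have "\<dots> \<le> \<delta> * (q * ((1 + \<mu> * cmod lam) * (IF + Ie)))"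
  proof -
    have "IF + Iu t \<le> (1 + \<mu> * cmod lam) * (IF + Ie)"
    proof -
      have "0 \<le> \<mu> * cmod lam * Ie" using Ie \<mu> by simp
      moreover have "(1 + \<mu> * cmod lam) * (IF + Ie) = IF + Ie + (\<mu> * cmod lam * IF + \<mu> * cmod lam * Ie)"
        by (simp add: algebra_simps)
      ultimately show ?thesis using Iu_le by linarith
    qed
    then show ?thesis
      using q const_nonneg by (auto intro!: mult_left_mono simp flip: distrib_left)
  qed
  finally have "norm (cmv F (G (w t) - w t) - cmv F (G Dt)) \<le> \<delta> * (q * ((1 + \<mu> * cmod lam) * (IF + Ie)))" .
  then have "\<mu> * cmod lam * norm (cmv F (G (w t) - w t) - cmv F (G Dt))
      \<le> \<mu> * cmod lam * (\<delta> * (q * ((1 + \<mu> * cmod lam) * (IF + Ie))))"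
    using \<mu> by (intro mult_left_mono) auto
  moreover have "norm (e t) \<le> \<mu> * cmod lam * norm (cmv F (G (w t) - w t) - cmv F (G Dt)) + \<mu> * norm (v t)"
  proof -
    have "norm (e t) \<le> norm ((\<mu> * lam) *s (cmv F (G (w t) - w t) - cmv F (G Dt))) + norm (\<mu> *\<^sub>R v t)"
      unfolding e_eq by (rule norm_triangle_ineq)
    then show ?thesis
      unfolding norm_smult using \<mu> by (simp add: norm_mult)
  qed
  ultimately show ?thesis
    unfolding sum error_gain_def q_def[symmetric] by (simp add: mult_ac)
qed

lemma error_gain_nonneg: "0 \<le> error_gain"
  unfolding error_gain_def using const_nonneg \<tau>_nonneg \<mu> by (intro mult_nonneg_nonneg add_nonneg_nonneg) auto

section \<open>The Lyapunov function of a mode\<close>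

definition V where "V t = cmv P (w t) \<bullet> w t"

lemma P_sym: "transpose P = P"
  using pd by (simp add: positive_definite_def)

text \<open>An identity for any input: the Riccati equation turns 2 P w \<bullet> A w into |F
  w|\<open>\<^sup>2\<close> - \<gamma> V, and P w \<bullet> Bd u is - F w \<bullet> u.\<close>

lemma V_deriv:
  assumes t: "0 \<le> t"
  shows "(V has_real_derivative - \<gamma> * V t + (norm (cmv F (w t)))\<^sup>2 - 2 * (cmv F (w t) \<bullet> u t)) (at t within {0..})"
proof -
  let ?w' = "cmv A (w t) + cmv Bd (u t)"
  have "((\<lambda>t. cmv P (w t) \<bullet> w t) has_vector_derivative cmv P (w t) \<bullet> ?w' + cmv P ?w' \<bullet> w t) (at t within {0..})"
    by (intro bounded_bilinear.has_vector_derivative[OF bounded_bilinear_inner] w_deriv t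
        bounded_linear.has_vector_derivative[OF cmv.bounded_linear_right])
  moreover have "cmv P (w t) \<bullet> ?w' + cmv P ?w' \<bullet> w t = - \<gamma> * V t + (norm (cmv F (w t)))\<^sup>2 - 2 * (cmv F (w t) \<bullet> u t)"
  proof -
    have "cmv P ?w' \<bullet> w t = cmv P (w t) \<bullet> ?w'"
      by (simp add: inner_cmv[of P] P_sym inner_commute)
    moreover have "cmv P (w t) \<bullet> ?w' = cmv P (w t) \<bullet> cmv A (w t) - cmv F (w t) \<bullet> u t"
      by (simp add: inner_add_right F_eq inner_cmv[of "transpose Bd"])
    moreover have "2 * (cmv P (w t) \<bullet> cmv A (w t)) = (norm (cmv F (w t)))\<^sup>2 - \<gamma> * V t"
      using riccati_inner[OF ric P_sym, of "w t" "w t"]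
      by (simp add: F_eq V_def power2_norm_eq_inner inner_commute)
    ultimately show ?thesis by linarith
  qed
  ultimately show ?thesis
    by (simp only: V_def[abs_def] has_real_derivative_iff_has_vector_derivative)
qed

lemma V_deriv_le:
  "- \<gamma> * V t + (norm (cmv F (w t)))\<^sup>2 - 2 * (cmv F (w t) \<bullet> u t)
     \<le> - \<gamma> * V t - (norm (cmv F (w t)))\<^sup>2 / 2 + 2 * (norm (e t))\<^sup>2"
proof -
  have "u t = (\<mu> * lam) *s cmv F (w t) + e t" by (simp add: e_def)
  then have "cmv F (w t) \<bullet> u t = \<mu> * Re lam * (norm (cmv F (w t)))\<^sup>2 + cmv F (w t) \<bullet> e t"
    by (simp add: inner_add_right inner_smult_self)
  moreover have "1 * (norm (cmv F (w t)))\<^sup>2 \<le> \<mu> * Re lam * (norm (cmv F (w t)))\<^sup>2"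
    by (rule mult_right_mono[OF \<mu>(2)]) simp
  moreover have "- (norm (cmv F (w t)) * norm (e t)) \<le> cmv F (w t) \<bullet> e t"
    using Cauchy_Schwarz_ineq2[of "cmv F (w t)" "e t"] by simp
  \<comment> \<open>Young's inequality with the weight that spends exactly half of the dissipation
    |F w|\<open>\<^sup>2\<close>.\<close>
  moreover have "0 \<le> (norm (cmv F (w t)) - 2 * norm (e t))\<^sup>2"
    by simp
  then have "2 * (norm (cmv F (w t)) * norm (e t)) \<le> (norm (cmv F (w t)))\<^sup>2 / 2 + 2 * (norm (e t))\<^sup>2"
    by (simp add: power2_diff power_mult_distrib)
  ultimately show ?thesis by simp
qed

text \<open>One factor 2 separates the forcing, another separates |F w| from |e| under the integral,
  and \<tau> comes from Cauchy-Schwarz on the window.\<close>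

lemma norm_e_squared_le:
  assumes \<delta>1: "\<delta> \<le> 1" and t: "\<tau> \<le> t"
  shows "(norm (e t))\<^sup>2 \<le> 4 * (\<delta> * error_gain)\<^sup>2 * \<tau> * integral {t - \<tau>..t} (\<lambda>s. (norm (cmv F (w s)))\<^sup>2 + (norm (e s))\<^sup>2)
      + 2 * \<mu>\<^sup>2 * (norm (v t))\<^sup>2"
proof -
  let ?h = "\<lambda>s. norm (cmv F (w s)) + norm (e s)"
  define I where "I = integral {t - \<tau>..t} ?h"
  have conth: "continuous_on {t - \<tau>..t} ?h"
    by (rule continuous_on_subset[of "{0..}"]) (use t in \<open>auto intro!: continuous_intros cont_norm_Fw conte\<close>)
  have cont2: "continuous_on {0..} (\<lambda>s. 2 * ((norm (cmv F (w s)))\<^sup>2 + (norm (e s))\<^sup>2))"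
    by (intro continuous_intros cont_norm_Fw conte)
  have "I\<^sup>2 \<le> \<tau> * integral {t - \<tau>..t} (\<lambda>s. (?h s)\<^sup>2)"
    unfolding I_def using integral_squared_le[OF conth] \<tau>_nonneg by simp
  also have "\<dots> \<le> \<tau> * integral {t - \<tau>..t} (\<lambda>s. 2 * ((norm (cmv F (w s)))\<^sup>2 + (norm (e s))\<^sup>2))"
  proof (intro mult_left_mono integral_le \<tau>_nonneg)
    show "(\<lambda>s. (?h s)\<^sup>2) integrable_on {t - \<tau>..t}"
      by (intro integrable_continuous_interval continuous_intros conth)
    show "(\<lambda>s. 2 * ((norm (cmv F (w s)))\<^sup>2 + (norm (e s))\<^sup>2)) integrable_on {t - \<tau>..t}"
      by (rule integrable_on_Icc_atLeast[OF cont2]) (use t in auto)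
    show "(?h s)\<^sup>2 \<le> 2 * ((norm (cmv F (w s)))\<^sup>2 + (norm (e s))\<^sup>2)" for s
      using sum_squares_bound[of "norm (cmv F (w s))" "norm (e s)"] by (simp add: power2_sum)
  qed
  finally have I2: "I\<^sup>2 \<le> 2 * \<tau> * integral {t - \<tau>..t} (\<lambda>s. (norm (cmv F (w s)))\<^sup>2 + (norm (e s))\<^sup>2)"
    by (simp add: mult_ac del: distrib_left_numeral)
  have "(norm (e t))\<^sup>2 \<le> (\<delta> * error_gain * I + \<mu> * norm (v t))\<^sup>2"
    using norm_e_le[OF assms] by (intro power_mono) (auto simp: I_def)
  also have "\<dots> \<le> 2 * (\<delta> * error_gain * I)\<^sup>2 + 2 * (\<mu> * norm (v t))\<^sup>2"
    using sum_squares_bound[of "\<delta> * error_gain * I" "\<mu> * norm (v t)"] by (simp add: power2_sum)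
  also have "(\<delta> * error_gain * I)\<^sup>2 = (\<delta> * error_gain)\<^sup>2 * I\<^sup>2"
    by (simp add: power_mult_distrib)
  also have "\<dots> \<le> (\<delta> * error_gain)\<^sup>2 * (2 * \<tau> * integral {t - \<tau>..t} (\<lambda>s. (norm (cmv F (w s)))\<^sup>2 + (norm (e s))\<^sup>2))"
    by (intro mult_left_mono I2) simp
  finally show ?thesis
    by (simp add: power_mult_distrib mult_ac)
qed

lemma mode_stable:
  assumes \<delta>1: "\<delta> \<le> 1" and \<delta>2: "8 * (\<delta> * error_gain * \<tau>) \<le> 1"
  shows "(y \<longlongrightarrow> 0) at_top" and "\<exists>C. \<forall>T\<ge>0. integral {0..T} (\<lambda>t. (norm (K (y t)))\<^sup>2) \<le> C"
proof -
  let ?f = "\<lambda>t. (norm (cmv F (w t)))\<^sup>2" and ?e = "\<lambda>t. (norm (e t))\<^sup>2" and ?v = "\<lambda>t. (norm (v t))\<^sup>2"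
  have contv0: "continuous_on {0..} v"
    by (rule continuous_on_subset[OF contv]) (use d3_le in auto)
  have conts: "continuous_on {0..} ?f" "continuous_on {0..} ?e" "continuous_on {0..} ?v"
    by (intro continuous_intros cont_norm_Fw conte contv0)+
  have V_nonneg: "0 \<le> V t" for t
    using inner_cmv_self_pos[OF pd, of "w t"] by (cases "w t = 0") (auto simp: V_def)
  obtain Cv where Cv: "\<And>T. 0 \<le> T \<Longrightarrow> integral {0..T} ?v \<le> Cv"
    using v_l2 by blast
  \<comment> \<open>The assumption is the square root of what the delay estimate asks: 4 /
    8\<open>\<^sup>2\<close> = 1/16.\<close>
  have small: "4 * (\<delta> * error_gain)\<^sup>2 * \<tau> * \<tau> \<le> 1 / 16"
  proof -
    have "(8 * (\<delta> * error_gain * \<tau>))\<^sup>2 \<le> 1\<^sup>2"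
      using \<delta>2 const_nonneg error_gain_nonneg \<tau>_nonneg by (intro power_mono) auto
    then show ?thesis by (simp add: power2_eq_square mult_ac)
  qed
  note est = delayed_l2_estimate[OF conts zero_le_power2 zero_le_power2 zero_le_power2 V_nonneg V_deriv V_deriv_le \<gamma>
      norm_e_squared_le[OF \<delta>1] \<tau>_nonneg _ small _ Cv]
  have pos: "0 \<le> 4 * (\<delta> * error_gain)\<^sup>2 * \<tau>" "0 \<le> 2 * \<mu>\<^sup>2"
    using \<tau>_nonneg by auto
  obtain C where C: "\<And>T. 0 \<le> T \<Longrightarrow> integral {0..T} ?f \<le> C" "\<And>T. 0 \<le> T \<Longrightarrow> integral {0..T} ?e \<le> C"
    using est(1)[OF _ _ pos] by auto
  have V0: "(V \<longlongrightarrow> 0) at_top"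
    using est(2)[OF _ _ pos] by auto
  have int: "?f integrable_on {0..T}" "?e integrable_on {0..T}" "?v integrable_on {0..T}" for T
    by (intro integrable_on_Icc_atLeast[OF conts(1)] integrable_on_Icc_atLeast[OF conts(2)]
        integrable_on_Icc_atLeast[OF conts(3)] order_refl)+
  define p where "p = 2 * (\<mu> * cmod lam)\<^sup>2"
  have p: "0 \<le> p" by (simp add: p_def)
  have u_le: "(norm (u t))\<^sup>2 \<le> p * ?f t + 2 * ?e t" for t
  proof -
    have "(norm (u t))\<^sup>2 \<le> (\<mu> * cmod lam * norm (cmv F (w t)) + norm (e t))\<^sup>2"
      by (intro power_mono norm_u_le) auto
    also have "\<dots> \<le> 2 * (\<mu> * cmod lam * norm (cmv F (w t)))\<^sup>2 + 2 * ?e t"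
      using sum_squares_bound[of "\<mu> * cmod lam * norm (cmv F (w t))" "norm (e t)"] by (simp add: power2_sum)
    finally show ?thesis by (simp add: p_def power_mult_distrib)
  qed
  have contu2: "continuous_on {0..} (\<lambda>t. (norm (u t))\<^sup>2)"
    by (intro continuous_intros contu0)
  have u_l2: "integral {0..T} (\<lambda>t. (norm (u t))\<^sup>2) \<le> p * C + 2 * C" if "0 \<le> T" for T
  proof -
    have "integral {0..T} (\<lambda>t. (norm (u t))\<^sup>2) \<le> integral {0..T} (\<lambda>t. p * ?f t + 2 * ?e t)"
      by (intro integral_le u_le integrable_on_Icc_atLeast[OF contu2] integrable_add integrable_on_mult_right int) auto
    also have "\<dots> = p * integral {0..T} ?f + 2 * integral {0..T} ?e"
      by (subst Henstock_Kurzweil_Integration.integral_add[OF integrable_on_mult_right[OF int(1)] integrable_on_mult_right[OF int(2)]])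
         simp
    also have "\<dots> \<le> p * C + 2 * C"
      using C[OF that] p by (intro add_mono mult_left_mono) auto
    finally show ?thesis .
  qed
  have lam: "0 < cmod lam"
    using \<mu> by auto
  show "\<exists>C. \<forall>T\<ge>0. integral {0..T} (\<lambda>t. (norm (K (y t)))\<^sup>2) \<le> C"
  proof (intro exI allI impI)
    fix T :: real assume T: "0 \<le> T"
    define q1 q2 where "q1 = 2 / (\<mu> * cmod lam)\<^sup>2" and "q2 = 2 / (cmod lam)\<^sup>2"
    \<comment> \<open>K y is recovered from the input by solving u = \<mu> (\<open>lam\<close> K y +
      v), both u and v being square integrable.\<close>
    have le: "(norm (K (y t)))\<^sup>2 \<le> q1 * (norm (u t))\<^sup>2 + q2 * ?v t" for t
    proof -
      have "\<mu> *\<^sub>R (lam *s K (y t)) = u t - \<mu> *\<^sub>R v t"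
        by (simp add: u_def scaleR_add_right)
      then have "\<mu> * cmod lam * norm (K (y t)) = norm (u t - \<mu> *\<^sub>R v t)"
        using \<mu> norm_smult[of lam "K (y t)"] by (metis abs_of_pos mult.assoc norm_scaleR)
      also have "\<dots> \<le> norm (u t) + \<mu> * norm (v t)"
        using norm_triangle_ineq4[of "u t" "\<mu> *\<^sub>R v t"] \<mu> by simp
      finally have "(\<mu> * cmod lam * norm (K (y t)))\<^sup>2 \<le> (norm (u t) + \<mu> * norm (v t))\<^sup>2"
        using \<mu> by (intro power_mono) auto
      also have "\<dots> \<le> 2 * (norm (u t))\<^sup>2 + 2 * (\<mu> * norm (v t))\<^sup>2"
        using sum_squares_bound[of "norm (u t)" "\<mu> * norm (v t)"] by (simp add: power2_sum)
      finally have "(norm (K (y t)))\<^sup>2 * (\<mu> * cmod lam)\<^sup>2 \<le> 2 * (norm (u t))\<^sup>2 + 2 * (\<mu> * norm (v t))\<^sup>2"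
        by (simp add: power_mult_distrib mult_ac)
      then have "(norm (K (y t)))\<^sup>2 \<le> (2 * (norm (u t))\<^sup>2 + 2 * (\<mu> * norm (v t))\<^sup>2) / (\<mu> * cmod lam)\<^sup>2"
        using \<mu> lam by (subst pos_le_divide_eq) auto
      also have "\<dots> = q1 * (norm (u t))\<^sup>2 + q2 * ?v t"
        using \<mu> lam by (simp add: q1_def q2_def add_divide_distrib power_mult_distrib)
      finally show ?thesis .
    qed
    have contK: "continuous_on {0..} (\<lambda>t. (norm (K (y t)))\<^sup>2)"
    proof -
      have "continuous_on {0..} y"
        by (rule continuous_on_subset[OF conty]) (use d3_le in auto)
      then show ?thesis
        unfolding K_def by (intro continuous_intros bounded_linear.continuous_on[OF bounded_linear_protocol_map])
    qed
    have intu: "(\<lambda>t. (norm (u t))\<^sup>2) integrable_on {0..T}"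
      by (intro integrable_on_Icc_atLeast[OF contu2]) auto
    have "integral {0..T} (\<lambda>t. (norm (K (y t)))\<^sup>2) \<le> integral {0..T} (\<lambda>t. q1 * (norm (u t))\<^sup>2 + q2 * ?v t)"
      by (intro integral_le le integrable_on_Icc_atLeast[OF contK] integrable_add integrable_on_mult_right int intu) auto
    also have "\<dots> = q1 * integral {0..T} (\<lambda>t. (norm (u t))\<^sup>2) + q2 * integral {0..T} ?v"
      by (subst Henstock_Kurzweil_Integration.integral_add[OF integrable_on_mult_right[OF intu] integrable_on_mult_right[OF int(3)]])
         simp
    also have "\<dots> \<le> q1 * (p * C + 2 * C) + q2 * Cv"
      using u_l2[OF T] Cv[OF T] by (intro add_mono mult_left_mono) (auto simp: q1_def q2_def)
    finally show "integral {0..T} (\<lambda>t. (norm (K (y t)))\<^sup>2) \<le> 2 / (\<mu> * cmod lam)\<^sup>2 * (p * C + 2 * C) + 2 / (cmod lam)\<^sup>2 * Cv"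
      by (simp add: q1_def q2_def)
  qed
  obtain c where c: "0 < c" "\<And>x. c * (norm x)\<^sup>2 \<le> cmv P x \<bullet> x"
    using positive_definite_coercive[OF pd] by blast
  define win where "win t = integral {t - \<tau>..t} (\<lambda>s. (norm (u s))\<^sup>2)" for t
  have win0: "(win \<longlongrightarrow> 0) at_top"
    unfolding win_def by (rule window_integral_tendsto_0[OF contu2 _ u_l2 \<tau>_nonneg]) auto
  have y_le: "(norm (y t))\<^sup>2 \<le> 2 / c * V t + 2 * (\<kappa> * b)\<^sup>2 * \<tau> * win t" if t: "\<tau> \<le> t" for t
  proof -
    have "norm (y t) \<le> norm (w t) + norm (\<Sum>j=1..3. D j t)"
      using norm_triangle_ineq4[of "w t" "\<Sum>j=1..3. D j t"] by (simp add: w_def)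
    also have "\<dots> \<le> norm (w t) + \<kappa> * b * Iu t"
      using norm_sum_D_le[OF t] by simp
    finally have "(norm (y t))\<^sup>2 \<le> (norm (w t) + \<kappa> * b * Iu t)\<^sup>2"
      by (intro power_mono) auto
    also have "\<dots> \<le> 2 * (norm (w t))\<^sup>2 + 2 * (\<kappa> * b * Iu t)\<^sup>2"
      using sum_squares_bound[of "norm (w t)" "\<kappa> * b * Iu t"] by (simp add: power2_sum)
    also have "\<dots> \<le> 2 / c * V t + 2 * ((\<kappa> * b)\<^sup>2 * (\<tau> * win t))"
    proof (rule add_mono)
      show "2 * (norm (w t))\<^sup>2 \<le> 2 / c * V t"
        using c(2)[of "w t"] c(1) by (simp add: V_def field_simps)
      have "(Iu t)\<^sup>2 \<le> \<tau> * win t"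
        using integral_squared_le[of "t - \<tau>" t "\<lambda>s. norm (u s)"] \<tau>_nonneg t
          continuous_on_subset[OF continuous_on_norm[OF contu0], of "{t - \<tau>..t}"]
        by (auto simp: Iu_def win_def)
      then show "2 * (\<kappa> * b * Iu t)\<^sup>2 \<le> 2 * ((\<kappa> * b)\<^sup>2 * (\<tau> * win t))"
        by (simp add: power_mult_distrib[of "\<kappa> * b"] mult_left_mono)
    qed
    finally show ?thesis by (simp add: mult.assoc)
  qed
  have "((\<lambda>t. 2 / c * V t + 2 * (\<kappa> * b)\<^sup>2 * \<tau> * win t) \<longlongrightarrow> 2 / c * 0 + 2 * (\<kappa> * b)\<^sup>2 * \<tau> * 0) at_top"
    by (intro tendsto_intros V0 win0)
  then have lim0: "((\<lambda>t. 2 / c * V t + 2 * (\<kappa> * b)\<^sup>2 * \<tau> * win t) \<longlongrightarrow> 0) at_top"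
    by simp
  have "((\<lambda>t. (norm (y t))\<^sup>2) \<longlongrightarrow> 0) at_top"
    by (rule tendsto_sandwich[OF _ eventually_at_top_linorderI[OF y_le] tendsto_const lim0]) auto
  then have "((\<lambda>t. sqrt ((norm (y t))\<^sup>2)) \<longlongrightarrow> sqrt 0) at_top"
    by (rule tendsto_real_sqrt)
  then show "(y \<longlongrightarrow> 0) at_top"
    by (simp add: tendsto_norm_zero_iff)
qed

end

text \<open>r can be chosen before P because \<open>error_gain\<close> does not involve P. The value
  1 / (N + 1) / (k + 1) meets both smallness conditions of \<open>mode_stable\<close> at
  once.\<close>

theorem delayed_mode_stable:
  fixes A :: "real^'n^'n" and B :: "nat \<Rightarrow> real^'m^'n"
  shows "\<exists>r>0. \<forall>P \<gamma> y v. norm P < r \<longrightarrow> delayed_mode A B d P \<gamma> \<mu> lam y v \<longrightarrow>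
    (y \<longlongrightarrow> 0) at_top \<and>
    (\<exists>C. \<forall>T\<ge>0. integral {0..T} (\<lambda>t. (norm (protocol_map A (delayed_input_matrix A B d)
        (feedback_gain A B d P) (\<Sum>j=1..3. d j) (y t)))\<^sup>2) \<le> C)"
proof -
  define N where "N = norm (transpose (delayed_input_matrix A B d))"
  define k where "k = \<bar>8 * delayed_mode.error_gain A B d \<mu> lam * (\<Sum>j=1..3. d j)\<bar>"
  define r where "r = 1 / (N + 1) / (k + 1)"
  have N: "0 \<le> N" and k: "0 \<le> k" by (auto simp: N_def k_def)
  show ?thesis
  proof (rule exI[of _ r], intro conjI allI impI)
    show "0 < r" using N k by (simp add: r_def)
    fix P \<gamma> y and v :: "real \<Rightarrow> complex^'m"
    assume P: "norm P < r" and "delayed_mode A B d P \<gamma> \<mu> lam y v"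
    then interpret delayed_mode A B d P \<gamma> \<mu> lam y v "delayed_input_matrix A B d" "feedback_gain A B d P"
      "\<Sum>j=1..3. d j" "protocol_map A (delayed_input_matrix A B d) (feedback_gain A B d P) (\<Sum>j=1..3. d j)"
      "\<lambda>t. \<mu> *\<^sub>R (lam *s protocol_map A (delayed_input_matrix A B d) (feedback_gain A B d P) (\<Sum>j=1..3. d j) (y t) + v t)"
      by simp_all
    have "\<delta> = N * norm P" by (simp add: \<delta>_def N_def)
    also have "\<dots> \<le> N * r" using P N by (intro mult_left_mono) auto
    also have "\<dots> = N / (N + 1) * (1 / (k + 1))"
      by (simp add: r_def)
    also have "\<dots> \<le> 1 * (1 / (k + 1))"
      using N k by (intro mult_right_mono) auto
    also have "\<dots> = 1 / (k + 1)" by simp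
    finally have \<delta>: "\<delta> \<le> 1 / (k + 1)" .
    have "8 * (\<delta> * error_gain * (\<Sum>j=1..3. d j)) \<le> \<delta> * k"
      using mult_left_mono[OF abs_ge_self[of "8 * error_gain * (\<Sum>j=1..3. d j)"] const_nonneg(1)] by (simp add: k_def mult_ac)
    also have "\<dots> \<le> 1 / (k + 1) * k"
      using \<delta> k by (rule mult_right_mono)
    also have "\<dots> \<le> 1" using k by (simp add: field_simps)
    finally have 2: "8 * (\<delta> * error_gain * (\<Sum>j=1..3. d j)) \<le> 1" .
    have "1 / (k + 1) \<le> 1" using k by simp
    with \<delta> have 1: "\<delta> \<le> 1" by linarith
    show "(y \<longlongrightarrow> 0) at_top" by (rule mode_stable(1)[OF 1 2])
    show "\<exists>C. \<forall>T\<ge>0. integral {0..T} (\<lambda>t. (norm (protocol_map A (delayed_input_matrix A B d)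
        (feedback_gain A B d P) (\<Sum>j=1..3. d j) (y t)))\<^sup>2) \<le> C"
      by (rule mode_stable(2)[OF 1 2])
  qed
qed

section \<open>The network\<close>

lemma laplacian_mult_nth:
  fixes W :: "real^'v^'v"
  shows "(laplacian W *v c) $ i = (\<Sum>k\<in>UNIV - {i}. W $ i $ k * (c $ i - c $ k))"
proof -
  have "(laplacian W *v c) $ i = laplacian W $ i $ i * c $ i + (\<Sum>k\<in>UNIV - {i}. laplacian W $ i $ k * c $ k)"
    unfolding matrix_vector_mult_def by (simp add: sum.remove[of UNIV i])
  also have "\<dots> = (\<Sum>k\<in>UNIV - {i}. W $ i $ k * c $ i) + (\<Sum>k\<in>UNIV - {i}. - (W $ i $ k * c $ k))"
    by (auto simp: laplacian_def sum_distrib_right intro!: sum.cong)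
  finally show ?thesis
    by (simp add: sum_negf right_diff_distrib sum_subtractf)
qed

text \<open>Maximum principle: at a maximal vertex all terms of a vanishing sum are nonnegative, so
  every in-neighbour is maximal too. This carries the maximum backwards along the path.\<close>

lemma laplacian_kernel_max_propagates:
  fixes W :: "real^'v^'v"
  assumes W: "weighted_adjacency W" and c: "laplacian W *v c = 0" and max: "\<And>k. c $ k \<le> M"
    and path: "(r, i) \<in> (edges W)\<^sup>*" and i: "c $ i = M"
  shows "c $ r = M"
  using path
proof (induction rule: converse_rtrancl_induct)
  case (step j i)
  have "(\<Sum>k\<in>UNIV - {i}. W $ i $ k * (c $ i - c $ k)) = 0"
    using c by (simp flip: laplacian_mult_nth)
  moreover have "0 \<le> W $ i $ k * (c $ i - c $ k)" for k
    using W max[of k] step.IH by (simp add: weighted_adjacency_def)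
  moreover have "W $ i $ j \<noteq> 0"
    using step.hyps(1) by (simp add: edges_def)
  then have "j \<in> UNIV - {i}"
    using W by (auto simp: weighted_adjacency_def)
  ultimately have "W $ i $ j * (c $ i - c $ j) = 0"
    by (subst (asm) sum_nonneg_eq_0_iff) auto
  with \<open>W $ i $ j \<noteq> 0\<close> step.IH show ?case by simp
qed (rule i)

text \<open>The root attains the maximum of c and, by the same argument for - c, its
  minimum.\<close>

lemma laplacian_kernel_constant:
  fixes W :: "real^'v^'v"
  assumes W: "weighted_adjacency W" and tree: "has_directed_spanning_tree W" and c: "laplacian W *v c = 0"
  shows "c $ i = c $ j"
proof -
  obtain T r where T: "T \<subseteq> edges W" and r: "\<And>i. (r, i) \<in> T\<^sup>*"
    using tree by (auto simp: has_directed_spanning_tree_def directed_tree_def)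
  have path: "(r, i) \<in> (edges W)\<^sup>*" for i
    using r rtrancl_mono[OF T] by blast
  have le: "c $ i \<le> c $ r" if c: "laplacian W *v c = 0" for c i
  proof -
    define M where "M = Max (range (($) c))"
    have max: "c $ k \<le> M" for k
      by (simp add: M_def)
    have "M \<in> range (($) c)"
      unfolding M_def by (intro Max_in) auto
    then obtain m where "c $ m = M" by auto
    then have "c $ r = M"
      using laplacian_kernel_max_propagates[OF W c max path] by blast
    with max show ?thesis by simp
  qed
  have "laplacian W *v (- c) = 0"
    using c by (simp add: linear_neg[OF matrix_vector_mul_linear])
  from le[OF this] le[OF c] have "c $ i = c $ r" for i
    by (metis antisym neg_le_iff_le vector_uminus_component)
  then show ?thesis by metis
qed

lemma complex_laplacian_kernel_constant:
  fixes W :: "real^'v^'v"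
  assumes "weighted_adjacency W" "has_directed_spanning_tree W"
    and c: "map_matrix complex_of_real (laplacian W) *v c = 0"
  shows "c $ i = c $ j"
proof -
  have comp: "(map_matrix complex_of_real (laplacian W) *v c) $ k = 0" for k
    using c by simp
  have "laplacian W *v (\<chi> k. Re (c $ k)) = 0"
    unfolding vec_eq_iff
  proof
    fix k
    show "(laplacian W *v (\<chi> k. Re (c $ k))) $ k = 0 $ k"
      using arg_cong[OF comp[of k], of Re] by (simp add: matrix_vector_mult_def)
  qed
  moreover have "laplacian W *v (\<chi> k. Im (c $ k)) = 0"
    unfolding vec_eq_iff
  proof
    fix k
    show "(laplacian W *v (\<chi> k. Im (c $ k))) $ k = 0 $ k"
      using arg_cong[OF comp[of k], of Im] by (simp add: matrix_vector_mult_def)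
  qed
  ultimately show ?thesis
    using laplacian_kernel_constant[OF assms(1,2), of "\<chi> k. Re (c $ k)" i j]
      laplacian_kernel_constant[OF assms(1,2), of "\<chi> k. Im (c $ k)" i j]
    by (simp add: complex_eq_iff)
qed

text \<open>Linear in the weights \<rho>, on which the network then acts through the transposed
  Laplacian.\<close>

definition combination :: "('v \<Rightarrow> real \<Rightarrow> real^'n) \<Rightarrow> complex^'v \<Rightarrow> real \<Rightarrow> complex^'n" where
  "combination x \<rho> t = (\<Sum>l\<in>UNIV. \<rho> $ l *s cvec (x l t))"

lemma combination_add: "combination x (\<rho> + \<sigma>) t = combination x \<rho> t + combination x \<sigma> t"
  by (simp add: combination_def vector_sadd_rdistrib sum.distrib)

lemma combination_smult: "combination x (c *s \<rho>) t = c *s combination x \<rho> t"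
  by (simp add: combination_def vec_eq_iff sum_distrib_left mult.assoc)

lemma combination_0 [simp]: "combination x 0 t = 0"
  by (simp add: combination_def)

lemma combination_axis: "combination x (axis i 1) t = cvec (x i t)"
  by (simp add: combination_def axis_def vec_eq_iff if_distrib if_distribR cong: if_cong)

lemma protocol_map_smult: "protocol_map A B F \<tau> (c *s x) = c *s protocol_map A B F \<tau> x"
  by (simp add: protocol_map_def flow_def cmv_smult)

lemmas linear_protocol_map = bounded_linear.linear[OF bounded_linear_protocol_map]
  and linear_cvec = bounded_linear.linear[OF bounded_linear_cvec]

locale consensus_loop =
  fixes A :: "real^'n^'n" and B :: "nat \<Rightarrow> real^'m^'n" and d :: "nat \<Rightarrow> real"
    and F :: "real^'n^'m" and \<mu> :: real and W :: "real^'v::finite^'v"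
    and x :: "'v \<Rightarrow> real \<Rightarrow> real^'n" and u :: "'v \<Rightarrow> real \<Rightarrow> real^'m"
  fixes Bd \<tau> K Lt
  defines "Bd \<equiv> delayed_input_matrix A B d" and "\<tau> \<equiv> (\<Sum>j=1..3. d j)"
    and "K \<equiv> protocol_map A Bd F \<tau>"
    and "Lt \<equiv> map_matrix complex_of_real (transpose (laplacian W))"
  assumes delays: "0 \<le> d 1" "d 1 \<le> d 2" "d 2 \<le> d 3"
    and dyn: "agent_dynamics A B d u x"
    and prot: "consensus_protocol A Bd F \<mu> \<tau> (d 3) W u x"
begin

lemma delay_range:
  assumes "j \<in> {1..3}" "0 \<le> t"
  shows "- d 3 \<le> t - d j"
proof -
  have "j = 1 \<or> j = 2 \<or> j = 3" using assms by auto
  with assms delays show ?thesis by auto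
qed

lemma cvec_u:
  assumes "- d 3 \<le> t"
  shows "cvec (u i t) = \<mu> *\<^sub>R K (\<Sum>j\<in>UNIV. complex_of_real (laplacian W $ i $ j) *s cvec (x j t))"
proof -
  have "cvec (u i t) = \<mu> *\<^sub>R K (cvec (relative_state W x i t))"
    using prot assms
    by (simp add: consensus_protocol_def linear_cmul[OF linear_cvec] K_def protocol_map_def flow_def cmv_cvec)
  also have "cvec (relative_state W x i t) = (\<Sum>j\<in>UNIV. complex_of_real (laplacian W $ i $ j) *s cvec (x j t))"
    by (simp add: relative_state_def linear_sum[OF linear_cvec] linear_cmul[OF linear_cvec] scaleR_eq_smult)
  finally show ?thesis .
qed

lemma combination_u:
  assumes "- d 3 \<le> t"
  shows "combination u \<rho> t = \<mu> *\<^sub>R K (combination x (Lt *v \<rho>) t)"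
proof -
  have "combination u \<rho> t = \<mu> *\<^sub>R K (\<Sum>i\<in>UNIV. \<rho> $ i *s (\<Sum>j\<in>UNIV. complex_of_real (laplacian W $ i $ j) *s cvec (x j t)))"
  proof -
    have "(\<Sum>i\<in>UNIV. \<rho> $ i *s (\<mu> *\<^sub>R K (X i))) = \<mu> *\<^sub>R K (\<Sum>i\<in>UNIV. \<rho> $ i *s X i)" for X
      by (simp add: K_def linear_sum[OF linear_protocol_map] protocol_map_smult scaleR_eq_smult
          vec.scale_sum_right mult.commute)
    then show ?thesis
      by (simp only: combination_def cvec_u[OF assms])
  qed
  also have "(\<Sum>i\<in>UNIV. \<rho> $ i *s (\<Sum>j\<in>UNIV. complex_of_real (laplacian W $ i $ j) *s cvec (x j t)))
      = combination x (Lt *v \<rho>) t"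
    unfolding combination_def Lt_def vec_eq_iff
    by (simp add: matrix_vector_mult_def transpose_def sum_distrib_left sum_distrib_right, subst sum.swap)
       (simp add: mult_ac)
  finally show ?thesis .
qed

lemma continuous_combination: "continuous_on {- d 3..} (combination x \<rho>)"
  unfolding combination_def[abs_def] using dyn
  by (intro continuous_intros bounded_bilinear.continuous_on[OF bounded_bilinear_smult]
      bounded_linear.continuous_on[OF bounded_linear_cvec]) (auto simp: agent_dynamics_def)

text \<open>For \<rho> an eigenvector of \<open>Lt\<close> this would be a closed single mode; for
  \<rho> in its kernel the input disappears.\<close>

lemma combination_deriv:
  assumes t: "0 \<le> t"
  shows "(combination x \<rho> has_vector_derivative cmv A (combination x \<rho> t)
     + (\<Sum>j=1..3. cmv (B j) (\<mu> *\<^sub>R K (combination x (Lt *v \<rho>) (t - d j))))) (at t within {0..})"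
proof -
  have "(combination x \<rho> has_vector_derivative
      (\<Sum>l\<in>UNIV. \<rho> $ l *s cvec (A *v x l t + (\<Sum>j=1..3. B j *v u l (t - d j))))) (at t within {0..})"
    unfolding combination_def[abs_def] using dyn t
    by (intro has_vector_derivative_sum
        bounded_linear.has_vector_derivative[OF bounded_bilinear.bounded_linear_right[OF bounded_bilinear_smult]]
        bounded_linear.has_vector_derivative[OF bounded_linear_cvec]) (auto simp: agent_dynamics_def)
  moreover have "(\<Sum>l\<in>UNIV. \<rho> $ l *s cvec (A *v x l t + (\<Sum>j=1..3. B j *v u l (t - d j))))
      = cmv A (combination x \<rho> t) + (\<Sum>j=1..3. cmv (B j) (combination u \<rho> (t - d j)))"
    unfolding combination_def
    by (simp add: linear_add[OF linear_cvec] linear_sum[OF linear_cvec] cmv.sum_right cmv_smult cmv_cvec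
        vector_add_ldistrib sum.distrib vec.scale_sum_right) (rule sum.swap)
  moreover have "(\<Sum>j=1..3. cmv (B j) (combination u \<rho> (t - d j)))
      = (\<Sum>j=1..3. cmv (B j) (\<mu> *\<^sub>R K (combination x (Lt *v \<rho>) (t - d j))))"
    using delay_range t by (intro sum.cong refl) (simp add: combination_u)
  ultimately show ?thesis by simp
qed

text \<open>
  Acting with one factor \<open>L - \<lambda>\<^sub>i\<close> at a time turns the network into a cascade of single modes,
  each driven by the next one.
\<close>

lemma cascade_stable:
  fixes S :: "nat set"
  assumes "finite S"
    and stable: "\<And>i y v. i \<in> S \<Longrightarrow> delayed_mode A B d P \<gamma> \<mu> (ev i) y v \<Longrightarrow>
      (y \<longlongrightarrow> 0) at_top \<and> (\<exists>C. \<forall>T\<ge>0. integral {0..T} (\<lambda>t. (norm (K (y t)))\<^sup>2) \<le> C)"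
    and F: "F = feedback_gain A B d P"
    and P: "positive_definite P" "riccati_solution A Bd \<gamma> P" "0 < \<gamma>" "0 < \<mu>"
    and ev: "\<And>i. i \<in> S \<Longrightarrow> 1 \<le> \<mu> * Re (ev i)"
    and "poly_act Lt (\<Prod>i\<in>S. [:- ev i, 1:]) \<rho> = 0"
  shows "(combination x \<rho> \<longlongrightarrow> 0) at_top
       \<and> (\<exists>C. \<forall>T\<ge>0. integral {0..T} (\<lambda>t. (norm (K (combination x \<rho> t)))\<^sup>2) \<le> C)"
  using assms(1) stable ev assms(9)
proof (induction S arbitrary: \<rho>)
  case empty
  then have "\<rho> = 0" by simp
  then show ?case
    by (auto simp: K_def combination_def[abs_def] linear_0[OF linear_protocol_map])
next
  case (insert i S)
  \<comment> \<open>\<sigma> is annihilated by the remaining factors. The product runs over indices,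
    so a repeated eigenvalue contributes several links.\<close>
  define \<sigma> where "\<sigma> = poly_act Lt [:- ev i, 1:] \<rho>"
  have "poly_act Lt (\<Prod>i\<in>S. [:- ev i, 1:]) \<sigma> = 0"
    using insert.prems(3) insert.hyps unfolding \<sigma>_def
    by (simp add: mult.commute flip: poly_act_mult del: poly_act_pCons mult_pCons_left mult_pCons_right)
  then have IH: "\<exists>C. \<forall>T\<ge>0. integral {0..T} (\<lambda>t. (norm (K (combination x \<sigma> t)))\<^sup>2) \<le> C"
    using insert.IH insert.prems(1,2) by blast
  have "Lt *v \<rho> = ev i *s \<rho> + \<sigma>"
    by (simp add: \<sigma>_def poly_act_linear_factor del: poly_act_pCons)
  then have split: "K (combination x (Lt *v \<rho>) t) = ev i *s K (combination x \<rho> t) + K (combination x \<sigma> t)" for t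
    by (simp add: combination_add combination_smult K_def linear_add[OF linear_protocol_map] protocol_map_smult)
  have "delayed_mode A B d P \<gamma> \<mu> (ev i) (combination x \<rho>) (\<lambda>t. K (combination x \<sigma> t))"
  proof (unfold_locales, unfold F[symmetric] Bd_def[symmetric] \<tau>_def[symmetric] K_def[symmetric])
    show "continuous_on {- d 3..} (\<lambda>t. K (combination x \<sigma> t))"
      unfolding K_def by (intro bounded_linear.continuous_on[OF bounded_linear_protocol_map] continuous_combination)
    show "(combination x \<rho> has_vector_derivative cmv A (combination x \<rho> t) +
        (\<Sum>j=1..3. cmv (B j) (\<mu> *\<^sub>R (ev i *s K (combination x \<rho> (t - d j)) + K (combination x \<sigma> (t - d j))))))
        (at t within {0..})" if "0 \<le> t" for t
      using combination_deriv[OF that, of \<rho>] by (simp only: split)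
  qed (use delays P IH insert.prems(2) continuous_combination in auto)
  then show ?case
    by (rule insert.prems(1)[rotated]) simp
qed

end

section \<open>Return to real trajectories and conclusion\<close>

definition revec :: "complex^'n \<Rightarrow> real^'n" where
  "revec z = (\<chi> n. Re (z $ n))"

lemma bounded_linear_revec: "bounded_linear revec"
  by (intro linear_conv_bounded_linear[THEN iffD1] linearI) (simp_all add: revec_def vec_eq_iff)

lemma norm_revec_le: "norm (revec z) \<le> norm z"
  unfolding norm_vec_def revec_def by (intro L2_set_mono) (auto simp: abs_Re_le_cmod)

lemma revec_cvec [simp]: "revec (cvec v) = v"
  by (simp add: revec_def cvec_def vec_eq_iff)

lemma revec_cmv: "revec (cmv M z) = M *v revec z"
  by (simp add: revec_def vec_eq_iff cmv_nth matrix_vector_mult_def)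

text \<open>The order of the quantifiers carries the dependences: \<open>\<gamma>s\<close> precedes
  W, so that the graph enters it through \<open>ev\<close> alone, and \<open>k\<close> precedes the
  trajectory. The factored characteristic polynomial lists the eigenvalues with
  multiplicity.\<close>

theorem theorem2:
  fixes A :: "real^'n^'n" and B :: "nat \<Rightarrow> real^'m^'n" and d :: "nat \<Rightarrow> real"
    and \<mu> :: real and ev :: "nat \<Rightarrow> complex"
  assumes delays: "0 \<le> d 1" "d 1 \<le> d 2" "d 2 \<le> d 3"
    and controllable: "controllable A (delayed_input_matrix A B d)"
    and imaginary: "\<forall>a\<in>eigenvalues A. Re a = 0"
    and Re_pos: "\<forall>i\<in>{2..CARD('v::finite)}. 0 < Re (ev i)"
    and mu_pos: "0 < \<mu>"
    and mu_ge: "\<forall>i\<in>{2..CARD('v)}. 1 / Re (ev i) \<le> \<mu>"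
  shows "\<exists>\<gamma>s>0. \<forall>W :: real^'v^'v.
           weighted_adjacency W \<and> has_directed_spanning_tree W \<and>
           charpoly (laplacian W) = [:0, 1:] * (\<Prod>i=2..CARD('v). [:- ev i, 1:]) \<longrightarrow>
           (\<forall>\<gamma> P. 0 < \<gamma> \<and> \<gamma> < \<gamma>s \<and> positive_definite P \<and>
               riccati_solution A (delayed_input_matrix A B d) \<gamma> P \<longrightarrow>
             (\<forall>\<phi> x. closed_loop_trajectory A B d (feedback_gain A B d P) \<mu> W \<phi> x \<longrightarrow> consensus x) \<and>
             (\<exists>k :: ('v \<Rightarrow> real \<Rightarrow> real^'n) \<Rightarrow> real. (\<forall>\<phi>. 0 < k \<phi>) \<and>
               (\<forall>\<phi> x. closed_loop_trajectory A B d (feedback_gain A B d P) \<mu> W \<phi> x \<longrightarrow>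
                 (\<exists>s. reference_trajectory x s \<and>
                   (\<forall>t\<ge>0. norm (s t) \<le> k \<phi> * (1 + t ^ (max_algebraic_multiplicity A - 1)))))))"
proof -
  let ?Bd = "delayed_input_matrix A B d"
  let ?K = "\<lambda>P. protocol_map A ?Bd (feedback_gain A B d P) (\<Sum>j=1..3. d j)"
  have ev: "1 \<le> \<mu> * Re (ev i)" if "i \<in> {2..CARD('v)}" for i
    using mu_ge Re_pos that by (simp add: pos_divide_le_eq)
  have "\<forall>i. \<exists>r>0. \<forall>P \<gamma> y v. norm P < r \<longrightarrow> delayed_mode A B d P \<gamma> \<mu> (ev i) y v \<longrightarrow>
    (y \<longlongrightarrow> 0) at_top \<and> (\<exists>C. \<forall>T\<ge>0. integral {0..T} (\<lambda>t. (norm (?K P (y t)))\<^sup>2) \<le> C)"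
    using delayed_mode_stable by blast
  then obtain r where r: "\<And>i. 0 < r i"
    and stable: "\<And>i P \<gamma> y v. norm P < r i \<Longrightarrow> delayed_mode A B d P \<gamma> \<mu> (ev i) y v \<Longrightarrow>
      (y \<longlongrightarrow> 0) at_top \<and> (\<exists>C. \<forall>T\<ge>0. integral {0..T} (\<lambda>t. (norm (?K P (y t)))\<^sup>2) \<le> C)"
    by metis
  \<comment> \<open>The extra 1 keeps the minimum defined for a single agent.\<close>
  define \<epsilon> where "\<epsilon> = Min (insert 1 (r ` {2..CARD('v)}))"
  have "0 < \<epsilon>" by (simp add: \<epsilon>_def r)
  have \<epsilon>_le: "\<epsilon> \<le> r i" if "i \<in> {2..CARD('v)}" for i
    using that unfolding \<epsilon>_def by (intro Min_le) auto
  obtain \<gamma>s where "0 < \<gamma>s"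
    and small: "\<And>\<gamma> P. 0 < \<gamma> \<Longrightarrow> \<gamma> < \<gamma>s \<Longrightarrow> positive_definite P \<Longrightarrow> riccati_solution A ?Bd \<gamma> P \<Longrightarrow> norm P < \<epsilon>"
    using riccati_solution_small[OF controllable imaginary \<open>0 < \<epsilon>\<close>] by blast
  obtain C where "0 \<le> C" and growth: "\<And>s t. (\<And>t. 0 \<le> t \<Longrightarrow> (s has_vector_derivative A *v s t) (at t within {0..})) \<Longrightarrow>
      0 \<le> t \<Longrightarrow> norm (s t) \<le> C * (1 + t ^ (max_algebraic_multiplicity A - 1)) * norm (s 0)"
    using imaginary_eigenvalues_growth[OF imaginary] by blast
  show ?thesis
  proof (rule exI[of _ \<gamma>s], rule conjI[OF \<open>0 < \<gamma>s\<close>], rule allI, rule impI)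
    fix W :: "real^'v^'v"
    assume "weighted_adjacency W \<and> has_directed_spanning_tree W \<and>
      charpoly (laplacian W) = [:0, 1:] * (\<Prod>i=2..CARD('v). [:- ev i, 1:])"
    then have W: "weighted_adjacency W" "has_directed_spanning_tree W"
      and cp: "charpoly (laplacian W) = [:0, 1:] * (\<Prod>i=2..CARD('v). [:- ev i, 1:])" by auto
    define q where "q = (\<Prod>i=2..CARD('v). [:- ev i, 1:])"
    define Lc Lt where "Lc = map_matrix complex_of_real (laplacian W)"
      and "Lt = map_matrix complex_of_real (transpose (laplacian W))"
    have Lt: "Lt = transpose Lc"
      by (simp add: Lt_def Lc_def transpose_def vec_eq_iff)
    have cpq: "charpoly (laplacian W) = [:0, 1:] * q"
      by (simp only: cp q_def)
    have q0: "poly q 0 \<noteq> 0"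
      using Re_pos by (force simp: q_def poly_prod)
    have kill_Lc: "Lc *v poly_act Lc q \<rho> = 0" for \<rho>
    proof -
      have "poly_act Lc ([:0, 1:] * q) \<rho> = 0"
        using poly_act_charpoly[of "laplacian W" \<rho>] unfolding cpq Lc_def .
      then show ?thesis
        unfolding poly_act_mult by simp
    qed
    have kill_Lt: "Lt *v poly_act Lt q \<rho> = 0" for \<rho>
    proof -
      have "poly_act Lt ([:0, 1:] * q) \<rho> = 0"
        using poly_act_charpoly[of "transpose (laplacian W)" \<rho>] unfolding charpoly_transpose cpq Lt_def .
      then show ?thesis
        unfolding poly_act_mult by simp
    qed
    \<comment> \<open>\<open>R i\<close> is row i of q(L) / q(0), the spectral projection onto the
      kernel of L.\<close>
    define R where "R i = (1 / poly q 0) *s poly_act Lt q (axis i 1)" for i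
    \<comment> \<open>The columns of q(L) lie in the kernel of L and are therefore constant, which
      makes all rows equal.\<close>
    have R_const: "R i = R j" for i j
    proof -
      have "R i $ k = (1 / poly q 0) * poly_act Lc q (axis k 1) $ i" for i k
        using poly_act_transpose[of Lc q "axis i 1" "axis k 1"]
        by (simp add: R_def Lt axis_def if_distrib if_distribR cong: if_cong)
      then show ?thesis
        using complex_laplacian_kernel_constant[OF W kill_Lc[unfolded Lc_def], of _ i j]
        by (simp add: vec_eq_iff Lc_def)
    qed
    have Lt_R: "Lt *v R i = 0" for i
      by (simp add: R_def matrix_vector_mult_smult kill_Lt)
    \<comment> \<open>On the kernel of \<open>Lt\<close> the polynomial q acts as the scalar q(0),
      so q takes the same value on \<open>R i\<close> and on the unit vector.\<close>
    have q_R: "poly_act Lt q (axis i 1 - R i) = 0" for i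
    proof -
      obtain g where g: "q = pCons (poly q 0) g"
        by (metis pCons_cases poly_pCons mult_zero_left add.right_neutral)
      have "poly_act Lt q (R i) = poly q 0 *s R i + Lt *v poly_act Lt g (R i)"
        by (subst g) (simp only: poly_act_pCons)
      also have "Lt *v poly_act Lt g (R i) = poly_act Lt g (Lt *v R i)"
        using poly_act_mult_commute[of Lt g "[:0, 1:]" "R i"] by simp
      also have "poly q 0 *s R i + \<dots> = poly_act Lt q (axis i 1)"
        unfolding Lt_R using q0 by (simp add: R_def vector_smult_assoc)
      finally show ?thesis by (simp add: poly_act_diff)
    qed
    note Lt_R' = Lt_R[unfolded Lt_def] and q_R' = q_R[unfolded q_def Lt_def]
    define i0 :: 'v where "i0 = undefined"
    \<comment> \<open>The summand 1 keeps \<open>k\<close> positive when the projected initial state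
      is 0.\<close>
    define k where "k \<phi> = C * norm (revec (combination \<phi> (R i0) 0)) + 1" for \<phi> :: "'v \<Rightarrow> real \<Rightarrow> real^'n"
    have k_pos: "0 < k \<phi>" for \<phi>
      unfolding k_def using \<open>0 \<le> C\<close> by (intro add_nonneg_pos mult_nonneg_nonneg) auto
    have main: "reference_trajectory x (\<lambda>t. revec (combination x (R i0) t)) \<and>
        (\<forall>t\<ge>0. norm (revec (combination x (R i0) t)) \<le> k \<phi> * (1 + t ^ (max_algebraic_multiplicity A - 1)))"
      if \<gamma>: "0 < \<gamma>" "\<gamma> < \<gamma>s" and P: "positive_definite P" "riccati_solution A ?Bd \<gamma> P"
        and traj: "closed_loop_trajectory A B d (feedback_gain A B d P) \<mu> W \<phi> x" for \<gamma> P \<phi> x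
    proof
      obtain u where "agent_dynamics A B d u x"
        "consensus_protocol A ?Bd (feedback_gain A B d P) \<mu> (\<Sum>j=1..3. d j) (d 3) W u x"
        using traj by (auto simp: closed_loop_trajectory_def)
      then interpret consensus_loop A B d "feedback_gain A B d P" \<mu> W x u ?Bd "\<Sum>j=1..3. d j" "?K P"
          "map_matrix complex_of_real (transpose (laplacian W))"
        using delays by unfold_locales auto
      have norm_P: "norm P < r i" if "i \<in> {2..CARD('v)}" for i
        using small[OF \<gamma> P] \<epsilon>_le[OF that] by simp
      have "(combination x (axis i 1 - R i) \<longlongrightarrow> 0) at_top" for i
      proof (rule conjunct1[OF cascade_stable[OF _ _ refl P \<gamma>(1) mu_pos ev q_R']])
        show "(y \<longlongrightarrow> 0) at_top \<and> (\<exists>C. \<forall>T\<ge>0. integral {0..T} (\<lambda>t. (norm (?K P (y t)))\<^sup>2) \<le> C)"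
          if "i \<in> {2..CARD('v)}" "delayed_mode A B d P \<gamma> \<mu> (ev i) y v" for i y v
          by (rule stable[OF norm_P[OF that(1)] that(2)])
      qed simp_all
      then have lim: "((\<lambda>t. norm (combination x (axis i 1 - R i) t)) \<longlongrightarrow> 0) at_top" for i
        by (rule tendsto_norm_zero)
      show "reference_trajectory x (\<lambda>t. revec (combination x (R i0) t))"
        unfolding reference_trajectory_def
      proof
        fix i
        have "x i t - revec (combination x (R i0) t) = revec (combination x (axis i 1 - R i) t)" for t
        proof -
          have "combination x (axis i 1) t = combination x (axis i 1 - R i) t + combination x (R i) t"
            by (simp flip: combination_add)
          then have "x i t = revec (combination x (axis i 1 - R i) t + combination x (R i) t)"
            by (metis combination_axis revec_cvec)
          then show ?thesis
            by (simp add: linear_add[OF bounded_linear.linear[OF bounded_linear_revec]] R_const[of i i0])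
        qed
        then have "norm (x i t - revec (combination x (R i0) t)) \<le> norm (combination x (axis i 1 - R i) t)" for t
          by (simp add: norm_revec_le)
        then show "((\<lambda>t. norm (x i t - revec (combination x (R i0) t))) \<longlongrightarrow> 0) at_top"
          by (intro tendsto_sandwich[OF _ _ tendsto_const lim[of i]] always_eventually allI) auto
      qed
      show "\<forall>t\<ge>0. norm (revec (combination x (R i0) t)) \<le> k \<phi> * (1 + t ^ (max_algebraic_multiplicity A - 1))"
      proof (intro allI impI)
        fix t :: real assume t: "0 \<le> t"
        have "((\<lambda>t. revec (combination x (R i0) t)) has_vector_derivative A *v revec (combination x (R i0) t)) (at t within {0..})"
          if "0 \<le> t" for t
        proof -
          \<comment> \<open>The weights lie in the kernel of \<open>Lt\<close>, so the inputs cancel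
            and the plant runs freely.\<close>
          have "(combination x (R i0) has_vector_derivative cmv A (combination x (R i0) t)) (at t within {0..})"
            using combination_deriv[OF that, of "R i0"]
            by (simp add: Lt_R' linear_0[OF linear_protocol_map] cmv.zero_right)
          from bounded_linear.has_vector_derivative[OF bounded_linear_revec this] show ?thesis
            by (simp only: revec_cmv)
        qed
        from growth[OF this t]
        have "norm (revec (combination x (R i0) t))
            \<le> C * (1 + t ^ (max_algebraic_multiplicity A - 1)) * norm (revec (combination x (R i0) 0))" .
        also have "combination x (R i0) 0 = combination \<phi> (R i0) 0"
          using traj delays by (simp add: combination_def closed_loop_trajectory_def)
        also have "C * (1 + t ^ (max_algebraic_multiplicity A - 1)) * norm (revec (combination \<phi> (R i0) 0))
            \<le> k \<phi> * (1 + t ^ (max_algebraic_multiplicity A - 1))"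
          using t by (simp add: k_def algebra_simps)
        finally show "norm (revec (combination x (R i0) t)) \<le> k \<phi> * (1 + t ^ (max_algebraic_multiplicity A - 1))" .
      qed
    qed
    have consensus: "consensus x" if "reference_trajectory x s" for x :: "'v \<Rightarrow> real \<Rightarrow> real^'n" and s
      unfolding consensus_def
    proof (intro allI)
      fix i j
      have "((\<lambda>t. norm (x i t - s t) + norm (x j t - s t)) \<longlongrightarrow> 0 + 0) at_top"
        using that unfolding reference_trajectory_def by (intro tendsto_add) auto
      then have lim: "((\<lambda>t. norm (x i t - s t) + norm (x j t - s t)) \<longlongrightarrow> 0) at_top"
        by simp
      have "norm (x i t - x j t) \<le> norm (x i t - s t) + norm (x j t - s t)" for t
        using norm_triangle_ineq4[of "x i t - s t" "x j t - s t"] by simp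
      then show "((\<lambda>t. norm (x i t - x j t)) \<longlongrightarrow> 0) at_top"
        by (intro tendsto_sandwich[OF _ _ tendsto_const lim] always_eventually allI) auto
    qed
    show "\<forall>\<gamma> P. 0 < \<gamma> \<and> \<gamma> < \<gamma>s \<and> positive_definite P \<and> riccati_solution A ?Bd \<gamma> P \<longrightarrow>
             (\<forall>\<phi> x. closed_loop_trajectory A B d (feedback_gain A B d P) \<mu> W \<phi> x \<longrightarrow> consensus x) \<and>
             (\<exists>k :: ('v \<Rightarrow> real \<Rightarrow> real^'n) \<Rightarrow> real. (\<forall>\<phi>. 0 < k \<phi>) \<and>
               (\<forall>\<phi> x. closed_loop_trajectory A B d (feedback_gain A B d P) \<mu> W \<phi> x \<longrightarrow>
                 (\<exists>s. reference_trajectory x s \<and>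
                   (\<forall>t\<ge>0. norm (s t) \<le> k \<phi> * (1 + t ^ (max_algebraic_multiplicity A - 1))))))"
    proof (intro allI impI, elim conjE, rule conjI)
      fix \<gamma> P
      assume *: "0 < \<gamma>" "\<gamma> < \<gamma>s" "positive_definite P" "riccati_solution A ?Bd \<gamma> P"
      show "\<forall>\<phi> x. closed_loop_trajectory A B d (feedback_gain A B d P) \<mu> W \<phi> x \<longrightarrow> consensus x"
        using main[OF *] consensus by blast
      show "\<exists>k :: ('v \<Rightarrow> real \<Rightarrow> real^'n) \<Rightarrow> real. (\<forall>\<phi>. 0 < k \<phi>) \<and>
               (\<forall>\<phi> x. closed_loop_trajectory A B d (feedback_gain A B d P) \<mu> W \<phi> x \<longrightarrow>
                 (\<exists>s. reference_trajectory x s \<and>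
                   (\<forall>t\<ge>0. norm (s t) \<le> k \<phi> * (1 + t ^ (max_algebraic_multiplicity A - 1)))))"
        using main[OF *] k_pos by blast
    qed
  qed
qed

end
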